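(* Let $S$ be a nonempty set and $G$ a group of permutations of $S$. Then the twisted Brin–Thompson group $SV_G$ is simple. Moreover, if $SV_G$ is finitely generated, then it can be generated by two elements of finite order.
   Context: Let $\mathfrak C=\{0,1\}^{\omega}$ be the Cantor set, $S$ a nonempty set, and $G$ a subgroup of the symmetric group of $S$. Let $\mathfrak C^S$ be the space of all functions $S\to\mathfrak C$ with the product topology. For a function $\psi\colon S\to\{0,1\}^*$ with $\psi(s)=\varnothing$ for all but finitely many $s$, the dyadic brick $B(\psi)$ is the set of $\kappa\in\mathfrak C^S$ such that $\psi(s)$ is a prefix of $\kappa(s)$ for all $s\in S$; the canonical homeomorphism $\Phi_\psi\colon\mathfrak C^S\to B(\psi)$ is $\Phi_\psi(\kappa)(s)=\psi(s)\cdot\kappa(s)$. For $\gamma\in G$ let $\tau_\gamma(\kappa)(s)=\kappa(\gamma^{-1}s)$. The twist homeomorphism $B(\varphi)\to B(\psi)$ associated to $\gamma$ is $\Phi_\psi\circ\tau_\gamma\circ\Phi_\varphi^{-1}$. The twisted Brin–Thompson group $SV_G$ is the group of all homeomorphisms $h$ of $\mathfrak C^S$ for which there exist two partitions $B(\varphi_1),\dots,B(\varphi_n)$ and $B(\psi_1),\dots,B(\psi_n)$ of $\mathfrak C^S$ into dyadic bricks and $\gamma_1,\dots,\gamma_n\in G$ such that $h|_{B(\varphi_i)}$ is the twist homeomorphism $B(\varphi_i)\to B(\psi_i)$ associated to $\gamma_i$. *)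

theory Defs
  imports "HOL-Analysis.Analysis" "HOL-Algebra.Algebra"
begin

text \<open>The Cantor set \<open>{0,1}^\<omega>\<close> is modelled as \<open>nat \<Rightarrow> bool\<close> with the product of
discrete topologies; the set \<open>S\<close> is the (nonempty) type \<open>'s\<close>; points of \<open>\<frak>C^S\<close> are
functions \<open>'s \<Rightarrow> nat \<Rightarrow> bool\<close>; finite words are \<open>bool list\<close>.\<close>

definition cantor_top :: "(nat \<Rightarrow> bool) topology" where
  "cantor_top = product_topology (\<lambda>_. discrete_topology UNIV) UNIV"

definition cantorS_top :: "('s \<Rightarrow> nat \<Rightarrow> bool) topology" where
  "cantorS_top = product_topology (\<lambda>_. cantor_top) UNIV"

definition is_prefix :: "bool list \<Rightarrow> (nat \<Rightarrow> bool) \<Rightarrow> bool" where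
  "is_prefix w x \<longleftrightarrow> (\<forall>i < length w. x i = w ! i)"

definition concat_seq :: "bool list \<Rightarrow> (nat \<Rightarrow> bool) \<Rightarrow> (nat \<Rightarrow> bool)" where
  "concat_seq w x = (\<lambda>i. if i < length w then w ! i else x (i - length w))"

definition brick_label :: "('s \<Rightarrow> bool list) \<Rightarrow> bool" where
  "brick_label \<psi> \<longleftrightarrow> finite {s. \<psi> s \<noteq> []}"

definition brick :: "('s \<Rightarrow> bool list) \<Rightarrow> ('s \<Rightarrow> nat \<Rightarrow> bool) set" where
  "brick \<psi> = {\<kappa>. \<forall>s. is_prefix (\<psi> s) (\<kappa> s)}"

definition Phi :: "('s \<Rightarrow> bool list) \<Rightarrow> ('s \<Rightarrow> nat \<Rightarrow> bool) \<Rightarrow> ('s \<Rightarrow> nat \<Rightarrow> bool)" where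
  "Phi \<psi> \<kappa> = (\<lambda>s. concat_seq (\<psi> s) (\<kappa> s))"

definition Phi_inv :: "('s \<Rightarrow> bool list) \<Rightarrow> ('s \<Rightarrow> nat \<Rightarrow> bool) \<Rightarrow> ('s \<Rightarrow> nat \<Rightarrow> bool)" where
  "Phi_inv \<psi> \<kappa> = (\<lambda>s i. \<kappa> s (i + length (\<psi> s)))"

definition tau :: "('s \<Rightarrow> 's) \<Rightarrow> ('s \<Rightarrow> nat \<Rightarrow> bool) \<Rightarrow> ('s \<Rightarrow> nat \<Rightarrow> bool)" where
  "tau \<gamma> \<kappa> = (\<lambda>s. \<kappa> (inv_into UNIV \<gamma> s))"

definition twist :: "('s \<Rightarrow> bool list) \<Rightarrow> ('s \<Rightarrow> bool list) \<Rightarrow> ('s \<Rightarrow> 's)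
    \<Rightarrow> ('s \<Rightarrow> nat \<Rightarrow> bool) \<Rightarrow> ('s \<Rightarrow> nat \<Rightarrow> bool)" where
  "twist \<phi> \<psi> \<gamma> = Phi \<psi> \<circ> tau \<gamma> \<circ> Phi_inv \<phi>"

definition brick_partition :: "('s \<Rightarrow> bool list) list \<Rightarrow> bool" where
  "brick_partition \<phi>s \<longleftrightarrow>
     (\<forall>i < length \<phi>s. brick_label (\<phi>s ! i)) \<and>
     (\<forall>i < length \<phi>s. \<forall>j < length \<phi>s. i \<noteq> j \<longrightarrow> brick (\<phi>s ! i) \<inter> brick (\<phi>s ! j) = {}) \<and>
     (\<Union>i < length \<phi>s. brick (\<phi>s ! i)) = UNIV"

definition SV :: "('s \<Rightarrow> 's) set \<Rightarrow> (('s \<Rightarrow> nat \<Rightarrow> bool) \<Rightarrow> ('s \<Rightarrow> nat \<Rightarrow> bool)) set" where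
  "SV G = {h. homeomorphic_map cantorS_top cantorS_top h \<and>
     (\<exists>\<phi>s \<psi>s \<gamma>s. length \<psi>s = length \<phi>s \<and> length \<gamma>s = length \<phi>s \<and>
        brick_partition \<phi>s \<and> brick_partition \<psi>s \<and> set \<gamma>s \<subseteq> G \<and>
        (\<forall>i < length \<phi>s. \<forall>\<kappa> \<in> brick (\<phi>s ! i).
            h \<kappa> = twist (\<phi>s ! i) (\<psi>s ! i) (\<gamma>s ! i) \<kappa>))}"

definition SV_group :: "('s \<Rightarrow> 's) set \<Rightarrow> (('s \<Rightarrow> nat \<Rightarrow> bool) \<Rightarrow> ('s \<Rightarrow> nat \<Rightarrow> bool)) monoid" where
  "SV_group G = \<lparr>carrier = SV G, mult = (\<circ>), one = id\<rparr>"

text \<open>Simplicity for possibly infinite groups (HOL-Algebra's \<open>simple_group\<close> requires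
\<open>order G > 1\<close>, which fails for infinite groups since \<open>card\<close> of an infinite set is 0).\<close>
definition simple_grp :: "('a, 'b) monoid_scheme \<Rightarrow> bool" where
  "simple_grp H \<longleftrightarrow> group H \<and> carrier H \<noteq> {\<one>\<^bsub>H\<^esub>} \<and>
     (\<forall>N. N \<lhd> H \<longrightarrow> N = {\<one>\<^bsub>H\<^esub>} \<or> N = carrier H)"

definition finitely_generated :: "('a, 'b) monoid_scheme \<Rightarrow> bool" where
  "finitely_generated H \<longleftrightarrow> (\<exists>A. finite A \<and> A \<subseteq> carrier H \<and> generate H A = carrier H)"

definition finite_order :: "('a, 'b) monoid_scheme \<Rightarrow> 'a \<Rightarrow> bool" where
  "finite_order H x \<longleftrightarrow> (\<exists>n::nat. n > 0 \<and> x [^]\<^bsub>H\<^esub> n = \<one>\<^bsub>H\<^esub>)"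

end

theory Submission
  imports Defs
begin

text \<open>Call an involution a swap if it exchanges a clopen set \<open>D\<close> with a disjoint clopen set,
  fixes everything else, and moves points of a proper clopen subset only.

  Simplicity. The group is transitive on proper nonempty clopen sets, so by halving \<open>D\<close> every
  swap is a commutator of two involutions supported in one proper clopen set. A nontrivial
  normal subgroup displaces some clopen set, hence contains the commutators of all pairs of
  elements supported there, hence all swaps. It remains to see that swaps generate. Modulo
  swaps, all copies of an element \<open>g\<close> on proper bricks agree, and the product of two such
  copies differs from \<open>g\<close> only by factors that move one letter past the labels of the bricks
  on which \<open>g\<close> is a twist. If these factors are products of swaps, then the class \<open>x\<close> of a
  copy satisfies \<open>x = x * x\<close>, so it is trivial. This is applied first with all twists equal
  to the identity, then in general.

  Generation. If the group is finitely generated, it is generated by finitely many commutators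
  of involutions \<open>w i\<close>. Transport the \<open>w i\<close> to a small clopen set \<open>Y\<close>, let \<open>a\<close> be a rotation
  of finite order permuting the levels of a clopen partition, and let \<open>b\<close> be the product of
  the conjugates of \<open>w i\<close> under \<open>a ^^ (4 ^ (i + 1))\<close>. As the exponents form a Sidon set, the
  commutator of two translates of \<open>b\<close> is that of \<open>w i\<close> and \<open>w j\<close>, so \<open>a\<close> and \<open>b\<close> generate
  all elements supported in \<open>Y\<close>. As \<open>Y\<close> consists of two adjacent levels, its translates
  overlap and all swaps are obtained.\<close>

text \<open>The group-theoretic arguments see only bijections acting on an algebra of clopen sets.
  Words and coordinates enter in transitivity, in the embedding of the space onto a brick, and in
  the generation by swaps. Transitivity meets no counting obstruction, because cutting a brick in
  two raises the number of bricks by exactly one. The two rounds of the generation argument have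
  this reason. If \<open>g\<close> twists a brick by \<gamma>, it carries a letter standing behind
  the label at coordinate \<open>s\<close> to coordinate \<gamma> \<open>s\<close>, whereas two
  copies of \<open>g\<close> leave that letter at \<open>s\<close>. The factor repairing this
  permutes no coordinates of the tails, so it lies in the group for \<open>{id}\<close>; inside that
  group there is nothing to repair. Properness of swaps is the other constraint: the bricks of the
  words \<open>False\<close> and \<open>True\<close> fill the space, so no swap exchanges them, and
  smaller bricks have to mediate. For the two generators, the number of levels is chosen so large
  that a sum of two exponents never wraps around; thus the Sidon property survives the reduction
  modulo that number.\<close>

unbundle no m_inv_syntax

section \<open>Flexible actions\<close>

lemma funpow_mem:
  assumes "id \<in> H" "\<And>x y. x \<in> H \<Longrightarrow> y \<in> H \<Longrightarrow> x \<circ> y \<in> H" "a \<in> H"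
  shows "a ^^ n \<in> H"
  by (induction n) (use assms in \<open>simp_all del: o_apply add: id_def[symmetric]\<close>)

text \<open>The larger exponents on the two sides agree: two summands of at most
  \<open>4 ^ b\<close> stay below \<open>4 ^ (b + 1)\<close>, so a strictly larger top exponent
  would win. Cancelling the top powers leaves the smaller ones.\<close>

lemma pow4_sum_eq:
  fixes a b c d :: nat
  assumes "4 ^ a + 4 ^ b = (4 ^ c + 4 ^ d :: nat)"
  shows "(a = c \<and> b = d) \<or> (a = d \<and> b = c)"
proof -
  have *: "\<not> b < d" if "c \<le> d" "a \<le> b" "4 ^ a + 4 ^ b = (4 ^ c + 4 ^ d :: nat)" for a b c d :: nat
  proof
    assume "b < d"
    then have "(4::nat) * 4 ^ b \<le> 4 ^ d"
      by (metis Suc_leI power_Suc power_increasing one_le_numeral)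
    moreover have "(4::nat) ^ a \<le> 4 ^ b" using that by simp
    moreover have "(4::nat) ^ b > 0" by simp
    ultimately show False using that(3) by linarith
  qed
  have **: "b = d" if "c \<le> d" "a \<le> b" "4 ^ a + 4 ^ b = (4 ^ c + 4 ^ d :: nat)" for a b c d :: nat
    using *[OF that] *[OF that(2,1) that(3)[symmetric]] by simp
  have inj: "x = y" if "(4::nat) ^ x = 4 ^ y" for x y :: nat using that by simp
  consider "a \<le> b" "c \<le> d" | "a \<le> b" "d \<le> c" | "b \<le> a" "c \<le> d" | "b \<le> a" "d \<le> c" by linarith
  then show ?thesis
  proof cases
    case 1
    then have "b = d" using **[of c d a b] assms by simp
    then show ?thesis using assms inj[of a c] by auto
  next
    case 2
    then have "b = c" using **[of d c a b] assms by (simp add: add.commute)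
    then show ?thesis using assms inj[of a d] by auto
  next
    case 3
    then have "a = d" using **[of c d b a] assms by (simp add: add.commute)
    then show ?thesis using assms inj[of b c] by auto
  next
    case 4
    then have "a = c" using **[of d c b a] assms by (simp add: add.commute)
    then show ?thesis using assms inj[of b d] by auto
  qed
qed

text \<open>\<open>glue\<close> makes the group full: a bijection that agrees near every point with
  some element is itself an element. \<open>transitive\<close> moves supports about,
  \<open>separate\<close> starts the argument on normal subgroups, and \<open>atomless\<close>
  supplies the halves needed to write swaps as commutators.\<close>

locale flexible_action =
  fixes \<Gamma> :: "('x \<Rightarrow> 'x) set" and \<B> :: "'x set set"
  assumes id_mem [simp, intro]: "id \<in> \<Gamma>"
    and comp_mem [intro]: "g \<in> \<Gamma> \<Longrightarrow> h \<in> \<Gamma> \<Longrightarrow> g \<circ> h \<in> \<Gamma>"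
    and inv_mem [intro]: "g \<in> \<Gamma> \<Longrightarrow> inv g \<in> \<Gamma>"
    and mem_bij: "g \<in> \<Gamma> \<Longrightarrow> bij g"
    and UNIV_clopen [simp, intro]: "UNIV \<in> \<B>"
    and Compl_clopen [intro]: "A \<in> \<B> \<Longrightarrow> - A \<in> \<B>"
    and Int_clopen [intro]: "A \<in> \<B> \<Longrightarrow> B \<in> \<B> \<Longrightarrow> A \<inter> B \<in> \<B>"
    and image_clopen [intro]: "g \<in> \<Gamma> \<Longrightarrow> A \<in> \<B> \<Longrightarrow> g ` A \<in> \<B>"
    and glue: "bij g \<Longrightarrow> (\<And>x. \<exists>A \<in> \<B>. x \<in> A \<and> (\<exists>h \<in> \<Gamma>. \<forall>y \<in> A. g y = h y)) \<Longrightarrow> g \<in> \<Gamma>"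
    and transitive: "A \<in> \<B> \<Longrightarrow> B \<in> \<B> \<Longrightarrow> A \<noteq> {} \<Longrightarrow> B \<noteq> {} \<Longrightarrow> A \<noteq> UNIV \<Longrightarrow> B \<noteq> UNIV
          \<Longrightarrow> \<exists>g \<in> \<Gamma>. g ` A = B"
    and separate: "g \<in> \<Gamma> \<Longrightarrow> g \<noteq> id \<Longrightarrow> \<exists>A \<in> \<B>. A \<noteq> {} \<and> g ` A \<inter> A = {}"
    and atomless: "A \<in> \<B> \<Longrightarrow> A \<noteq> {} \<Longrightarrow> \<exists>U \<in> \<B>. A \<inter> U \<noteq> {} \<and> A - U \<noteq> {}"
begin

lemma Un_clopen [intro]: "A \<in> \<B> \<Longrightarrow> B \<in> \<B> \<Longrightarrow> A \<union> B \<in> \<B>"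
  using Compl_clopen[of "- A \<inter> - B"] by auto

lemma Diff_clopen [intro]: "A \<in> \<B> \<Longrightarrow> B \<in> \<B> \<Longrightarrow> A - B \<in> \<B>"
  by (simp add: Diff_eq Int_clopen Compl_clopen)

lemma empty_clopen [simp, intro]: "{} \<in> \<B>"
  using Compl_clopen[OF UNIV_clopen] by simp

lemma mem_inj: "g \<in> \<Gamma> \<Longrightarrow> g x = g y \<longleftrightarrow> x = y"
  using mem_bij[of g] by (auto simp: bij_def inj_def)

lemma inv_app [simp]: "g \<in> \<Gamma> \<Longrightarrow> inv g (g x) = x" "g \<in> \<Gamma> \<Longrightarrow> g (inv g x) = x"
  using mem_bij[of g] by (auto simp: bij_def surj_f_inv_f)

lemma inv_inv_mem [simp]: "g \<in> \<Gamma> \<Longrightarrow> inv (inv g) = g"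
  using mem_bij inv_inv_eq by blast

lemma in_image_iff: "g \<in> \<Gamma> \<Longrightarrow> x \<in> g ` A \<longleftrightarrow> inv g x \<in> A"
  by (auto intro: image_eqI[of _ g "inv g x"])

lemma inv_comp:
  assumes "g \<in> \<Gamma>" "h \<in> \<Gamma>"
  shows "inv (g \<circ> h) = inv h \<circ> inv g"
  using assms by (intro inv_equality) simp_all

section \<open>Rigid stabilisers and transitivity inside a clopen set\<close>

definition rist :: "'x set \<Rightarrow> ('x \<Rightarrow> 'x) set" where
  "rist A = {g \<in> \<Gamma>. \<forall>x. x \<notin> A \<longrightarrow> g x = x}"

lemma rist_mem: "g \<in> rist A \<Longrightarrow> g \<in> \<Gamma>" and rist_fix: "g \<in> rist A \<Longrightarrow> x \<notin> A \<Longrightarrow> g x = x"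
  by (auto simp: rist_def)

lemma rist_stable: "g \<in> rist A \<Longrightarrow> g x \<in> A \<longleftrightarrow> x \<in> A"
  by (metis mem_inj rist_fix rist_mem)

lemma rist_inv: "g \<in> rist A \<Longrightarrow> inv g \<in> rist A"
  unfolding rist_def by (auto, metis inv_app(1))

lemma rist_conj:
  assumes "g \<in> rist A" "h \<in> \<Gamma>"
  shows "h \<circ> g \<circ> inv h \<in> rist (h ` A)"
  using assms unfolding rist_def by (auto simp: in_image_iff intro!: comp_mem)

lemma rist_commute:
  assumes "g \<in> rist A" "h \<in> rist B" "A \<inter> B = {}"
  shows "g \<circ> h = h \<circ> g"
proof
  fix x
  have "x \<in> A \<Longrightarrow> g x \<notin> B" "x \<in> B \<Longrightarrow> h x \<notin> A"
    using assms rist_stable[OF assms(1), of x] rist_stable[OF assms(2), of x] by auto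
  then show "(g \<circ> h) x = (h \<circ> g) x"
    using rist_fix[OF assms(1)] rist_fix[OF assms(2)] assms(3)
    by (cases "x \<in> A"; cases "x \<in> B") auto
qed

text \<open>Two elements are glued with the identity off \<open>A\<close>: one takes
  \<open>P\<close> to \<open>Q\<close>, the other takes \<open>A - P\<close> to
  \<open>A - Q\<close>. Strictness of both inclusions keeps the remainders nonempty, so that
  transitivity applies to them too.\<close>

lemma rist_transitive:
  assumes "A \<in> \<B>" "P \<in> \<B>" "Q \<in> \<B>" "P \<subset> A" "Q \<subset> A" "P \<noteq> {}" "Q \<noteq> {}"
  shows "\<exists>g \<in> rist A. g ` P = Q"
proof -
  obtain g where g: "g \<in> \<Gamma>" "g ` P = Q" using transitive[of P Q] assms by auto
  have "A - P \<in> \<B>" "A - Q \<in> \<B>" "A - P \<noteq> {}" "A - Q \<noteq> {}" "A - P \<noteq> UNIV" "A - Q \<noteq> UNIV"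
    using assms by auto
  then obtain h where h: "h \<in> \<Gamma>" "h ` (A - P) = A - Q" using transitive[of "A - P" "A - Q"] by blast
  have gi: "inv g x \<in> P \<longleftrightarrow> x \<in> Q" for x using g in_image_iff by auto
  have hi: "inv h x \<in> A - P \<longleftrightarrow> x \<in> A - Q" for x using h in_image_iff[of h x "A - P"] by simp
  have gP: "g x \<in> Q \<longleftrightarrow> x \<in> P" for x using gi[of "g x"] g by simp
  have hP: "h x \<in> A - Q \<longleftrightarrow> x \<in> A - P" for x using hi[of "h x"] h by simp
  define f where "f x = (if x \<in> P then g x else if x \<in> A then h x else x)" for x
  define f' where "f' x = (if x \<in> Q then inv g x else if x \<in> A then inv h x else x)" for x
  have "f' (f x) = x" for x
    using assms g h gP[of x] hP[of x] by (auto simp: f_def f'_def)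
  moreover have "f (f' x) = x" for x
    using assms g h gi[of x] hi[of x] by (auto simp: f_def f'_def)
  ultimately have "bij f" by (intro o_bij[of f' f]) auto
  have "f \<in> \<Gamma>"
  proof (rule glue[OF \<open>bij f\<close>])
    fix x
    consider "x \<in> P" | "x \<in> A - P" | "x \<in> - A" by auto
    then show "\<exists>A\<in>\<B>. x \<in> A \<and> (\<exists>h\<in>\<Gamma>. \<forall>y\<in>A. f y = h y)"
    proof cases
      case 1 then show ?thesis using assms g by (intro bexI[of _ P]) (auto simp: f_def)
    next
      case 2 then show ?thesis using assms h by (intro bexI[of _ "A - P"]) (auto simp: f_def)
    next
      case 3 then show ?thesis using assms
        by (intro bexI[of _ "- A"] conjI bexI[of _ id]) (auto simp: f_def)
    qed
  qed
  then have "f \<in> rist A" using assms by (auto simp: rist_def f_def)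
  moreover have "f ` P = Q" using g(2) by (auto simp: f_def)
  ultimately show ?thesis by blast
qed

section \<open>Swaps and their form as commutators\<close>

lemma involution_glue:
  assumes "\<And>x. f (f x) = x"
    "\<And>x. \<exists>A \<in> \<B>. x \<in> A \<and> (\<exists>h \<in> \<Gamma>. \<forall>y \<in> A. f y = h y)"
  shows "f \<in> \<Gamma>"
  using assms(2) by (intro glue o_bij[of f f]) (auto simp: assms(1) fun_eq_iff)

definition is_swap :: "('x \<Rightarrow> 'x) \<Rightarrow> 'x set \<Rightarrow> bool" where
  "is_swap p D \<longleftrightarrow> p \<in> \<Gamma> \<and> D \<in> \<B> \<and> p \<circ> p = id \<and> p ` D \<inter> D = {} \<and> D \<union> p ` D \<noteq> UNIV
     \<and> (\<forall>x. x \<notin> D \<union> p ` D \<longrightarrow> p x = x)"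

lemma is_swapD:
  assumes "is_swap p D"
  shows "p \<in> \<Gamma>" "D \<in> \<B>" "p \<circ> p = id" "p ` D \<inter> D = {}" "D \<union> p ` D \<noteq> UNIV"
    "x \<notin> D \<union> p ` D \<Longrightarrow> p x = x"
  using assms unfolding is_swap_def by blast+

lemma is_swap_invol: "is_swap p D \<Longrightarrow> p (p x) = x"
  using fun_cong[OF is_swapD(3), of p D x] by simp

lemma is_swap_image_iff: "is_swap p D \<Longrightarrow> x \<in> p ` D \<longleftrightarrow> p x \<in> D"
  using is_swap_invol[of p D] by (metis image_iff)

lemma is_swap_inv: "is_swap p D \<Longrightarrow> inv p = p"
  using is_swap_invol[of p D] by (metis inv_equality)

lemma is_swap_conj:
  assumes "is_swap p D" "h \<in> \<Gamma>"
  shows "is_swap (h \<circ> p \<circ> inv h) (h ` D)"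
proof -
  note p = assms(1)[unfolded is_swap_def]
  have im: "(h \<circ> p \<circ> inv h) ` (h ` D) = h ` (p ` D)"
    using assms by (auto simp: image_image)
  have bh: "bij h" using assms mem_bij by blast
  have un: "h ` D \<union> h ` (p ` D) = h ` (D \<union> p ` D)" by auto
  have "h ` (D \<union> p ` D) \<noteq> UNIV" using p bh
    by (metis bij_def image_eqI inj_image_mem_iff UNIV_I UNIV_eq_I)
  moreover have "h ` (p ` D) \<inter> h ` D = {}"
    using p bh by (metis bij_def image_Int image_empty)
  moreover have "(h \<circ> p \<circ> inv h) \<circ> (h \<circ> p \<circ> inv h) = id"
    using is_swap_invol[OF assms(1)] assms(2) by (auto simp: fun_eq_iff)
  moreover have "(h \<circ> p \<circ> inv h) x = x" if "x \<notin> h ` (D \<union> p ` D)" for x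
  proof -
    have "inv h x \<notin> D \<union> p ` D" using that assms(2) by (auto simp: in_image_iff)
    then have "p (inv h x) = inv h x" using p by blast
    then show ?thesis using assms by simp
  qed
  moreover have "h \<circ> p \<circ> inv h \<in> \<Gamma>" "h ` D \<in> \<B>" using p assms by blast+
  ultimately show ?thesis unfolding is_swap_def im un by blast
qed

lemma is_swap_swap_letters: "is_swap p D \<Longrightarrow> is_swap p (p ` D)"
proof -
  assume a: "is_swap p D"
  have pp: "p ` (p ` D) = D" using is_swap_invol[OF a] by (auto simp: image_image)
  have "p ` D \<in> \<B>" using a unfolding is_swap_def by blast
  then show "is_swap p (p ` D)" using a
    unfolding is_swap_def pp Un_commute[of "p ` D"] Int_commute[of D] by blast
qed

text \<open>Halve \<open>D\<close> into \<open>D1\<close> and \<open>D2\<close>, and let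
  \<open>k\<close> carry \<open>D1\<close> to \<open>D2\<close>. Take \<open>u\<close> to be
  \<open>p\<close> on \<open>D1\<close> and its image only; take \<open>v\<close> to exchange
  \<open>D1\<close> with \<open>D2\<close> by \<open>k\<close> and their images by the conjugate of
  \<open>k\<close> under \<open>p\<close>. As \<open>v\<close> commutes with \<open>p\<close>, the
  conjugate of \<open>u\<close> by \<open>v\<close> is \<open>p\<close> on \<open>D2\<close> and its
  image, so multiplying it by \<open>u\<close> gives all of \<open>p\<close>. Both factors are
  involutions, which is why \<open>u \<circ> v \<circ> u \<circ> v\<close> is a commutator.\<close>

lemma is_swap_commutator:
  assumes "is_swap p D"
  shows "\<exists>u \<in> rist (D \<union> p ` D). \<exists>v \<in> rist (D \<union> p ` D). u \<circ> u = id \<and> v \<circ> v = id \<and> p = u \<circ> v \<circ> u \<circ> v"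
proof (cases "D = {}")
  case True
  then have "p = id" using is_swapD(6)[OF assms] by (intro ext) simp
  then show ?thesis using True by (intro bexI[of _ id]) (auto simp: rist_def)
next
  case False
  note p = assms[unfolded is_swap_def]
  have pp [simp]: "p (p x) = x" for x using is_swap_invol[OF assms] .
  obtain U where U: "U \<in> \<B>" "D \<inter> U \<noteq> {}" "D - U \<noteq> {}" using atomless[of D] p False by blast
  define D1 where "D1 = D \<inter> U"
  define D2 where "D2 = D - U"
  have D: "D1 \<in> \<B>" "D2 \<in> \<B>" "D1 \<noteq> {}" "D2 \<noteq> {}" "D1 \<noteq> UNIV" "D2 \<noteq> UNIV" "D = D1 \<union> D2" "D1 \<inter> D2 = {}"
    using U p by (auto simp: D1_def D2_def)
  obtain k where k: "k \<in> \<Gamma>" "k ` D1 = D2" using transitive[of D1 D2] D by blast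
  have k1: "k x \<in> D2 \<longleftrightarrow> x \<in> D1" for x using k(2) mem_inj[OF k(1)] by (metis image_iff)
  have k2: "inv k x \<in> D1 \<longleftrightarrow> x \<in> D2" for x using k in_image_iff by blast
  have pd: "x \<in> D \<Longrightarrow> p x \<notin> D" for x using p by blast
  have pim: "x \<in> p ` A \<longleftrightarrow> p x \<in> A" for x A using pp by (metis image_iff)
  have fixp: "p x = x" if "x \<notin> D1" "x \<notin> D2" "p x \<notin> D1" "p x \<notin> D2" for x
    using that p pim D by blast
  have pdn: "x \<in> D1 \<Longrightarrow> p x \<notin> D1" "x \<in> D1 \<Longrightarrow> p x \<notin> D2" "x \<in> D2 \<Longrightarrow> p x \<notin> D1" "x \<in> D2 \<Longrightarrow> p x \<notin> D2" for x
    using pd[of x] D(7) by auto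
  have dj: "x \<in> D1 \<Longrightarrow> x \<notin> D2" for x using D by auto
  have pG: "p \<in> \<Gamma>" using p by simp
  define u where "u x = (if x \<in> D1 \<or> p x \<in> D1 then p x else x)" for x
  define v where "v x = (if x \<in> D1 then k x else if x \<in> D2 then inv k x
      else if p x \<in> D1 then p (k (p x)) else if p x \<in> D2 then p (inv k (p x)) else x)" for x
  have uu: "u (u x) = x" for x by (auto simp: u_def)
  have vv: "v (v x) = x" for x
    using k1[of x] k2[of x] k1[of "p x"] k2[of "p x"] k dj pdn
    by (auto simp: v_def)
  have pres: "{x. p x \<in> A} \<in> \<B>" if "A \<in> \<B>" for A
  proof -
    have "{x. p x \<in> A} = p ` A" using pim by auto
    then show ?thesis using that pG by auto
  qed
  have uG: "u \<in> \<Gamma>"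
  proof (rule involution_glue[OF uu])
    fix x
    let ?A = "D1 \<union> {x. p x \<in> D1}"
    have A: "?A \<in> \<B>" using pres D by auto
    show "\<exists>A\<in>\<B>. x \<in> A \<and> (\<exists>h\<in>\<Gamma>. \<forall>y\<in>A. u y = h y)"
    proof (cases "x \<in> ?A")
      case True then show ?thesis using A pG
        by (intro bexI[of _ ?A] conjI bexI[of _ p]) (auto simp: u_def)
    next
      case False then show ?thesis using Compl_clopen[OF A]
        by (intro bexI[of _ "- ?A"] conjI bexI[of _ id]) (auto simp: u_def)
    qed
  qed
  have vG: "v \<in> \<Gamma>"
  proof (rule involution_glue[OF vv])
    fix x
    let ?P1 = "{x. p x \<in> D1}" and ?P2 = "{x. p x \<in> D2}"
    have A: "?P1 \<in> \<B>" "?P2 \<in> \<B>" using pres D by auto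
    have 5: "- (D1 \<union> D2 \<union> ?P1 \<union> ?P2) \<in> \<B>" using A D by (intro Compl_clopen Un_clopen)
    consider "x \<in> D1" | "x \<in> D2" | "p x \<in> D1" | "p x \<in> D2" | "x \<in> - (D1 \<union> D2 \<union> ?P1 \<union> ?P2)" by auto
    then show "\<exists>A\<in>\<B>. x \<in> A \<and> (\<exists>h\<in>\<Gamma>. \<forall>y\<in>A. v y = h y)"
    proof cases
      case 1 then show ?thesis using D k
        by (intro bexI[of _ D1] conjI bexI[of _ k]) (auto simp: v_def)
    next
      case 2 then show ?thesis using D k dj
        by (intro bexI[of _ D2] conjI bexI[of _ "inv k"]) (auto simp: v_def)
    next
      case 3
      have "\<forall>y\<in>?P1. v y = (p \<circ> k \<circ> p) y" using pdn pp by (auto simp: v_def)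
      then show ?thesis using 3 A k pG by (intro bexI[of _ ?P1] conjI bexI[of _ "p \<circ> k \<circ> p"]) auto
    next
      case 4
      have "\<forall>y\<in>?P2. v y = (p \<circ> inv k \<circ> p) y" using pdn pp dj by (auto simp: v_def)
      then show ?thesis using 4 A k pG
        by (intro bexI[of _ ?P2] conjI bexI[of _ "p \<circ> inv k \<circ> p"]) auto
    next
      case 5
      then show ?thesis using \<open>- (D1 \<union> D2 \<union> ?P1 \<union> ?P2) \<in> \<B>\<close>
        by (intro bexI[of _ "- (D1 \<union> D2 \<union> ?P1 \<union> ?P2)"] conjI bexI[of _ id]) (auto simp: v_def)
    qed
  qed
  have "u \<in> rist (D \<union> p ` D)" using uG pim D by (auto simp: rist_def u_def)
  moreover have "v \<in> rist (D \<union> p ` D)" using vG pim D by (auto simp: rist_def v_def)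
  moreover have "p x = u (v (u (v x)))" for x
  proof -
    have np: "p x \<in> D1 \<Longrightarrow> x \<notin> D1" "p x \<in> D1 \<Longrightarrow> x \<notin> D2" "p x \<in> D2 \<Longrightarrow> x \<notin> D1" "p x \<in> D2 \<Longrightarrow> x \<notin> D2"
      using pdn[of "p x"] by auto
    consider "x \<in> D1" | "x \<in> D2" | "p x \<in> D1" | "p x \<in> D2" | "x \<in> - (D1 \<union> D2)" "p x \<in> - (D1 \<union> D2)"
      by auto
    then show ?thesis
    proof cases
      case 1
      then have "v x = k x" "k x \<in> D2" by (auto simp: v_def k1)
      moreover from this have "u (k x) = k x" using dj pdn by (auto simp: u_def)
      moreover have "u x = p x" using 1 by (simp add: u_def)
      ultimately show ?thesis using vv[of x] by simp
    next
      case 2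
      then have a: "v x = inv k x" "inv k x \<in> D1" using dj by (auto simp: v_def k2)
      then have b: "u (inv k x) = p (inv k x)" by (simp add: u_def)
      have c: "v (p (inv k x)) = p x" using a(2) pdn k by (auto simp: v_def)
      have "u (p x) = p x" using 2 dj pdn by (auto simp: u_def)
      then show ?thesis using a b c by simp
    next
      case 3
      then have a: "v x = p (k (p x))" using np by (simp add: v_def)
      have "k (p x) \<notin> D1" "p (k (p x)) \<notin> D1" using 3 k1[of "p x"] pdn dj by auto
      then have b: "u (p (k (p x))) = p (k (p x))" by (simp add: u_def)
      have c: "v (p (k (p x))) = x" using vv[of x] a by simp
      show ?thesis using a b c 3 by (simp add: u_def)
    next
      case 4
      then have a: "v x = p (inv k (p x))" using np dj by (auto simp: v_def)
      have i: "inv k (p x) \<in> D1" using 4 k2 by simp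
      have b: "u (p (inv k (p x))) = inv k (p x)" using i by (simp add: u_def)
      have c: "v (inv k (p x)) = p x" using i k by (simp add: v_def)
      have "p x \<notin> D1" "x \<notin> D1" using 4 np dj by auto
      then have "u (p x) = p x" by (simp add: u_def)
      then show ?thesis using a b c by simp
    next
      case 5
      then have "p x = x" using fixp by auto
      then show ?thesis using 5 by (simp add: u_def v_def)
    qed
  qed
  ultimately show ?thesis using uu vv
    by (intro bexI[of _ u] bexI[of _ v]) (auto simp: fun_eq_iff)
qed

section \<open>Subgroups, and the one generated by swaps\<close>

definition subgrp :: "('x \<Rightarrow> 'x) set \<Rightarrow> bool" where
  "subgrp H \<longleftrightarrow> H \<subseteq> \<Gamma> \<and> id \<in> H \<and> (\<forall>x\<in>H. \<forall>y\<in>H. x \<circ> y \<in> H) \<and> (\<forall>x\<in>H. inv x \<in> H)"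

lemma subgrpD:
  assumes "subgrp H"
  shows "x \<in> H \<Longrightarrow> x \<in> \<Gamma>" "id \<in> H" "x \<in> H \<Longrightarrow> y \<in> H \<Longrightarrow> x \<circ> y \<in> H" "x \<in> H \<Longrightarrow> inv x \<in> H"
  using assms by (auto simp: subgrp_def)

text \<open>Inverses need no clause of their own because swaps are involutions.\<close>

inductive_set swap_gen :: "('x \<Rightarrow> 'x) set" where
  swap_gen_id: "id \<in> swap_gen"
| swap_gen_is_swap: "is_swap p D \<Longrightarrow> p \<in> swap_gen"
| swap_gen_comp: "p \<in> swap_gen \<Longrightarrow> q \<in> swap_gen \<Longrightarrow> p \<circ> q \<in> swap_gen"

lemma swap_gen_mem: "p \<in> swap_gen \<Longrightarrow> p \<in> \<Gamma>"
  by (induction rule: swap_gen.induct) (use is_swapD(1) in blast)+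

lemma swap_gen_inv: "p \<in> swap_gen \<Longrightarrow> inv p \<in> swap_gen"
proof (induction rule: swap_gen.induct)
  case (swap_gen_comp p q)
  then show ?case using inv_comp[of p q] swap_gen_mem swap_gen.swap_gen_comp by metis
next
  case swap_gen_id
  show ?case unfolding inv_id by (rule swap_gen.swap_gen_id)
next
  case (swap_gen_is_swap p D)
  then show ?case using is_swap_inv swap_gen.swap_gen_is_swap by metis
qed

lemma swap_gen_conj: "p \<in> swap_gen \<Longrightarrow> h \<in> \<Gamma> \<Longrightarrow> h \<circ> p \<circ> inv h \<in> swap_gen"
proof (induction rule: swap_gen.induct)
  case swap_gen_id
  then have "h \<circ> id \<circ> inv h = id" by (auto simp: fun_eq_iff)
  then show ?case using swap_gen.swap_gen_id by metis
next
  case (swap_gen_is_swap p D)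
  then show ?case using is_swap_conj swap_gen.swap_gen_is_swap by blast
next
  case (swap_gen_comp p q)
  then have "h \<circ> (p \<circ> q) \<circ> inv h = (h \<circ> p \<circ> inv h) \<circ> (h \<circ> q \<circ> inv h)" by (auto simp: fun_eq_iff)
  then show ?case using swap_gen_comp swap_gen.swap_gen_comp by metis
qed

lemma swap_gen_least: "subgrp H \<Longrightarrow> (\<And>p D. is_swap p D \<Longrightarrow> p \<in> H) \<Longrightarrow> swap_gen \<subseteq> H"
proof
  fix x assume "subgrp H" "\<And>p D. is_swap p D \<Longrightarrow> p \<in> H" "x \<in> swap_gen"
  from this(3) show "x \<in> H"
    by (induction rule: swap_gen.induct) (use \<open>subgrp H\<close> \<open>\<And>p D. is_swap p D \<Longrightarrow> p \<in> H\<close> subgrpD in blast)+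
qed

text \<open>Double commutator argument. Let \<open>f\<close> displace \<open>A\<close>. For
  \<open>g\<close> supported in \<open>A\<close>, the commutator of \<open>g\<close> and
  \<open>f\<close> lies in \<open>N\<close> and equals \<open>g \<circ> g'\<close> with
  \<open>g'\<close> supported in the image of \<open>A\<close>. If \<open>h\<close> is supported in
  \<open>A\<close> too, \<open>g'\<close> commutes with \<open>h\<close> and cancels, so the
  commutator of \<open>g \<circ> g'\<close> with \<open>h\<close>, again in \<open>N\<close>, is
  that of \<open>g\<close> and \<open>h\<close>. Swaps are such commutators up to
  conjugation.\<close>

lemma normal_contains_swap_gen:
  assumes N: "subgrp N" "\<And>h n. h \<in> \<Gamma> \<Longrightarrow> n \<in> N \<Longrightarrow> h \<circ> n \<circ> inv h \<in> N"
    and f: "f \<in> N" "f \<noteq> id"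
  shows "swap_gen \<subseteq> N"
proof (rule swap_gen_least[OF N(1)])
  have fG: "f \<in> \<Gamma>" using subgrpD(1)[OF N(1)] f by simp
  obtain A where A: "A \<in> \<B>" "A \<noteq> {}" "f ` A \<inter> A = {}" using separate[OF fG f(2)] by blast
  have AU: "A \<noteq> UNIV" using A by auto
  have comm: "g \<circ> h \<circ> inv g \<circ> inv h \<in> N" if g: "g \<in> rist A" and h: "h \<in> rist A" for g h
  proof -
    have gG: "g \<in> \<Gamma>" and hG: "h \<in> \<Gamma>" using g h rist_mem by auto
    define g' where "g' = f \<circ> inv g \<circ> inv f"
    have g': "g' \<in> rist (f ` A)" unfolding g'_def using rist_conj[OF rist_inv[OF g] fG] .
    have g'G: "g' \<in> \<Gamma>" using g' rist_mem by blast
    have "(g \<circ> f \<circ> inv g) \<circ> inv f \<in> N"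
      using subgrpD[OF N(1)] N(2)[OF gG f(1)] f(1) by blast
    then have cN: "g \<circ> g' \<in> N" unfolding g'_def by (simp add: comp_assoc)
    have "g \<circ> g' \<circ> (h \<circ> inv (g \<circ> g') \<circ> inv h) \<in> N"
      using cN subgrpD[OF N(1)] N(2)[OF hG] by blast
    moreover have "g \<circ> g' \<circ> (h \<circ> inv (g \<circ> g') \<circ> inv h) = g \<circ> h \<circ> inv g \<circ> inv h"
    proof
      fix x
      have "g' (h y) = h (g' y)" for y
        using rist_commute[OF g' h] A by (auto simp: fun_eq_iff)
      then show "(g \<circ> g' \<circ> (h \<circ> inv (g \<circ> g') \<circ> inv h)) x = (g \<circ> h \<circ> inv g \<circ> inv h) x"
        by (simp add: inv_comp gG g'G)
    qed
    ultimately show ?thesis by simp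
  qed
  fix p D assume p: "is_swap p D"
  define E where "E = D \<union> p ` D"
  have E: "E \<in> \<B>" "E \<noteq> UNIV" using is_swapD(1,2,5)[OF p] unfolding E_def by blast+
  show "p \<in> N"
  proof (cases "E = {}")
    case True
    then have "p = id" using is_swapD(6)[OF p] unfolding E_def
      by (intro ext) (metis empty_iff id_apply)
    then show ?thesis using subgrpD(2)[OF N(1)] by metis
  next
    case False
    \<comment> \<open>Here the support of the swap has to be nonempty and proper; the case
      distinction ensures the former, the definition of swaps the latter.\<close>
    obtain k where k: "k \<in> \<Gamma>" "k ` E = A" using transitive[of E A] E A AU False by blast
    obtain u v where uv: "u \<in> rist E" "v \<in> rist E" "u \<circ> u = id" "v \<circ> v = id" "p = u \<circ> v \<circ> u \<circ> v"
      using is_swap_commutator[OF p] unfolding E_def[symmetric] by blast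
    define u' where "u' = k \<circ> u \<circ> inv k"
    define v' where "v' = k \<circ> v \<circ> inv k"
    have r: "u' \<in> rist A" "v' \<in> rist A" using rist_conj[OF uv(1) k(1)] rist_conj[OF uv(2) k(1)] k
      by (auto simp: u'_def v'_def)
    have uu: "u (u x) = x" "v (v x) = x" for x using uv(3,4) by (auto simp: fun_eq_iff)
    have "u' (u' x) = x" "v' (v' x) = x" for x
      using uu k by (auto simp: u'_def v'_def)
    then have i: "inv u' = u'" "inv v' = v'" by (auto intro: inv_equality)
    have m: "u' \<circ> v' \<circ> u' \<circ> v' \<in> N" using comm[OF r] i by simp
    have "inv k \<circ> (u' \<circ> v' \<circ> u' \<circ> v') \<circ> inv (inv k) \<in> N"
      using N(2)[OF inv_mem[OF k(1)] m] .
    moreover have "inv k \<circ> (u' \<circ> v' \<circ> u' \<circ> v') \<circ> inv (inv k) = p"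
      using k unfolding uv(5) u'_def v'_def by (auto simp: fun_eq_iff)
    ultimately show ?thesis by simp
  qed
qed

section \<open>Two generators of finite order\<close>

lemma rist_mono: "g \<in> rist B \<Longrightarrow> B \<subseteq> C \<Longrightarrow> g \<in> rist C"
  unfolding rist_def by blast

text \<open>The levels are the positions that the rotation of finite order will permute; each new
  one is cut off the last.\<close>

lemma clopen_levels:
  "\<exists>idx :: 'x \<Rightarrow> nat. (\<forall>x. idx x \<le> n) \<and> (\<forall>i \<le> n. {x. idx x = i} \<in> \<B> \<and> {x. idx x = i} \<noteq> {})"
proof (induction n)
  case 0
  show ?case by (intro exI[of _ "\<lambda>_. 0"]) auto
next
  case (Suc n)
  then obtain idx :: "'x \<Rightarrow> nat" where idx: "\<And>x. idx x \<le> n"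
    "\<And>i. i \<le> n \<Longrightarrow> {x. idx x = i} \<in> \<B>" "\<And>i. i \<le> n \<Longrightarrow> {x. idx x = i} \<noteq> {}" by blast
  let ?L = "{x. idx x = n}"
  obtain U where U: "U \<in> \<B>" "?L \<inter> U \<noteq> {}" "?L - U \<noteq> {}"
    using atomless[OF idx(2,3)[OF order_refl]] by blast
  define idx' where "idx' x = (if idx x = n \<and> x \<notin> U then Suc n else idx x)" for x
  have "idx' x \<le> Suc n" for x using idx(1)[of x] by (auto simp: idx'_def)
  moreover have "{x. idx' x = i} \<in> \<B> \<and> {x. idx' x = i} \<noteq> {}" if i: "i \<le> Suc n" for i
  proof -
    consider "i = Suc n" | "i = n" | "i < n" using i by linarith
    then show ?thesis
    proof cases
      case 1
      have "idx x \<noteq> Suc n" for x using idx(1)[of x] by simp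
      then have "{x. idx' x = i} = ?L - U" using 1 by (auto simp: idx'_def)
      then show ?thesis using U idx(2)[of n] by auto
    next
      case 2
      then have "{x. idx' x = i} = ?L \<inter> U" by (auto simp: idx'_def)
      then show ?thesis using U idx(2)[of n] by auto
    next
      case 3
      then have "{x. idx' x = i} = {x. idx x = i}" by (auto simp: idx'_def)
      then show ?thesis using idx(2,3)[of i] 3 by simp
    qed
  qed
  ultimately show ?case by blast
qed

text \<open>Cut \<open>D\<close> by the pair of levels of \<open>x\<close> and \<open>p x\<close>.
  Each piece yields a swap between two fixed levels, and since the pieces have disjoint supports
  their product over the finitely many pairs is \<open>p\<close>. In the proof \<open>f S\<close> is
  \<open>p\<close> restricted to the pieces with index in \<open>S\<close>.\<close>

lemma is_swap_split_mem:
  assumes H: "subgrp H" and p: "is_swap p D" and idx: "\<And>i. {x. idx x = i} \<in> \<B>"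
    "\<And>x. idx x < (N :: nat)"
    and piece: "\<And>i j q E. i < N \<Longrightarrow> j < N \<Longrightarrow> is_swap q E \<Longrightarrow> E \<subseteq> {x. idx x = i} \<Longrightarrow> q ` E \<subseteq> {x. idx x
        = j} \<Longrightarrow> q \<in> H"
  shows "p \<in> H"
proof -
  note pD = is_swapD[OF p]
  have pp [simp]: "p (p x) = x" for x using is_swap_invol[OF p] .
  have pd: "x \<in> D \<Longrightarrow> p x \<notin> D" for x using pD(4) by blast
  define E where "E S = {x \<in> D. (idx x, idx (p x)) \<in> S}" for S
  define f where "f S x = (if x \<in> E S \<or> p x \<in> E S then p x else x)" for S x
  have imf: "f S ` E S = p ` E S" for S by (auto simp: f_def)
  have Eij: "E {(i, j)} \<in> \<B>" for i j
  proof -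
    have "p ` {x. idx x = j} = {x. idx (p x) = j}" using pp by force
    then have "E {(i, j)} = D \<inter> {x. idx x = i} \<inter> p ` {x. idx x = j}" unfolding E_def by auto
    then show ?thesis using pD(1,2) idx(1) by (metis Int_clopen image_clopen)
  qed
  have fij: "f {(i, j)} \<in> H" if ij: "i < N" "j < N" for i j
  proof (rule piece[OF ij])
    let ?s = "{(i, j)}"
    have pi: "p ` E ?s \<in> \<B>" using Eij pD by blast
    have im: "x \<in> p ` E ?s \<longleftrightarrow> p x \<in> E ?s" for x using pp by (metis image_iff)
    have inv: "f ?s (f ?s x) = x" for x by (auto simp: f_def)
    have "f ?s \<in> \<Gamma>"
    proof (rule involution_glue[OF inv])
      fix x
      let ?A = "E ?s \<union> p ` E ?s"
      have A: "?A \<in> \<B>" using Eij pi by blast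
      show "\<exists>A\<in>\<B>. x \<in> A \<and> (\<exists>h\<in>\<Gamma>. \<forall>y\<in>A. f ?s y = h y)"
      proof (cases "x \<in> ?A")
        case True
        then show ?thesis using A pD(1) im
          by (intro bexI[of _ ?A] conjI bexI[of _ p]) (auto simp: f_def)
      next
        case False
        then show ?thesis using Compl_clopen[OF A] im
          by (intro bexI[of _ "- ?A"] conjI bexI[of _ id]) (auto simp: f_def)
      qed
    qed
    moreover have "E ?s \<subseteq> D" by (auto simp: E_def)
    then have "p ` E ?s \<inter> E ?s = {}" "E ?s \<union> p ` E ?s \<noteq> UNIV" using pD(4,5) by blast+
    moreover have "f ?s x = x" if "x \<notin> E ?s \<union> p ` E ?s" for x using that im by (simp add: f_def)
    moreover have "f ?s \<circ> f ?s = id" using inv by (intro ext) simp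
    ultimately show "is_swap (f ?s) (E ?s)" unfolding is_swap_def imf using Eij by blast
    show "E ?s \<subseteq> {x. idx x = i}" "f ?s ` E ?s \<subseteq> {x. idx x = j}" by (auto simp: E_def f_def)
  qed
  have "f S \<in> H" if "finite S" "S \<subseteq> {..<N} \<times> {..<N}" for S
    using that
  proof (induction S)
    case empty
    have "f {} = id" by (auto simp: f_def E_def)
    then show ?case using subgrpD(2)[OF H] by metis
  next
    case (insert s S)
    obtain i j where s: "s = (i, j)" by force
    have "f (insert s S) = f {s} \<circ> f S"
    proof
      fix x
      show "f (insert s S) x = (f {s} \<circ> f S) x"
        using insert.hyps pd[of x] pd[of "p x"] by (auto simp: f_def E_def)
    qed
    moreover have "f {s} \<in> H" "f S \<in> H" using fij insert s by auto
    ultimately show ?case using subgrpD(3)[OF H] by metis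
  qed
  from this[of "{..<N} \<times> {..<N}"] have "f ({..<N} \<times> {..<N}) \<in> H" by simp
  moreover have "f ({..<N} \<times> {..<N}) = p"
  proof
    fix x
    have "p x = x" if "x \<notin> D" "p x \<notin> D" using pD(6)[of x] that is_swap_image_iff[OF p] by blast
    then show "f ({..<N} \<times> {..<N}) x = p x" using idx(2) by (auto simp: f_def E_def)
  qed
  ultimately show ?thesis by metis
qed

text \<open>The last two hypotheses on \<open>\<iota>0\<close> say that conjugation by it takes the
  group to the rigid stabiliser of its range and back. Hence the generation hypothesis
  \<open>gen\<close> can be replayed inside a proper clopen set, where there is room for
  translates.\<close>

theorem two_torsion_generators:
  fixes ws :: "nat \<Rightarrow> 'x \<Rightarrow> 'x" and \<iota>0 :: "'x \<Rightarrow> 'x"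
  assumes ws: "\<And>i. i < M \<Longrightarrow> ws i \<in> \<Gamma>" "\<And>i. i < M \<Longrightarrow> ws i \<circ> ws i = id"
    and gen: "\<And>H. subgrp H \<Longrightarrow> (\<And>i j. i < M \<Longrightarrow> j < M \<Longrightarrow> i \<noteq> j \<Longrightarrow> ws i \<circ> ws j \<circ> ws i \<circ> ws j \<in> H) \<Longrightarrow> \<Gamma> \<subseteq> H"
    and swap_gen: "\<Gamma> \<subseteq> swap_gen"
    and \<iota>0: "inj \<iota>0" "range \<iota>0 \<in> \<B>" "range \<iota>0 \<noteq> UNIV"
      "\<And>g. g \<in> \<Gamma> \<Longrightarrow> (\<lambda>x. if x \<in> range \<iota>0 then \<iota>0 (g (inv \<iota>0 x)) else x) \<in> \<Gamma>"
      "\<And>h. h \<in> rist (range \<iota>0) \<Longrightarrow> inv \<iota>0 \<circ> h \<circ> \<iota>0 \<in> \<Gamma>"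
  shows "\<exists>a \<in> \<Gamma>. \<exists>b \<in> \<Gamma>. (\<exists>n > 0. a ^^ n = id) \<and> b \<circ> b = id
     \<and> (\<forall>H. subgrp H \<longrightarrow> a \<in> H \<longrightarrow> b \<in> H \<longrightarrow> \<Gamma> \<subseteq> H)"
proof -
  \<comment> \<open>Exponents starting at 1 make each \<open>k i\<close> a multiple of 4, so an
    offset of 0 or 1 is visible modulo 4. Below, \<open>N\<close> is at least four times each
    \<open>k i\<close> with \<open>i < M\<close>, and at least 16, so \<open>k i + k r + 1\<close>
    stays below \<open>N\<close>.\<close>
  define k where "k i = (4::nat) ^ (i + 1)" for i
  define N where "N = (4::nat) ^ (M + 2)"
  have N16: "N \<ge> 16" using power_increasing[of 2 "M+2" "4::nat"] by (simp add: N_def)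
  have kN: "4 * k i \<le> N" if "i < M" for i
    using power_increasing[of "i + 2" "M+2" "4::nat"] that by (simp add: N_def k_def)
  have k4: "k i mod 4 = 0" for i by (simp add: k_def)
  have kk: "(i = l \<and> r = j) \<or> (i = j \<and> r = l)" if "k i + k r = k j + k l" for i j l r
    using pow4_sum_eq[of "i+1" "r+1" "j+1" "l+1"] that by (auto simp: k_def)
  obtain idx :: "'x \<Rightarrow> nat" where idx0: "\<And>x. idx x \<le> N - 1" and
    idx1: "\<And>i. i \<le> N - 1 \<Longrightarrow> {x. idx x = i} \<in> \<B> \<and> {x. idx x = i} \<noteq> {}"
    using clopen_levels[of "N - 1"] by blast
  have idxN: "idx x < N" for x using idx0[of x] N16 by linarith
  define Lev where "Lev i = {x. idx x = i}" for i
  have Lev: "Lev i \<in> \<B>" "Lev i \<noteq> {}" if "i < N" for i using idx1[of i] that by (auto simp: Lev_def)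
  have LevB: "Lev i \<in> \<B>" for i
  proof (cases "i < N")
    case False
    then have "Lev i = {}" using idxN by (auto simp: Lev_def)
    then show ?thesis by simp
  qed (use Lev in blast)
  have LevU: "Lev i \<noteq> UNIV" for i
  proof
    assume "Lev i = UNIV"
    moreover have "Lev 0 \<noteq> {}" "Lev 1 \<noteq> {}" using Lev N16 by auto
    ultimately show False unfolding Lev_def
      by (metis (mono_tags, lifting) UNIV_I empty_Collect_eq mem_Collect_eq zero_neq_one)
  qed
  have "\<exists>g \<in> \<Gamma>. g ` Lev 0 = Lev i" if "i < N" for i
    using that Lev LevU N16 by (intro transitive) auto
  then obtain h0 where h0: "\<And>i. i < N \<Longrightarrow> h0 i \<in> \<Gamma>" "\<And>i. i < N \<Longrightarrow> h0 i ` Lev 0 = Lev i" by metis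
  \<comment> \<open>Reading the index modulo \<open>N\<close> closes the cycle with the very chart
    it started from; hence \<open>a ^^ N\<close> is the identity and not merely a map preserving all
    levels.\<close>
  define h where "h i = h0 (i mod N)" for i
  have hG: "h i \<in> \<Gamma>" and hL: "h i ` Lev 0 = Lev (i mod N)" for i
    using h0 N16 by (auto simp: h_def)
  define a where "a x = h (idx x + 1) (inv (h (idx x)) x)" for x
  have i0: "idx (inv (h (idx x)) x) = 0" for x
    using hL[of "idx x"] in_image_iff[OF hG, of x "idx x" "Lev 0"] idxN[of x]
      by (auto simp: Lev_def)
  have ih: "idx (h i y) = i mod N" if "idx y = 0" for i y
    using hL[of i] that by (auto simp: Lev_def)
  have hmod: "h (i mod N) = h i" for i by (simp add: h_def)
  have hN: "h (i + N) = h i" for i by (simp add: h_def)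
  have apow: "(a ^^ n) x = h (idx x + n) (inv (h (idx x)) x)" for n x
  proof (induction n)
    case 0 then show ?case by (simp add: hG)
  next
    case (Suc n)
    have "idx ((a ^^ n) x) = (idx x + n) mod N" using ih[OF i0] Suc by simp
    moreover have "h (Suc ((idx x + n) mod N)) = h (Suc (idx x + n))"
      by (simp add: h_def mod_Suc_eq)
    ultimately show ?case using Suc by (simp add: a_def hG hmod)
  qed
  have aidx: "idx ((a ^^ n) x) = (idx x + n) mod N" for n x using apow ih[OF i0] by simp
  have aN: "a ^^ N = id" using apow hN by (auto simp: fun_eq_iff hG)
  have N0: "N > 0" using N16 by simp
  have abij: "bij a"
  proof (rule o_bij[of "a ^^ (N - 1)"])
    show "a ^^ (N - 1) \<circ> a = id" using aN N0 by (metis Suc_diff_1 funpow_Suc_right)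
    show "a \<circ> a ^^ (N - 1) = id" using aN N0 by (metis Suc_diff_1 funpow.simps(2))
  qed
  have aG: "a \<in> \<Gamma>"
  proof (rule glue[OF abij])
    fix x
    show "\<exists>A\<in>\<B>. x \<in> A \<and> (\<exists>h\<in>\<Gamma>. \<forall>y\<in>A. a y = h y)"
      by (intro bexI[of _ "Lev (idx x)"] conjI bexI[of _ "h (idx x + 1) \<circ> inv (h (idx x))"])
        (auto simp: Lev_def a_def hG LevB[unfolded Lev_def] intro!: comp_mem inv_mem)
  qed
  have AG: "a ^^ n \<in> \<Gamma>" for n by (intro funpow_mem comp_mem id_mem aG)
  define Y where "Y = Lev 0 \<union> Lev 1"
  have YB: "Y \<in> \<B>" "Y \<noteq> {}" using LevB Lev N16 by (auto simp: Y_def)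
  have "Lev 2 \<noteq> {}" using Lev N16 by auto
  then obtain x2 where "idx x2 = 2" by (auto simp: Lev_def)
  then have "x2 \<notin> Y" by (auto simp: Y_def Lev_def)
  then have YU: "Y \<noteq> UNIV" by blast
  have Yi: "x \<in> Y \<longleftrightarrow> idx x < 2" for x by (auto simp: Y_def Lev_def)

  \<comment> \<open>\<open>\<iota>\<close> spreads the whole space over \<open>Y\<close>. The map
    \<open>ext\<close> built from it is a homomorphism of the group onto the rigid stabiliser of
    \<open>Y\<close>.\<close>
  obtain t where t: "t \<in> \<Gamma>" "t ` range \<iota>0 = Y" using transitive[of "range \<iota>0" Y] \<iota>0 YB YU by blast
  define \<iota> where "\<iota> = t \<circ> \<iota>0"
  have \<iota>r: "range \<iota> = Y" using t by (auto simp: \<iota>_def image_comp[symmetric])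
  have \<iota>inj: "inj \<iota>" using \<iota>0(1) mem_bij[OF t(1)] by (auto simp: \<iota>_def bij_def intro: inj_compose)
  define \<rho> where "\<rho> = inv \<iota>"
  have \<rho>\<iota> [simp]: "\<rho> (\<iota> x) = x" for x using \<iota>inj by (simp add: \<rho>_def)
  have \<iota>\<rho> [simp]: "x \<in> Y \<Longrightarrow> \<iota> (\<rho> x) = x" for x using \<iota>r by (auto simp: \<rho>_def f_inv_into_f)
  have \<iota>Y [simp]: "\<iota> x \<in> Y" for x using \<iota>r by blast
  have \<rho>t: "\<rho> x = inv \<iota>0 (inv t x)" if x: "x \<in> Y" for x
  proof -
    obtain z where "x = \<iota> z" using \<iota>r x by blast
    moreover have "inv \<iota>0 (inv t (\<iota> z)) = z" using \<iota>0(1) t(1) by (simp add: \<iota>_def)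
    ultimately show ?thesis by simp
  qed
  define ext where "ext g x = (if x \<in> Y then \<iota> (g (\<rho> x)) else x)" for g x
  have ext_comp: "ext (g \<circ> g') = ext g \<circ> ext g'" for g g' by (auto simp: ext_def)
  have ext_id: "ext id = id" by (auto simp: ext_def)
  have extG: "ext g \<in> rist Y" if g: "g \<in> \<Gamma>" for g
  proof -
    define e where "e x = (if x \<in> range \<iota>0 then \<iota>0 (g (inv \<iota>0 x)) else x)" for x
    have e: "e \<in> \<Gamma>" using \<iota>0(4)[OF g] by (simp add: e_def[abs_def])
    have "ext g = t \<circ> e \<circ> inv t"
    proof
      fix x
      show "ext g x = (t \<circ> e \<circ> inv t) x"
      proof (cases "x \<in> Y")
        case True
        then have "inv t x \<in> range \<iota>0" using t in_image_iff by blast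
        then show ?thesis using True \<rho>t by (simp add: ext_def e_def \<iota>_def)
      next
        case False
        then have "inv t x \<notin> range \<iota>0" using t in_image_iff by blast
        then show ?thesis using False t by (simp add: ext_def e_def)
      qed
    qed
    then have "ext g \<in> \<Gamma>" using e t by (metis comp_mem inv_mem)
    then show ?thesis by (auto simp: rist_def ext_def)
  qed
  have ext_onto: "\<exists>g \<in> \<Gamma>. f = ext g" if f: "f \<in> rist Y" for f
  proof
    have f': "inv t \<circ> f \<circ> t \<in> rist (range \<iota>0)"
    proof -
      have "inv t ` Y = range \<iota>0" using t by (auto simp: image_image simp flip: t(2))
      then show ?thesis using rist_conj[OF f inv_mem[OF t(1)]] t by simp
    qed
    show "inv \<iota>0 \<circ> (inv t \<circ> f \<circ> t) \<circ> \<iota>0 \<in> \<Gamma>" using \<iota>0(5)[OF f'] .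
    show "f = ext (inv \<iota>0 \<circ> (inv t \<circ> f \<circ> t) \<circ> \<iota>0)"
    proof
      fix x
      show "f x = ext (inv \<iota>0 \<circ> (inv t \<circ> f \<circ> t) \<circ> \<iota>0) x"
      proof (cases "x \<in> Y")
        case True
        then have "t (\<iota>0 (\<rho> x)) = x" using \<iota>\<rho> by (simp add: \<iota>_def)
        moreover have "f x \<in> Y" using True rist_stable[OF f] by simp
        ultimately show ?thesis using True \<rho>t[of "f x"] \<iota>\<rho>[of "f x"] by (simp add: ext_def)
      next
        case False
        then show ?thesis using rist_fix[OF f] by (simp add: ext_def)
      qed
    qed
  qed

  define w where "w i = ext (ws i)" for i
  have wY: "w i \<in> rist Y" if "i < M" for i using extG ws that by (simp add: w_def)
  have ww: "w i (w i x) = x" if "i < M" for i x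
    using ext_comp[of "ws i" "ws i"] ws(2)[OF that] ext_id by (metis comp_apply id_apply w_def)
  define A where "A i = a ^^ k i" for i
  have AGi: "A i \<in> \<Gamma>" for i using AG by (simp add: A_def)
  define c where "c i = A i \<circ> w i \<circ> inv (A i)" for i
  define Z where "Z i = A i ` Y" for i
  have cZ: "c i \<in> rist (Z i)" if "i < M" for i using rist_conj[OF wY[OF that] AGi]
    by (simp add: c_def Z_def)
  have cc: "c i (c i x) = x" if "i < M" for i x using ww[OF that] AGi by (simp add: c_def)
  \<comment> \<open>Since \<open>k i + 1\<close> is below \<open>N\<close>, the two levels of the
    translate do not wrap around.\<close>
  have Zi: "x \<in> Z i \<longleftrightarrow> idx x = k i \<or> idx x = k i + 1" if "i < M" for i x
  proof -
    let ?y = "inv (A i) x"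
    have e: "idx x = (idx ?y + k i) mod N" using aidx[of "k i" ?y] AGi by (simp flip: A_def)
    have "x \<in> Z i \<longleftrightarrow> idx ?y < 2" using in_image_iff[OF AGi] by (simp add: Z_def Yi)
    also have "\<dots> \<longleftrightarrow> idx x = k i \<or> idx x = k i + 1"
    proof (cases "idx ?y + k i < N")
      case True then show ?thesis using e by auto
    next
      case False
      moreover have "idx ?y + k i < N + k i" using idxN by simp
      moreover have "k i < N" using kN[OF that] N0 by linarith
      ultimately have "idx x = idx ?y + k i - N" using e by (simp add: mod_if)
      then show ?thesis using idxN[of ?y] kN[OF that] False N16 by linarith
    qed
    finally show ?thesis .
  qed
  have Zdis: "i = j" if "i < M" "j < M" "x \<in> Z i" "x \<in> Z j" for i j x
  proof -
    have "k i = k j" using that Zi k4[of i] k4[of j] by auto presburger+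
    then show ?thesis by (simp add: k_def)
  qed
  have ZB: "Z i \<in> \<B>" for i using AGi YB by (auto simp: Z_def)
  \<comment> \<open>By \<open>Zdis\<close> at most one index qualifies, so \<open>b\<close> is the
    product of the \<open>c i\<close>, whose supports are disjoint.\<close>
  define b where "b x = (if \<exists>i<M. x \<in> Z i then c (THE i. i < M \<and> x \<in> Z i) x else x)" for x
  have bZ: "b x = c i x" if "i < M" "x \<in> Z i" for i x
  proof -
    have "(THE i. i < M \<and> x \<in> Z i) = i" using that Zdis by blast
    then show ?thesis using that by (auto simp: b_def)
  qed
  have bfix: "b x = x" if "\<And>i. i < M \<Longrightarrow> x \<notin> Z i" for x using that by (auto simp: b_def)
  have bb: "b (b x) = x" for x
  proof (cases "\<exists>i<M. x \<in> Z i")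
    case True
    then obtain i where i: "i < M" "x \<in> Z i" by blast
    then have "c i x \<in> Z i" using rist_stable[OF cZ] by blast
    then show ?thesis using i bZ cc by metis
  qed (use bfix in metis)
  have UZB: "(\<Union>i<n. Z i) \<in> \<B>" for n
    by (induction n) (auto simp: lessThan_Suc ZB)
  have bG: "b \<in> \<Gamma>"
  proof (rule involution_glue[OF bb])
    fix x
    show "\<exists>A\<in>\<B>. x \<in> A \<and> (\<exists>h\<in>\<Gamma>. \<forall>y\<in>A. b y = h y)"
    proof (cases "\<exists>i<M. x \<in> Z i")
      case True
      then obtain i where i: "i < M" "x \<in> Z i" by blast
      then show ?thesis using ZB bZ rist_mem[OF cZ]
        by (intro bexI[of _ "Z i"] conjI bexI[of _ "c i"]) auto
    next
      case False
      then show ?thesis using Compl_clopen[OF UZB[of M]] bfix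
        by (intro bexI[of _ "- (\<Union>i<M. Z i)"] conjI bexI[of _ id]) auto
    qed
  qed

  have main: "\<Gamma> \<subseteq> H" if H: "subgrp H" "a \<in> H" "b \<in> H" for H
  proof -
    have aH: "a ^^ n \<in> H" for n using funpow_mem[of H a n] H subgrpD[OF H(1)] by blast
    \<comment> \<open>Conjugating \<open>b\<close> back by \<open>A i\<close> brings its
      \<open>i\<close>-th factor onto \<open>Y\<close>, where it is \<open>w i\<close>. The
      remaining factors act outside \<open>Y\<close>, on the set called \<open>S i\<close>
      below.\<close>
    define d where "d i = inv (A i) \<circ> b \<circ> A i" for i
    have dH: "d i \<in> H" for i using aH H subgrpD[OF H(1)] by (simp add: d_def A_def)
    have dd: "d i (d i x) = x" for i x using bb AGi by (simp add: d_def)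
    define S where "S i = {x. x \<notin> Y \<and> (\<exists>l<M. A i x \<in> Z l)}" for i
    have AY: "A i x \<in> Z i \<longleftrightarrow> x \<in> Y" for i x using in_image_iff[OF AGi] AGi by (simp add: Z_def)
    have dY: "d i x = w i x" if "x \<in> Y" "i < M" for i x
      using bZ[of i "A i x"] that AY AGi by (simp add: d_def c_def)
    have dfix: "d i x = x" if "x \<notin> Y" "x \<notin> S i" for i x
      using that bfix[of "A i x"] AGi by (auto simp: d_def S_def)
    have dS: "d i x \<in> S i" if x: "x \<in> S i" "i < M" for i x
    proof -
      obtain l where l: "l < M" "A i x \<in> Z l" using x by (auto simp: S_def)
      have e: "A i (d i x) = c l (A i x)" using bZ[OF l] AGi by (simp add: d_def)
      then have "A i (d i x) \<in> Z l" using rist_stable[OF cZ[OF l(1)]] l by simp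
      moreover have "d i x \<notin> Y"
      proof
        assume "d i x \<in> Y"
        then have "A i (d i x) \<in> Z i" using AY by simp
        then have "l = i" using Zdis l x \<open>A i (d i x) \<in> Z l\<close> by blast
        then show False using l x AY by (auto simp: S_def)
      qed
      ultimately show ?thesis using l by (auto simp: S_def)
    qed
    \<comment> \<open>A common point at level \<open>n\<close> gives
      \<open>n + k i = k l + \<epsilon>\<close> and \<open>n + k j = k r + \<epsilon>'\<close>
      modulo \<open>N\<close>. Eliminating \<open>n\<close> yields
      \<open>k i + k r + \<epsilon>' = k j + k l + \<epsilon>\<close>, a true equation since neither
      side reaches \<open>N\<close>. Modulo 4 the offsets agree, and the Sidon property with
      \<open>i \<noteq> j\<close> leaves only \<open>i = l\<close>, which would put the point in
      \<open>Y\<close>.\<close>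
    have Sdis: "S i \<inter> S j = {}" if ij: "i < M" "j < M" "i \<noteq> j" for i j
    proof (rule ccontr)
      assume "S i \<inter> S j \<noteq> {}"
      then obtain x l r where x: "x \<notin> Y" "l < M" "r < M" "A i x \<in> Z l" "A j x \<in> Z r"
        by (auto simp: S_def)
      have "idx (A i x) = (idx x + k i) mod N" "idx (A j x) = (idx x + k j) mod N"
        using aidx by (auto simp: A_def)
      moreover have "\<exists>\<epsilon> < 2. n = m + \<epsilon>" if "n = m \<or> n = m + 1" for n m :: nat
        using that by (metis Suc_1 Suc_eq_plus1 add_0_right lessI zero_less_Suc)
      ultimately obtain \<epsilon> \<epsilon>' where e: "\<epsilon> < 2" "\<epsilon>' < 2" "(idx x + k i) mod N = k l + \<epsilon>"
        "(idx x + k j) mod N = k r + \<epsilon>'"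
        using Zi[OF x(2), of "A i x"] Zi[OF x(3), of "A j x"] x(4,5) by metis
      have 1: "(k i + (k r + \<epsilon>')) mod N = (idx x + k i + k j) mod N"
        unfolding e(4)[symmetric] by (simp add: mod_simps ac_simps)
      have 2: "(k j + (k l + \<epsilon>)) mod N = (idx x + k i + k j) mod N"
        unfolding e(3)[symmetric] by (simp add: mod_simps ac_simps)
      have "k i + (k r + \<epsilon>') < N" "k j + (k l + \<epsilon>) < N"
        using kN[OF ij(1)] kN[OF ij(2)] kN[OF x(2)] kN[OF x(3)] e(1,2) N16 by linarith+
      then have 3: "k i + (k r + \<epsilon>') = k j + (k l + \<epsilon>)" using 1 2 by simp
      have "\<epsilon> = \<epsilon>'" using 3 e(1,2) k4[of i] k4[of j] k4[of l] k4[of r] by presburger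
      then have "i = l" using kk[of i r j l] 3 ij by auto
      then have "A i x \<in> Z i" using x by simp
      then show False using AY x by simp
    qed
    \<comment> \<open>On \<open>Y\<close> the two conjugates are \<open>w i\<close> and
      \<open>w j\<close>. Outside \<open>Y\<close> each point is moved by at most one of them,
      because \<open>S i\<close> and \<open>S j\<close> are disjoint and invariant; that one is an
      involution applied twice.\<close>
    have comm: "d i \<circ> d j \<circ> d i \<circ> d j = w i \<circ> w j \<circ> w i \<circ> w j" if ij: "i < M" "j < M" "i \<noteq> j"
      for i j
    proof
      fix x
      have st: "w i y \<in> Y" "w j y \<in> Y" if "y \<in> Y" for y
        using rist_stable[OF wY] ij that by auto
      show "(d i \<circ> d j \<circ> d i \<circ> d j) x = (w i \<circ> w j \<circ> w i \<circ> w j) x"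
      proof (cases "x \<in> Y")
        case True
        then show ?thesis using dY st ij by simp
      next
        case False
        have r: "(w i \<circ> w j \<circ> w i \<circ> w j) x = x" using False rist_fix[OF wY] ij by simp
        have SY: "y \<notin> Y" if "y \<in> S l" for y l using that by (simp add: S_def)
        consider "x \<in> S i" | "x \<in> S j" | "x \<notin> S i" "x \<notin> S j" by blast
        then have "d i (d j (d i (d j x))) = x"
        proof cases
          case 1
          then have "x \<notin> S j" "d i x \<notin> S j" "d i x \<notin> Y" using dS[OF 1 ij(1)] Sdis[OF ij] SY
            by blast+
          then have "d j x = x" "d j (d i x) = d i x" using dfix False by blast+
          then show ?thesis using dd by simp
        next
          case 2
          then have "x \<notin> S i" "d j x \<notin> S i" "d j x \<notin> Y" using dS[OF 2 ij(2)] Sdis[OF ij] SY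
            by blast+
          then have "d i x = x" "d i (d j x) = d j x" using dfix False by blast+
          then show ?thesis using dd by simp
        next
          case 3 then show ?thesis using dfix False by simp
        qed
        then show ?thesis using r by simp
      qed
    qed
    \<comment> \<open>The preimage of \<open>H\<close> under \<open>ext\<close> is a subgroup
      containing all the commutators of the \<open>ws\<close>, so it is everything; since
      \<open>ext\<close> is onto, \<open>H\<close> contains the rigid stabiliser of
      \<open>Y\<close>.\<close>
    define H' where "H' = {g \<in> \<Gamma>. ext g \<in> H}"
    have "subgrp H'" unfolding subgrp_def
    proof (intro conjI ballI)
      show "H' \<subseteq> \<Gamma>" by (auto simp: H'_def)
      show "id \<in> H'" using ext_id subgrpD(2)[OF H(1)] unfolding H'_def
        by (metis (mono_tags) id_mem mem_Collect_eq)
      show "x \<circ> y \<in> H'" if "x \<in> H'" "y \<in> H'" for x y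
        using that subgrpD(3)[OF H(1)] by (auto simp: H'_def ext_comp)
      show "inv x \<in> H'" if "x \<in> H'" for x
      proof -
        have x: "x \<in> \<Gamma>" "ext x \<in> H" using that by (auto simp: H'_def)
        have "x \<circ> inv x = id" "inv x \<circ> x = id" using x(1) by (auto simp: fun_eq_iff)
        then have "ext x \<circ> ext (inv x) = id" "ext (inv x) \<circ> ext x = id"
          using ext_id ext_comp by metis+
        then have "ext x (ext (inv x) y) = y" "ext (inv x) (ext x y) = y" for y
          by (simp_all add: pointfree_idE)
        then have "inv (ext x) = ext (inv x)" by (auto intro: inv_equality)
        then show ?thesis using x subgrpD(4)[OF H(1), of "ext x"] by (auto simp: H'_def)
      qed
    qed
    moreover have "ws i \<circ> ws j \<circ> ws i \<circ> ws j \<in> H'" if ij: "i < M" "j < M" "i \<noteq> j" for i j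
    proof -
      have "ext (ws i \<circ> ws j \<circ> ws i \<circ> ws j) = d i \<circ> d j \<circ> d i \<circ> d j"
        using comm[OF ij] by (simp add: ext_comp w_def)
      moreover have "d i \<circ> d j \<circ> d i \<circ> d j \<in> H" using dH subgrpD(3)[OF H(1)] by blast
      moreover have "ws i \<circ> ws j \<circ> ws i \<circ> ws j \<in> \<Gamma>" using ws ij by (intro comp_mem) auto
      ultimately show ?thesis by (simp add: H'_def)
    qed
    ultimately have GH': "\<Gamma> \<subseteq> H'" by (rule gen)
    have ristY: "rist Y \<subseteq> H" using ext_onto GH' by (auto simp: H'_def)
    \<comment> \<open>Conjugation by \<open>a ^^ i\<close> shifts the two levels back into
      \<open>Y\<close>; the bound on \<open>i\<close> excludes the pair that straddles the end of
      the cycle.\<close>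
    have rist2: "g \<in> H" if g: "g \<in> rist (Lev i \<union> Lev (Suc i))" and i: "Suc i < N" for g i
    proof -
      let ?a = "a ^^ i"
      have im: "inv ?a ` (Lev i \<union> Lev (Suc i)) \<subseteq> Y"
      proof
        fix y assume "y \<in> inv ?a ` (Lev i \<union> Lev (Suc i))"
        then have "?a y \<in> Lev i \<union> Lev (Suc i)" using AG by auto
        then have e: "(idx y + i) mod N = i \<or> (idx y + i) mod N = Suc i" using aidx
          by (auto simp: Lev_def)
        have "idx y < 2"
        proof (cases "idx y + i < N")
          case True then show ?thesis using e by auto
        next
          case False
          then have "(idx y + i) mod N = idx y + i - N" using idxN[of y] i by (simp add: mod_if)
          then show ?thesis using e idxN[of y] False by linarith
        qed
        then show "y \<in> Y" using Yi by simp
      qed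
      have "inv ?a \<circ> g \<circ> inv (inv ?a) \<in> rist (inv ?a ` (Lev i \<union> Lev (Suc i)))"
        using rist_conj[OF g inv_mem[OF AG]] .
      then have "inv ?a \<circ> g \<circ> ?a \<in> rist Y" using rist_mono[OF _ im] AG by (simp add: o_assoc)
      then have "inv ?a \<circ> g \<circ> ?a \<in> H" using ristY by (rule subsetD[rotated])
      then have "?a \<circ> (inv ?a \<circ> g \<circ> ?a) \<circ> inv ?a \<in> H" using aH subgrpD(4)[OF H(1) aH]
        by (meson subgrpD(3)[OF H(1)])
      moreover have "?a \<circ> (inv ?a \<circ> g \<circ> ?a) \<circ> inv ?a = g" using AG by (auto simp: fun_eq_iff)
      ultimately show ?thesis by (simp only:)
    qed
    have is_swap_rist: "is_swap p D \<Longrightarrow> D \<union> p ` D \<subseteq> B \<Longrightarrow> p \<in> rist B" for p D B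
      unfolding rist_def using is_swapD[of p D] by blast
    \<comment> \<open>The target is brought down one level at a time. If it lies in
      \<open>Lev (Suc j)\<close> and \<open>i < j\<close>, an element supported in
      \<open>Lev j\<close> and \<open>Lev (Suc j)\<close>, already in \<open>H\<close>, carries it
      onto \<open>Lev j\<close> and fixes \<open>D\<close>; the conjugated swap falls under the
      induction hypothesis. An empty \<open>D\<close> is set apart because
      \<open>rist_transitive\<close> moves nonempty sets.\<close>
    have up: "p \<in> H" if "is_swap p D" "D \<subseteq> Lev i" "p ` D \<subseteq> Lev j" "i \<le> j" "j < N" for p D i j
      using that
    proof (induction j arbitrary: p)
      case 0
      then have "p \<in> rist (Lev 0 \<union> Lev (Suc 0))" using is_swap_rist[of p D "Lev 0 \<union> Lev (Suc 0)"] 0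
        by blast
      then show ?case using rist2[of p 0] N16 by simp
    next
      case (Suc j)
      consider "i = Suc j" | "i = j" | "i < j" using Suc.prems by linarith
      then show ?case
      proof cases
        case 1
        then have "p \<in> rist (Lev j \<union> Lev (Suc j))"
          using is_swap_rist[of p D "Lev j \<union> Lev (Suc j)"] Suc.prems by blast
        then show ?thesis using rist2[of p j] Suc.prems by simp
      next
        case 2
        then have "p \<in> rist (Lev j \<union> Lev (Suc j))"
          using is_swap_rist[of p D "Lev j \<union> Lev (Suc j)"] Suc.prems by blast
        then show ?thesis using rist2[of p j] Suc.prems by simp
      next
        case 3
        show ?thesis
        proof (cases "D = {}")
          case True
          then have "p = id" using is_swapD(6)[OF Suc.prems(1)]
            by (intro ext) (metis Un_empty empty_iff id_apply image_empty)
          then show ?thesis using subgrpD(2)[OF H(1)] by metis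
        next
          case False
          let ?E = "p ` D"
          let ?R = "Lev j \<union> Lev (Suc j)"
          have "?E \<in> \<B>" using is_swapD[OF Suc.prems(1)] by blast
          moreover have dj: "Lev j \<inter> Lev (Suc j) = {}" by (auto simp: Lev_def)
          moreover have "Lev j \<noteq> {}" "Lev (Suc j) \<noteq> {}" using Lev Suc.prems by auto
          ultimately obtain g where g: "g \<in> rist ?R" "g ` ?E = Lev j"
            using rist_transitive[of ?R ?E "Lev j"] False Suc.prems LevB by blast
          have gG: "g \<in> \<Gamma>" using g rist_mem by blast
          have gD: "g ` D = D"
          proof -
            have "g x = x" if "x \<in> D" for x using rist_fix[OF g(1)] that Suc.prems(2) 3
              by (auto simp: Lev_def)
            then show ?thesis by simp
          qed
          let ?q = "g \<circ> p \<circ> inv g"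
          have q: "is_swap ?q D" using is_swap_conj[OF Suc.prems(1) gG] gD by simp
          have "inv g ` D = D" using gD gG by (metis image_inv_f_f mem_bij bij_is_inj)
          then have qD: "?q ` D = Lev j" using g(2) by (metis image_comp)
          have "?q \<in> H"
            using Suc.IH[OF q Suc.prems(2) equalityD1[OF qD] less_imp_le[OF 3] Suc_lessD[OF Suc.prems(5)]] .
          moreover have gH: "g \<in> H" using rist2[OF g(1)] Suc.prems by simp
          ultimately have "inv g \<circ> ?q \<circ> g \<in> H" by (meson subgrpD(3,4)[OF H(1)])
          moreover have "inv g \<circ> ?q \<circ> g = p" using gG by (auto simp: fun_eq_iff)
          ultimately show ?thesis by (simp only:)
        qed
      qed
    qed
    have "p \<in> H" if p: "is_swap p D" for p D
    proof (rule is_swap_split_mem[OF H(1) p, of idx N])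
      show "{x. idx x = i} \<in> \<B>" for i using LevB by (simp add: Lev_def)
      show "idx x < N" for x using idxN .
      fix i j q E
      assume q: "i < N" "j < N" "is_swap q E" "E \<subseteq> {x. idx x = i}" "q ` E \<subseteq> {x. idx x = j}"
      show "q \<in> H"
      proof (cases "i \<le> j")
        case True then show ?thesis using up q by (auto simp: Lev_def)
      next
        case False
        have "q ` (q ` E) = E" using is_swap_invol[OF q(3)] by (auto simp: image_image)
        then show ?thesis using up[OF is_swap_swap_letters[OF q(3)], of j i] q False
          by (auto simp: Lev_def)
      qed
    qed
    then have "swap_gen \<subseteq> H" by (intro swap_gen_least H)
    then show ?thesis using swap_gen by blast
  qed
  show ?thesis
    using aG bG aN N0 bb main
    by (intro bexI[of _ a] bexI[of _ b]) (auto simp: fun_eq_iff)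
qed

end

section \<open>Bricks and local twists\<close>

type_synonym 's point = "'s \<Rightarrow> nat \<Rightarrow> bool"

definition concat_label :: "('s \<Rightarrow> bool list) \<Rightarrow> ('s \<Rightarrow> bool list) \<Rightarrow> 's \<Rightarrow> bool list" where
  "concat_label \<phi> \<theta> = (\<lambda>s. \<phi> s @ \<theta> s)"

lemma concat_label_Nil [simp]: "concat_label (\<lambda>_. []) \<theta> = \<theta>" "concat_label \<phi> (\<lambda>_. []) = \<phi>"
  by (auto simp: concat_label_def)

lemma Phi_concat_label: "Phi (concat_label \<phi> \<theta>) \<kappa> = Phi \<phi> (Phi \<theta> \<kappa>)"
  by (auto simp: Phi_def concat_label_def concat_seq_def nth_append fun_eq_iff)

lemma Phi_inv_Phi [simp]: "Phi_inv \<phi> (Phi \<phi> \<kappa>) = \<kappa>"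
  by (auto simp: Phi_def Phi_inv_def concat_seq_def)

lemma Phi_Phi_inv: "\<kappa> \<in> brick \<phi> \<Longrightarrow> Phi \<phi> (Phi_inv \<phi> \<kappa>) = \<kappa>"
  by (auto simp: Phi_def Phi_inv_def concat_seq_def brick_def is_prefix_def fun_eq_iff)

lemma Phi_in_brick [simp, intro]: "Phi \<phi> \<kappa> \<in> brick \<phi>"
  by (auto simp: Phi_def brick_def is_prefix_def concat_seq_def)

lemma brickE:
  assumes "x \<in> brick \<phi>"
  obtains \<kappa> where "x = Phi \<phi> \<kappa>"
  using Phi_Phi_inv[OF assms] that by metis

lemma range_Phi: "range (Phi \<phi>) = brick \<phi>"
  by (auto elim: brickE)

lemma inj_Phi: "inj (Phi \<phi>)"
  by (metis Phi_inv_Phi injI)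

lemma Phi_eq_iff [simp]: "Phi \<phi> \<kappa> = Phi \<phi> \<kappa>' \<longleftrightarrow> \<kappa> = \<kappa>'"
  by (metis Phi_inv_Phi)

lemma Phi_Nil [simp]: "Phi (\<lambda>_. []) = id"
  by (auto simp: Phi_def concat_seq_def fun_eq_iff)

lemma brick_Nil [simp]: "brick (\<lambda>_. []) = UNIV"
  by (auto simp: brick_def is_prefix_def)

lemma brick_concat_label_subset: "brick (concat_label \<phi> \<theta>) \<subseteq> brick \<phi>"
  by (auto simp: Phi_concat_label elim!: brickE)

lemma tau_Phi: "tau \<gamma> (Phi \<theta> \<kappa>) = Phi (\<theta> \<circ> inv \<gamma>) (tau \<gamma> \<kappa>)"
  by (auto simp: tau_def Phi_def)

lemma tau_tau: "bij \<gamma> \<Longrightarrow> bij \<gamma>' \<Longrightarrow> tau \<gamma>' (tau \<gamma> \<kappa>) = tau (\<gamma>' \<circ> \<gamma>) \<kappa>"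
  by (simp add: tau_def o_inv_distrib)

lemma tau_id [simp]: "tau id = id"
  by (auto simp: tau_def fun_eq_iff)

lemma tau_inv [simp]: "bij \<gamma> \<Longrightarrow> tau \<gamma> (tau (inv \<gamma>) \<kappa>) = \<kappa>"
  by (simp add: tau_tau bij_imp_bij_inv bij_is_surj surj_iff[THEN iffD1])

lemma label_Nil [simp, intro]: "brick_label (\<lambda>_. [])"
  by (simp add: brick_label_def)

lemma label_concat_label [intro]: "brick_label \<phi> \<Longrightarrow> brick_label \<theta> \<Longrightarrow> brick_label (concat_label \<phi> \<theta>)"
  unfolding brick_label_def concat_label_def
  by (rule finite_subset[of _ "{s. \<phi> s \<noteq> []} \<union> {s. \<theta> s \<noteq> []}"]) auto

lemma label_perm:
  assumes "brick_label \<theta>" "bij \<gamma>"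
  shows "brick_label (\<theta> \<circ> \<gamma>)"
proof -
  have "{s. (\<theta> \<circ> \<gamma>) s \<noteq> []} = \<gamma> -` {s. \<theta> s \<noteq> []}" by auto
  then show ?thesis
    using assms finite_vimageI[of "{s. \<theta> s \<noteq> []}" \<gamma>] unfolding brick_label_def bij_def by metis
qed

lemma label_drop:
  assumes "brick_label \<theta>"
  shows "brick_label (\<lambda>s. drop (n s) (\<theta> s))"
  using assms unfolding brick_label_def by (rule finite_subset[rotated]) auto

text \<open>Labels of bricks with a common point spell prefixes of the same sequences, so comparing
  lengths coordinatewise already decides extension.\<close>

lemma longer_label:
  assumes "x \<in> brick \<phi>" "x \<in> brick \<xi>" "\<And>s. length (\<phi> s) \<le> length (\<xi> s)"
  shows "\<xi> = concat_label \<phi> (\<lambda>s. drop (length (\<phi> s)) (\<xi> s))"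
proof
  fix s
  have "take (length (\<phi> s)) (\<xi> s) = \<phi> s"
  proof (rule nth_equalityI)
    show "length (take (length (\<phi> s)) (\<xi> s)) = length (\<phi> s)" using assms(3)[of s] by simp
    fix i assume "i < length (take (length (\<phi> s)) (\<xi> s))"
    then have "i < length (\<phi> s)" "i < length (\<xi> s)" by auto
    then show "take (length (\<phi> s)) (\<xi> s) ! i = \<phi> s ! i"
      using assms(1,2) by (auto simp: brick_def is_prefix_def)
  qed
  then show "\<xi> s = concat_label \<phi> (\<lambda>s. drop (length (\<phi> s)) (\<xi> s)) s"
    unfolding concat_label_def by (metis append_take_drop_id)
qed

text \<open>For fixed finite \<open>F\<close> and \<open>n\<close> the cells form a finite partition
  of the space into bricks. Indexing a cell by any point in it avoids enumerating words.\<close>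

definition cell_label :: "'s set \<Rightarrow> nat \<Rightarrow> 's point \<Rightarrow> 's \<Rightarrow> bool list" where
  "cell_label F n x = (\<lambda>s. if s \<in> F then map (x s) [0..<n] else [])"

lemma label_cell_label [intro]: "finite F \<Longrightarrow> brick_label (cell_label F n x)"
  unfolding brick_label_def by (rule finite_subset[of _ F]) (auto simp: cell_label_def)

lemma in_brick_cell_label: "y \<in> brick (cell_label F n x) \<longleftrightarrow> (\<forall>s\<in>F. \<forall>i<n. y s i = x s i)"
  by (auto simp: brick_def is_prefix_def cell_label_def)

lemma self_in_brick_cell_label [simp, intro]: "x \<in> brick (cell_label F n x)"
  by (simp add: in_brick_cell_label)

lemma cell_label_cong: "y \<in> brick (cell_label F n x) \<Longrightarrow> cell_label F n y = cell_label F n x"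
  by (simp add: in_brick_cell_label) (auto simp: cell_label_def fun_eq_iff)

lemma finite_range_cell_label:
  assumes "finite F"
  shows "finite (range (cell_label F n))"
proof -
  have "finite {w :: bool list. length w = n}"
    using finite_lists_length_eq[of "UNIV :: bool set" n] by simp
  note finite_set_of_finite_funs[OF assms this, of "[]"]
  moreover have "range (cell_label F n) \<subseteq> {f. \<forall>x. (x \<in> F \<longrightarrow> f x \<in> {w. length w = n}) \<and> (x \<notin> F \<longrightarrow> f x
      = [])}"
    by (simp add: cell_label_def image_subset_iff)
  ultimately show ?thesis by (rule finite_subset[rotated])
qed

section \<open>Maps that are twists near each point\<close>

locale perm_group =
  fixes G :: "('s \<Rightarrow> 's) set"
  assumes G_id [simp, intro]: "id \<in> G"
    and G_comp: "g \<in> G \<Longrightarrow> h \<in> G \<Longrightarrow> g \<circ> h \<in> G"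
    and G_inv: "g \<in> G \<Longrightarrow> inv g \<in> G"
    and G_bij: "g \<in> G \<Longrightarrow> bij g"

definition acts :: "('s point \<Rightarrow> 's point) \<Rightarrow> ('s \<Rightarrow> bool list) \<Rightarrow> ('s \<Rightarrow> bool list) \<Rightarrow> ('s \<Rightarrow> 's) \<Rightarrow> bool"
  where
  "acts f \<phi> \<psi> \<gamma> \<longleftrightarrow> (\<forall>\<kappa>. f (Phi \<phi> \<kappa>) = Phi \<psi> (tau \<gamma> \<kappa>))"

text \<open>This replaces the two partitions in the definition of \<open>SV\<close> by a condition
  at one point, which is what gluing needs; compactness recovers the partitions later.\<close>

definition locally_twist :: "('s \<Rightarrow> 's) set \<Rightarrow> ('s point \<Rightarrow> 's point) \<Rightarrow> 's point \<Rightarrow> bool" where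
  "locally_twist G f x \<longleftrightarrow> (\<exists>\<phi> \<psi> \<gamma>. brick_label \<phi> \<and> brick_label \<psi> \<and> \<gamma> \<in> G \<and> x \<in> brick \<phi> \<and> acts f \<phi> \<psi> \<gamma>)"

lemma locally_twistI: "brick_label \<phi> \<Longrightarrow> brick_label \<psi> \<Longrightarrow> \<gamma> \<in> G \<Longrightarrow> x \<in> brick \<phi> \<Longrightarrow>
    (\<And>\<kappa>. f (Phi \<phi> \<kappa>) = Phi \<psi> (tau \<gamma> \<kappa>)) \<Longrightarrow> locally_twist G f x"
  unfolding locally_twist_def acts_def by blast

lemma acts_twist: "acts f \<phi> \<psi> \<gamma> \<longleftrightarrow> (\<forall>\<kappa>\<in>brick \<phi>. f \<kappa> = twist \<phi> \<psi> \<gamma> \<kappa>)"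
proof
  assume a: "acts f \<phi> \<psi> \<gamma>"
  show "\<forall>\<kappa>\<in>brick \<phi>. f \<kappa> = twist \<phi> \<psi> \<gamma> \<kappa>"
  proof
    fix x assume "x \<in> brick \<phi>"
    then obtain \<kappa> where "x = Phi \<phi> \<kappa>" by (rule brickE)
    then show "f x = twist \<phi> \<psi> \<gamma> x" using a by (simp add: acts_def twist_def)
  qed
qed (auto simp: acts_def twist_def)

text \<open>The suffix \<theta> reappears permuted on the target side, since \<open>tau\<close>
  carries the letters at \<open>s\<close> to coordinate \<gamma> \<open>s\<close>.\<close>

lemma acts_refine: "acts f \<phi> \<psi> \<gamma> \<Longrightarrow> acts f (concat_label \<phi> \<theta>) (concat_label \<psi> (\<theta> \<circ> inv \<gamma>)) \<gamma>"
  by (simp add: acts_def Phi_concat_label tau_Phi)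

context perm_group
begin

text \<open>The source and target bricks of a local twist can be shrunk simultaneously into
  prescribed bricks around \<open>x\<close> and \<open>f x\<close>. Composition, restriction and
  continuity of local twists all reduce to this.\<close>

lemma locally_twist_refine:
  assumes "locally_twist G f x" "brick_label \<phi>1" "brick_label \<phi>2" "x \<in> brick \<phi>1" "f x \<in> brick \<phi>2"
  shows "\<exists>\<omega>1 \<omega>2 \<gamma>. brick_label \<omega>1 \<and> brick_label \<omega>2 \<and> \<gamma> \<in> G \<and> x \<in> brick (concat_label \<phi>1 \<omega>1)
     \<and> acts f (concat_label \<phi>1 \<omega>1) (concat_label \<phi>2 \<omega>2) \<gamma>"
proof -
  obtain \<phi> \<psi> \<gamma> where l: "brick_label \<phi>" "brick_label \<psi>" "\<gamma> \<in> G" "x \<in> brick \<phi>" "acts f \<phi> \<psi> \<gamma>"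
    using assms(1) unfolding locally_twist_def by blast
  have b: "bij \<gamma>" using l G_bij by blast
  obtain \<kappa>0 where x: "x = Phi \<phi> \<kappa>0" using l(4) by (rule brickE)
  \<comment> \<open>At \<open>s\<close> the suffix must be long enough for \<open>\<phi>1\<close> at
    \<open>s\<close> and also for \<open>\<phi>2\<close> at \<gamma> \<open>s\<close>, which is
    where these letters arrive; the sum of the two lengths covers both.\<close>
  define \<theta> where "\<theta> s = map (\<kappa>0 s) [0..<length (\<phi>1 s) + length (\<phi>2 (\<gamma> s))]" for s
  have "{s. \<theta> s \<noteq> []} = {s. \<phi>1 s \<noteq> []} \<union> {s. (\<phi>2 \<circ> \<gamma>) s \<noteq> []}" by (auto simp: \<theta>_def)
  then have \<theta>: "brick_label \<theta>" using assms(2) label_perm[OF assms(3) b]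
    by (simp add: brick_label_def)
  have \<kappa>0: "\<kappa>0 \<in> brick \<theta>" by (auto simp: brick_def is_prefix_def \<theta>_def)
  then obtain \<kappa>1 where \<kappa>1: "\<kappa>0 = Phi \<theta> \<kappa>1" by (rule brickE)
  define \<xi>1 where "\<xi>1 = concat_label \<phi> \<theta>"
  define \<xi>2 where "\<xi>2 = concat_label \<psi> (\<theta> \<circ> inv \<gamma>)"
  have a: "acts f \<xi>1 \<xi>2 \<gamma>" unfolding \<xi>1_def \<xi>2_def using acts_refine[OF l(5)] .
  have L: "brick_label \<xi>1" "brick_label \<xi>2"
    using l \<theta> label_perm[OF \<theta> bij_imp_bij_inv[OF b]] by (auto simp: \<xi>1_def \<xi>2_def)
  have x1: "x = Phi \<xi>1 \<kappa>1" using x \<kappa>1 by (simp add: \<xi>1_def Phi_concat_label)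
  then have fx: "f x \<in> brick \<xi>2" "x \<in> brick \<xi>1" using a by (simp_all add: acts_def)
  have "\<gamma> (inv \<gamma> s) = s" for s using b by (simp add: bij_is_surj surj_f_inv_f)
  then have "length (\<phi>1 s) \<le> length (\<xi>1 s)" "length (\<phi>2 s) \<le> length (\<xi>2 s)" for s
    by (auto simp: \<xi>1_def \<xi>2_def concat_label_def \<theta>_def)
  then have c: "\<xi>1 = concat_label \<phi>1 (\<lambda>s. drop (length (\<phi>1 s)) (\<xi>1 s))"
    "\<xi>2 = concat_label \<phi>2 (\<lambda>s. drop (length (\<phi>2 s)) (\<xi>2 s))"
    using longer_label assms fx by blast+
  then show ?thesis using a L label_drop l(3) fx by metis
qed

text \<open>After refining \<open>f\<close> so that its target label extends the source label of
  \<open>g\<close>, the two twists compose on the nose.\<close>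

lemma locally_twist_comp:
  assumes "locally_twist G f x" "locally_twist G g (f x)"
  shows "locally_twist G (g \<circ> f) x"
proof -
  obtain \<phi>' \<psi>' \<gamma>' where g: "brick_label \<phi>'" "brick_label \<psi>'" "\<gamma>' \<in> G" "f x \<in> brick \<phi>'"
    "acts g \<phi>' \<psi>' \<gamma>'"
    using assms(2) unfolding locally_twist_def by blast
  obtain \<omega>1 \<omega>2 \<gamma> where f: "brick_label \<omega>1" "brick_label \<omega>2" "\<gamma> \<in> G" "x \<in> brick \<omega>1"
    "acts f \<omega>1 (concat_label \<phi>' \<omega>2) \<gamma>"
    using locally_twist_refine[OF assms(1) label_Nil g(1) _ g(4)] by auto
  show ?thesis
  proof (rule locally_twistI[OF f(1) _ G_comp[OF g(3) f(3)] f(4)])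
    show "brick_label (concat_label \<psi>' (\<omega>2 \<circ> inv \<gamma>'))"
      using g f label_perm bij_imp_bij_inv G_bij by blast
    show "(g \<circ> f) (Phi \<omega>1 \<kappa>) = Phi (concat_label \<psi>' (\<omega>2 \<circ> inv \<gamma>')) (tau (\<gamma>' \<circ> \<gamma>) \<kappa>)" for \<kappa>
      using f(5) g(5) G_bij f(3) g(3) by (simp add: acts_def Phi_concat_label tau_Phi tau_tau)
  qed
qed

lemma locally_twist_inv:
  assumes "bij h" "locally_twist G h (inv h y)"
  shows "locally_twist G (inv h) y"
proof -
  obtain \<phi> \<psi> \<gamma> where h: "brick_label \<phi>" "brick_label \<psi>" "\<gamma> \<in> G" "inv h y \<in> brick \<phi>" "acts h \<phi> \<psi> \<gamma>"
    using assms(2) unfolding locally_twist_def by blast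
  have b: "bij \<gamma>" using h G_bij by blast
  have hi: "inv h (h x) = x" "h (inv h x) = x" for x using assms
    by (auto simp: bij_def surj_f_inv_f)
  have "h (Phi \<phi> (tau (inv \<gamma>) \<kappa>)) = Phi \<psi> \<kappa>" for \<kappa> using h(5) b by (simp add: acts_def)
  then have e: "inv h (Phi \<psi> \<kappa>) = Phi \<phi> (tau (inv \<gamma>) \<kappa>)" for \<kappa> using hi by metis
  obtain \<kappa> where "inv h y = Phi \<phi> \<kappa>" using h(4) by (rule brickE)
  then have "y = Phi \<psi> (tau \<gamma> \<kappa>)" using h(5) hi(2)[of y] by (simp add: acts_def)
  then show ?thesis using locally_twistI[OF h(2,1) G_inv[OF h(3)] _ e] by blast
qed

lemma locally_twist_cong:
  assumes "brick_label \<phi>0" "x \<in> brick \<phi>0" "\<And>y. y \<in> brick \<phi>0 \<Longrightarrow> f y = g y" "locally_twist G g x"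
  shows "locally_twist G f x"
proof -
  obtain \<omega>1 \<omega>2 \<gamma> where l: "brick_label \<omega>1" "brick_label \<omega>2" "\<gamma> \<in> G" "x \<in> brick (concat_label \<phi>0 \<omega>1)"
    "acts g (concat_label \<phi>0 \<omega>1) \<omega>2 \<gamma>"
    using locally_twist_refine[OF assms(4) assms(1) label_Nil assms(2)] by auto
  have "f (Phi (concat_label \<phi>0 \<omega>1) \<kappa>) = Phi \<omega>2 (tau \<gamma> \<kappa>)" for \<kappa>
    using l(5) assms(3) by (simp add: acts_def Phi_concat_label)
  then show ?thesis using locally_twistI[of "concat_label \<phi>0 \<omega>1" \<omega>2 \<gamma> G x f] l assms(1) by blast
qed

lemma locally_twist_id: "locally_twist G id x"
  by (rule locally_twistI[of "\<lambda>_. []" "\<lambda>_. []" id]) auto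

end

lemma locally_twist_mono: "locally_twist G f x \<Longrightarrow> G \<subseteq> G' \<Longrightarrow> locally_twist G' f x"
  unfolding locally_twist_def by blast

section \<open>Clopen sets, grids and compactness\<close>

definition brick_open :: "'s point set \<Rightarrow> bool" where
  "brick_open A \<longleftrightarrow> (\<forall>x\<in>A. \<exists>\<phi>. brick_label \<phi> \<and> x \<in> brick \<phi> \<and> brick \<phi> \<subseteq> A)"

lemma brick_open_Int:
  assumes "brick_open A" "brick_open B"
  shows "brick_open (A \<inter> B)"
  unfolding brick_open_def
proof
  fix x assume x: "x \<in> A \<inter> B"
  obtain \<phi> where p: "brick_label \<phi>" "x \<in> brick \<phi>" "brick \<phi> \<subseteq> A" using assms(1) x
    unfolding brick_open_def by blast
  obtain \<psi> where q: "brick_label \<psi>" "x \<in> brick \<psi>" "brick \<psi> \<subseteq> B" using assms(2) x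
    unfolding brick_open_def by blast
  define \<xi> where "\<xi> s = map (x s) [0..<max (length (\<phi> s)) (length (\<psi> s))]" for s
  have "{s. \<xi> s \<noteq> []} \<subseteq> {s. \<phi> s \<noteq> []} \<union> {s. \<psi> s \<noteq> []}" by (auto simp: \<xi>_def)
  then have c: "brick_label \<xi>" using p q by (auto simp: brick_label_def intro: finite_subset)
  have xc: "x \<in> brick \<xi>" by (auto simp: brick_def is_prefix_def \<xi>_def)
  have "brick \<xi> \<subseteq> brick \<eta>" if "x \<in> brick \<eta>" "\<And>s. length (\<eta> s) \<le> length (\<xi> s)" for \<eta>
    using longer_label[OF that(1) xc that(2)] brick_concat_label_subset by metis
  then have "brick \<xi> \<subseteq> brick \<phi>" "brick \<xi> \<subseteq> brick \<psi>" using p(2) q(2) by (simp_all add: \<xi>_def)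
  then have "brick \<xi> \<subseteq> A \<inter> B" using p(3) q(3) by (meson Int_greatest order_trans)
  then show "\<exists>\<phi>. brick_label \<phi> \<and> x \<in> brick \<phi> \<and> brick \<phi> \<subseteq> A \<inter> B" using c xc by (intro exI conjI)
qed

lemma brick_open_Un: "brick_open A \<Longrightarrow> brick_open B \<Longrightarrow> brick_open (A \<union> B)"
  unfolding brick_open_def by (metis Un_iff le_supI1 le_supI2)

lemma brick_open_UNIV [simp]: "brick_open UNIV" and brick_open_empty [simp]: "brick_open {}"
  unfolding brick_open_def using label_Nil brick_Nil by blast+

lemma (in perm_group) brick_open_vimage:
  assumes "\<And>x. locally_twist G f x" "brick_open A"
  shows "brick_open (f -` A)"
  unfolding brick_open_def
proof
  fix x assume "x \<in> f -` A"
  then obtain \<phi> where p: "brick_label \<phi>" "f x \<in> brick \<phi>" "brick \<phi> \<subseteq> A" using assms(2)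
    unfolding brick_open_def by auto
  obtain \<omega>1 \<omega>2 \<gamma> where l: "brick_label \<omega>1" "x \<in> brick \<omega>1" "acts f \<omega>1 (concat_label \<phi> \<omega>2) \<gamma>"
    using locally_twist_refine[OF assms(1) label_Nil p(1) _ p(2)] by auto
  then have "brick \<omega>1 \<subseteq> f -` A"
    using p by (auto simp: acts_def Phi_concat_label elim!: brickE)
  then show "\<exists>\<phi>. brick_label \<phi> \<and> x \<in> brick \<phi> \<and> brick \<phi> \<subseteq> f -` A" using l by blast
qed

text \<open>Phrasing clopenness by bricks lets it be verified near each point. The product topology
  is consulted only for compactness and for the homeomorphism clause of \<open>SV\<close>.\<close>

definition clop :: "'s point set set" where
  "clop = {A. brick_open A \<and> brick_open (- A)}"

lemma clop_Compl: "A \<in> clop \<Longrightarrow> - A \<in> clop"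
  by (auto simp: clop_def)

lemma clop_Int: "A \<in> clop \<Longrightarrow> B \<in> clop \<Longrightarrow> A \<inter> B \<in> clop"
  by (auto simp: clop_def brick_open_Int brick_open_Un)

lemma clop_UNIV: "UNIV \<in> clop"
  by (auto simp: clop_def)

lemma (in perm_group) clop_vimage: "(\<And>x. locally_twist G f x) \<Longrightarrow> A \<in> clop \<Longrightarrow> f -` A \<in> clop"
  using brick_open_vimage[of f A] brick_open_vimage[of f "- A"]
    by (auto simp: clop_def vimage_Compl)

lemma clop_local:
  assumes "\<And>x. \<exists>\<phi>. brick_label \<phi> \<and> x \<in> brick \<phi> \<and> (\<forall>y\<in>brick \<phi>. y \<in> A \<longleftrightarrow> x \<in> A)"
  shows "A \<in> clop"
  unfolding clop_def brick_open_def
proof (intro CollectI conjI ballI)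
  fix x assume "x \<in> A" then show "\<exists>\<phi>. brick_label \<phi> \<and> x \<in> brick \<phi> \<and> brick \<phi> \<subseteq> A" using assms[of x]
    by blast
next
  fix x assume "x \<in> - A" then show "\<exists>\<phi>. brick_label \<phi> \<and> x \<in> brick \<phi> \<and> brick \<phi> \<subseteq> - A"
    using assms[of x] by blast
qed

lemma clop_nbhd:
  assumes "A \<in> clop"
  shows "\<exists>\<phi>. brick_label \<phi> \<and> x \<in> brick \<phi> \<and> (\<forall>y\<in>brick \<phi>. y \<in> A \<longleftrightarrow> x \<in> A)"
proof (cases "x \<in> A")
  case True
  then obtain \<phi> where "brick_label \<phi>" "x \<in> brick \<phi>" "brick \<phi> \<subseteq> A" using assms
    unfolding clop_def brick_open_def by blast
  then show ?thesis using True by blast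
next
  case False
  then obtain \<phi> where "brick_label \<phi>" "x \<in> brick \<phi>" "brick \<phi> \<subseteq> - A" using assms
    unfolding clop_def brick_open_def by blast
  then show ?thesis using False by blast
qed

lemma clop_coord: "{\<kappa>. \<kappa> s i = b} \<in> clop"
proof (rule clop_local)
  fix x :: "'a point"
  show "\<exists>\<phi>. brick_label \<phi> \<and> x \<in> brick \<phi> \<and> (\<forall>y\<in>brick \<phi>. y \<in> {\<kappa>. \<kappa> s i = b} \<longleftrightarrow> x \<in> {\<kappa>. \<kappa> s i = b})"
    by (intro exI[of _ "cell_label {s} (Suc i) x"]) (auto simp: in_brick_cell_label)
qed

lemma clop_INT: "finite I \<Longrightarrow> (\<And>i. i \<in> I \<Longrightarrow> A i \<in> clop) \<Longrightarrow> (\<Inter>i\<in>I. A i) \<in> clop"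
  by (induction I rule: finite_induct) (auto simp: clop_UNIV clop_Int)

lemma brick_eq_INT: "brick \<phi> = (\<Inter>s\<in>{s. \<phi> s \<noteq> []}. \<Inter>i\<in>{..<length (\<phi> s)}. {\<kappa>. \<kappa> s i = \<phi> s ! i})"
  by (force simp: brick_def is_prefix_def)

lemma clop_brick: "brick_label \<phi> \<Longrightarrow> brick \<phi> \<in> clop"
  unfolding brick_eq_INT brick_label_def by (intro clop_INT clop_coord) auto

lemma topspace_cantorS [simp]: "topspace cantorS_top = UNIV"
  by (simp add: cantorS_top_def cantor_top_def)

lemma continuous_map_cantorS_iff:
  "continuous_map T cantorS_top h \<longleftrightarrow> (\<forall>s i. continuous_map T (discrete_topology UNIV) (\<lambda>x. h x s i))"
  by (simp add: cantorS_top_def cantor_top_def continuous_map_componentwise_UNIV)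

lemma openin_coord: "openin cantorS_top {\<kappa> :: 's point. \<kappa> s i = b}"
proof -
  have "continuous_map cantorS_top cantorS_top (id :: 's point \<Rightarrow> 's point)" by simp
  then have "continuous_map cantorS_top (discrete_topology UNIV) (\<lambda>x :: 's point. id x s i)"
    unfolding continuous_map_cantorS_iff by blast
  then have "openin cantorS_top {x \<in> topspace cantorS_top. id x s i \<in> {b}}"
    by (rule openin_continuous_map_preimage) simp
  then show ?thesis by simp
qed

lemma openin_brick:
  assumes "brick_label \<phi>"
  shows "openin cantorS_top (brick \<phi>)"
proof -
  have t: "openin cantorS_top (\<Inter>i\<in>I. A i)" if "finite I" "\<And>i. i \<in> I \<Longrightarrow> openin cantorS_top (A i)"
    for I and A :: "'i \<Rightarrow> 's point set"
  proof (cases "I = {}")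
    case True
    have "openin cantorS_top (topspace cantorS_top :: 's point set)" by (rule openin_topspace)
    then show ?thesis using True by simp
  next
    case False
    then show ?thesis using that by (intro openin_Inter) auto
  qed
  show ?thesis
    unfolding brick_eq_INT using assms by (intro t openin_coord) (auto simp: brick_label_def)
qed

lemma compact_cantorS: "compact_space cantorS_top"
  by (simp add: cantorS_top_def cantor_top_def compact_space_product_topology compact_space_discrete_topology)

lemma brick_open_openin: "brick_open A \<Longrightarrow> openin cantorS_top A"
  using openin_brick unfolding openin_subopen[of _ A] brick_open_def by meson

text \<open>Compactness gives a finite subcover by good bricks. The grid that reads all coordinates
  occurring in it, to the maximal depth occurring, refines each of these bricks, and
  \<open>P\<close> passes to extensions.\<close>

lemma uniform_label:
  assumes "\<And>x. \<exists>\<phi>. brick_label \<phi> \<and> x \<in> brick \<phi> \<and> P \<phi>"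
    "\<And>\<phi> \<theta>. P \<phi> \<Longrightarrow> brick_label \<theta> \<Longrightarrow> P (concat_label \<phi> \<theta>)"
  shows "\<exists>F n. finite F \<and> (\<forall>x. P (cell_label F n x))"
proof -
  let ?U = "brick ` {\<phi>. brick_label \<phi> \<and> P \<phi>}"
  have "\<exists>\<F>. finite \<F> \<and> \<F> \<subseteq> ?U \<and> topspace cantorS_top \<subseteq> \<Union>\<F>"
    using compact_cantorS unfolding compact_space_alt
  proof (rule spec[of _ ?U, THEN mp], intro conjI)
    show "\<forall>U\<in>?U. openin cantorS_top U" using openin_brick by auto
    show "topspace cantorS_top \<subseteq> \<Union>?U" using assms(1) by auto
  qed
  then obtain \<F> where F: "finite \<F>" "\<F> \<subseteq> ?U" "\<Union>\<F> = UNIV" by auto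
  obtain \<Phi>s where \<Phi>s: "finite \<Phi>s" "\<Phi>s \<subseteq> {\<phi>. brick_label \<phi> \<and> P \<phi>}" "\<F> = brick ` \<Phi>s"
    using finite_subset_image[OF F(1,2)] by blast
  define S where "S = (\<Union>\<phi>\<in>\<Phi>s. {s. \<phi> s \<noteq> []})"
  have S: "finite S" using \<Phi>s by (auto simp: S_def brick_label_def)
  \<comment> \<open>The inserted 0 covers an empty \<open>S\<close>, which occurs when all chosen
    labels are empty.\<close>
  define n where "n = Max (insert 0 ((\<lambda>(\<phi>, s). length (\<phi> s)) ` (\<Phi>s \<times> S)))"
  have n: "length (\<phi> s) \<le> n" if "\<phi> \<in> \<Phi>s" "s \<in> S" for \<phi> s
  proof -
    have "length (\<phi> s) \<in> (\<lambda>(\<phi>, s). length (\<phi> s)) ` (\<Phi>s \<times> S)"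
      using that by (intro image_eqI[of _ _ "(\<phi>, s)"]) auto
    then show ?thesis unfolding n_def using S \<Phi>s(1) by (intro Max_ge) auto
  qed
  have "P (cell_label S n x)" for x
  proof -
    obtain \<phi> where p: "\<phi> \<in> \<Phi>s" "x \<in> brick \<phi>" using F \<Phi>s by blast
    have "length (\<phi> s) \<le> length (cell_label S n x s)" for s
      using n[OF p(1), of s] p by (auto simp: cell_label_def S_def)
    then have "cell_label S n x = concat_label \<phi> (\<lambda>s. drop (length (\<phi> s)) (cell_label S n x s))"
      using p by (intro longer_label) auto
    moreover have "P (concat_label \<phi> (\<lambda>s. drop (length (\<phi> s)) (cell_label S n x s)))"
      by (rule assms(2)[OF _ label_drop[OF label_cell_label[OF S]]]) (use p(1) \<Phi>s(2) in blast)
    ultimately show ?thesis by simp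
  qed
  then show ?thesis using S by blast
qed

section \<open>The group as the set of bijections that are locally twists\<close>

definition twist_group :: "('s \<Rightarrow> 's) set \<Rightarrow> ('s point \<Rightarrow> 's point) set" where
  "twist_group G = {h. bij h \<and> (\<forall>x. locally_twist G h x)}"

context perm_group
begin

lemma uniform_acts:
  assumes "h \<in> twist_group G"
  shows "\<exists>F n \<Psi> g. finite F \<and>
     (\<forall>x. brick_label (\<Psi> (cell_label F n x)) \<and> g (cell_label F n x) \<in> G
         \<and> acts h (cell_label F n x) (\<Psi> (cell_label F n x)) (g (cell_label F n x)))"
proof -
  let ?P = "\<lambda>\<phi>. \<exists>\<psi> \<gamma>. brick_label \<psi> \<and> \<gamma> \<in> G \<and> acts h \<phi> \<psi> \<gamma>"
  have "\<exists>F n. finite F \<and> (\<forall>x. ?P (cell_label F n x))"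
  proof (rule uniform_label)
    show "\<exists>\<phi>. brick_label \<phi> \<and> x \<in> brick \<phi> \<and> ?P \<phi>" for x using assms
      unfolding twist_group_def locally_twist_def by blast
    show "?P (concat_label \<phi> \<theta>)" if "?P \<phi>" "brick_label \<theta>" for \<phi> \<theta>
      using that acts_refine label_concat_label label_perm[OF that(2) bij_imp_bij_inv[OF G_bij]]
        by metis
  qed
  then obtain F n where F: "finite F" "\<And>x. ?P (cell_label F n x)" by blast
  \<comment> \<open>The target and the permutation are chosen as functions of the label, so that all
    points of a cell receive the same ones.\<close>
  define Q where "Q \<phi> q \<longleftrightarrow> brick_label (fst q) \<and> snd q \<in> G \<and> acts h \<phi> (fst q) (snd q)" for \<phi> q
  define q where "q \<phi> = (SOME q. Q \<phi> q)" for \<phi>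
  have "Q (cell_label F n x) (q (cell_label F n x))" for x
    unfolding q_def by (rule someI_ex) (use F(2)[of x] in \<open>auto simp: Q_def\<close>)
  then show ?thesis using F(1)
    by (intro exI[of _ F] exI[of _ n] exI[of _ "fst \<circ> q"] exI[of _ "snd \<circ> q"]) (auto simp: Q_def)
qed

lemma acts_image:
  assumes "acts h \<phi> \<psi> \<gamma>" "bij \<gamma>"
  shows "h ` brick \<phi> = brick \<psi>"
proof
  show "h ` brick \<phi> \<subseteq> brick \<psi>" using assms by (auto simp: acts_def elim!: brickE)
  show "brick \<psi> \<subseteq> h ` brick \<phi>"
  proof
    fix y assume "y \<in> brick \<psi>"
    then obtain \<kappa> where "y = Phi \<psi> \<kappa>" by (rule brickE)
    then have "y = h (Phi \<phi> (tau (inv \<gamma>) \<kappa>))" using assms by (simp add: acts_def)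
    then show "y \<in> h ` brick \<phi>" by blast
  qed
qed

lemma locally_twist_continuous:
  assumes "\<And>x. locally_twist G h x"
  shows "continuous_map cantorS_top cantorS_top h"
  unfolding continuous_map_cantorS_iff
proof (intro allI)
  fix s i
  have "openin cantorS_top {x. h x s i \<in> U}" for U
  proof -
    have "{x. h x s i \<in> U} = (\<Union>b\<in>U. h -` {\<kappa>. \<kappa> s i = b})" by auto
    moreover have "openin cantorS_top (h -` {\<kappa>. \<kappa> s i = b})" for b
      by (intro brick_open_openin brick_open_vimage[OF assms]) (use clop_coord[of s i b] in \<open>simp add: clop_def\<close>)
    ultimately show ?thesis by auto
  qed
  then show "continuous_map cantorS_top (discrete_topology UNIV) (\<lambda>x. h x s i)"
    by (simp add: continuous_map_def)
qed

text \<open>The substantial inclusion reads the source partition off a sufficiently fine grid. A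
  twist maps a brick onto a brick, so the images of the cells are bricks too, and they partition the
  space because \<open>h\<close> is bijective. Continuity of \<open>h\<close> and of its inverse
  follows because both are locally twists.\<close>

lemma SV_eq_twist_group: "SV G = twist_group G"
proof
  show "SV G \<subseteq> twist_group G"
  proof
    fix h assume "h \<in> SV G"
    then obtain \<phi>s \<psi>s \<gamma>s where h: "homeomorphic_map cantorS_top cantorS_top h"
      "length \<psi>s = length \<phi>s" "length \<gamma>s = length \<phi>s" "brick_partition \<phi>s" "brick_partition \<psi>s"
        "set \<gamma>s \<subseteq> G"
      "\<And>i \<kappa>. i < length \<phi>s \<Longrightarrow> \<kappa> \<in> brick (\<phi>s ! i) \<Longrightarrow> h \<kappa> = twist (\<phi>s ! i) (\<psi>s ! i) (\<gamma>s ! i) \<kappa>"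
      unfolding SV_def by blast
    have "bij h" using h(1) by (auto simp: homeomorphic_eq_everything_map bij_def)
    moreover have "locally_twist G h x" for x
    proof -
      obtain i where i: "i < length \<phi>s" "x \<in> brick (\<phi>s ! i)" using h(4)
        unfolding brick_partition_def by blast
      have "\<gamma>s ! i \<in> G" using h(3,6) i(1) nth_mem[of i \<gamma>s] by auto
      then show ?thesis
        unfolding locally_twist_def acts_twist using h i
        by (intro exI[of _ "\<phi>s ! i"] exI[of _ "\<psi>s ! i"] exI[of _ "\<gamma>s ! i"]) (auto simp: brick_partition_def)
    qed
    ultimately show "h \<in> twist_group G" unfolding twist_group_def by blast
  qed
  show "twist_group G \<subseteq> SV G"
  proof
    fix h assume hG: "h \<in> twist_group G"
    then have b: "bij h" and l: "\<And>x. locally_twist G h x" by (auto simp: twist_group_def)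
    have "homeomorphic_maps cantorS_top cantorS_top h (inv h)"
      unfolding homeomorphic_maps_def
      using locally_twist_continuous[OF l] locally_twist_continuous[OF locally_twist_inv[OF b l]] b
        by (auto simp: bij_def surj_f_inv_f)
    then have hom: "homeomorphic_map cantorS_top cantorS_top h" using homeomorphic_map_maps by blast
    obtain F n \<Psi> g where F: "finite F" and
      a: "\<And>x. brick_label (\<Psi> (cell_label F n x))" "\<And>x. g (cell_label F n x) \<in> G"
      "\<And>x. acts h (cell_label F n x) (\<Psi> (cell_label F n x)) (g (cell_label F n x))"
      using uniform_acts[OF hG] by blast
    obtain \<phi>s where p: "set \<phi>s = range (cell_label F n)" "distinct \<phi>s"
      using finite_distinct_list[OF finite_range_cell_label[OF F]] by blast
    have ex: "\<exists>x. \<phi>s ! i = cell_label F n x" if "i < length \<phi>s" for i using p nth_mem[OF that]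
      by auto
    have im: "h ` brick (\<phi>s ! i) = brick (\<Psi> (\<phi>s ! i))" if "i < length \<phi>s" for i
      using ex[OF that] acts_image[OF a(3) G_bij[OF a(2)]] by metis
    have dis: "brick (\<phi>s ! i) \<inter> brick (\<phi>s ! j) = {}" if ij: "i < length \<phi>s" "j < length \<phi>s" "i \<noteq> j"
      for i j
    proof (rule ccontr)
      assume "brick (\<phi>s ! i) \<inter> brick (\<phi>s ! j) \<noteq> {}"
      then obtain z where "z \<in> brick (\<phi>s ! i)" "z \<in> brick (\<phi>s ! j)" by blast
      then have "\<phi>s ! i = cell_label F n z" "\<phi>s ! j = cell_label F n z" using ex ij cell_label_cong
        by metis+
      then show False using nth_eq_iff_index_eq[OF p(2) ij(1,2)] ij(3) by metis
    qed
    have cov: "\<exists>i < length \<phi>s. x \<in> brick (\<phi>s ! i)" for x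
    proof -
      have "cell_label F n x \<in> set \<phi>s" using p by simp
      then show ?thesis by (metis in_set_conv_nth self_in_brick_cell_label)
    qed
    have bp: "brick_partition \<phi>s" unfolding brick_partition_def
    proof (intro conjI allI impI)
      show "brick_label (\<phi>s ! i)" if "i < length \<phi>s" for i using ex[OF that] label_cell_label[OF F]
        by metis
      show "(\<Union>i<length \<phi>s. brick (\<phi>s ! i)) = UNIV" using cov
        unfolding set_eq_iff UN_iff lessThan_iff Bex_def by blast
    qed (rule dis)
    have "brick_partition (map \<Psi> \<phi>s)" unfolding brick_partition_def
    proof (intro conjI allI impI)
      show "brick_label (map \<Psi> \<phi>s ! i)" if "i < length (map \<Psi> \<phi>s)" for i using that ex a(1)
        by fastforce
      show "brick (map \<Psi> \<phi>s ! i) \<inter> brick (map \<Psi> \<phi>s ! j) = {}"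
        if "i < length (map \<Psi> \<phi>s)" "j < length (map \<Psi> \<phi>s)" "i \<noteq> j" for i j
      proof -
        have ij: "i < length \<phi>s" "j < length \<phi>s" using that by auto
        have "h ` brick (\<phi>s ! i) \<inter> h ` brick (\<phi>s ! j) = {}"
          using dis[OF ij that(3)] image_Int[OF bij_is_inj[OF b], symmetric] by simp
        then show ?thesis using im ij by simp
      qed
      have "\<exists>i < length (map \<Psi> \<phi>s). y \<in> brick (map \<Psi> \<phi>s ! i)" for y
      proof -
        obtain i where i: "i < length \<phi>s" "inv h y \<in> brick (\<phi>s ! i)" using cov by blast
        then have "h (inv h y) \<in> brick (\<Psi> (\<phi>s ! i))" using im[OF i(1)] by blast
        then show ?thesis using i(1) surj_f_inv_f[OF bij_is_surj[OF b], of y] by auto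
      qed
      then show "(\<Union>i<length (map \<Psi> \<phi>s). brick (map \<Psi> \<phi>s ! i)) = UNIV"
        unfolding set_eq_iff UN_iff lessThan_iff Bex_def by blast
    qed
    moreover have "set (map g \<phi>s) \<subseteq> G" using p a(2) by auto
    moreover have "\<forall>i<length \<phi>s. \<forall>\<kappa>\<in>brick (\<phi>s ! i). h \<kappa> = twist (\<phi>s ! i) (map \<Psi> \<phi>s ! i) (map g \<phi>s ! i) \<kappa>"
    proof (intro allI impI)
      fix i assume i: "i < length \<phi>s"
      then obtain x where "\<phi>s ! i = cell_label F n x" using ex by blast
      then show "\<forall>\<kappa>\<in>brick (\<phi>s ! i). h \<kappa> = twist (\<phi>s ! i) (map \<Psi> \<phi>s ! i) (map g \<phi>s ! i) \<kappa>"
        using a(3)[of x] i unfolding acts_twist by simp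
    qed
    ultimately show "h \<in> SV G" unfolding SV_def using hom bp
      by (intro CollectI conjI exI[of _ \<phi>s] exI[of _ "map \<Psi> \<phi>s"] exI[of _ "map g \<phi>s"]) auto
  qed
qed

end

context perm_group
begin

lemma twist_group_bij: "h \<in> twist_group G \<Longrightarrow> bij h"
  and twist_group_locally_twist: "h \<in> twist_group G \<Longrightarrow> locally_twist G h x"
  by (auto simp: twist_group_def)

lemma twist_groupI: "bij h \<Longrightarrow> (\<And>x. locally_twist G h x) \<Longrightarrow> h \<in> twist_group G"
  unfolding twist_group_def by blast

lemma twist_group_id: "id \<in> twist_group G"
  by (rule twist_groupI) (auto simp: locally_twist_id)

lemma twist_group_comp: "g \<in> twist_group G \<Longrightarrow> h \<in> twist_group G \<Longrightarrow> g \<circ> h \<in> twist_group G"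
  by (rule twist_groupI) (auto intro: bij_comp twist_group_bij locally_twist_comp twist_group_locally_twist)

lemma twist_group_inv: "g \<in> twist_group G \<Longrightarrow> inv g \<in> twist_group G"
  by (rule twist_groupI) (auto intro: bij_imp_bij_inv twist_group_bij locally_twist_inv twist_group_locally_twist)

lemma twist_group_image_clop:
  assumes "g \<in> twist_group G" "A \<in> clop"
  shows "g ` A \<in> clop"
proof -
  have b: "bij g" using assms twist_group_bij by blast
  have "inv g -` A = g ` A"
    using bij_vimage_eq_inv_image[OF bij_imp_bij_inv[OF b]] inv_inv_eq[OF b] by metis
  then show ?thesis
    using clop_vimage[OF twist_group_locally_twist[OF twist_group_inv[OF assms(1)]] assms(2)]
      by metis
qed

lemma locally_twist_glue:
  assumes "A \<in> clop" "x \<in> A" "\<And>y. y \<in> A \<Longrightarrow> f y = g y" "locally_twist G g x"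
  shows "locally_twist G f x"
proof -
  obtain \<phi> where p: "brick_label \<phi>" "x \<in> brick \<phi>" "\<forall>y\<in>brick \<phi>. y \<in> A \<longleftrightarrow> x \<in> A"
    using clop_nbhd[OF assms(1)] by blast
  then have "f y = g y" if "y \<in> brick \<phi>" for y using assms(2,3) that by blast
  then show ?thesis using locally_twist_cong[OF p(1,2) _ assms(4)] by blast
qed

end

section \<open>Dissections into bricks and transitivity on clopen sets\<close>

definition single_label :: "'s \<Rightarrow> bool list \<Rightarrow> 's \<Rightarrow> bool list" where
  "single_label s w = (\<lambda>t. if t = s then w else [])"

lemma label_single_label [simp, intro]: "brick_label (single_label s w)"
  unfolding brick_label_def by (rule finite_subset[of _ "{s}"]) (auto simp: single_label_def)

lemma in_brick_single_label: "x \<in> brick (single_label s w) \<longleftrightarrow> (\<forall>i<length w. x s i = w ! i)"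
  by (auto simp: brick_def is_prefix_def single_label_def)

lemma concat_label_single_label: "concat_label (single_label s u) (single_label s v)
    = single_label s (u @ v)"
  by (auto simp: concat_label_def single_label_def)

lemma Phi_nth: "Phi \<phi> \<kappa> s (length (\<phi> s) + i) = \<kappa> s i"
  by (simp add: Phi_def concat_seq_def)

lemma Phi_single_label_0: "Phi (single_label s [a]) \<kappa> s 0 = a"
  by (simp add: Phi_def concat_seq_def single_label_def)

lemma first_letter:
  obtains a \<kappa> where "x = Phi (single_label s [a]) \<kappa>"
proof -
  have "x \<in> brick (single_label s [x s 0])" by (simp add: in_brick_single_label)
  then show ?thesis using brickE that by metis
qed

definition dissection :: "'s point set \<Rightarrow> ('s \<Rightarrow> bool list) set \<Rightarrow> bool" where
  "dissection A \<A> \<longleftrightarrow> finite \<A> \<and> (\<forall>\<phi>\<in>\<A>. brick_label \<phi>)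
     \<and> (\<forall>\<phi>\<in>\<A>. \<forall>\<psi>\<in>\<A>. \<phi> \<noteq> \<psi> \<longrightarrow> brick \<phi> \<inter> brick \<psi> = {}) \<and> (\<Union>\<phi>\<in>\<A>. brick \<phi>) = A"

lemma dissection_exists:
  assumes "A \<in> clop"
  shows "\<exists>\<A>. dissection A \<A>"
proof -
  have "\<exists>F n. finite F \<and> (\<forall>x. brick (cell_label F n x) \<subseteq> A \<or> brick (cell_label F n x) \<inter> A = {})"
  proof (rule uniform_label)
    show "\<exists>\<phi>. brick_label \<phi> \<and> x \<in> brick \<phi> \<and> (brick \<phi> \<subseteq> A \<or> brick \<phi> \<inter> A = {})" for x
      using clop_nbhd[OF assms, of x] by blast
    show "brick (concat_label \<phi> \<theta>) \<subseteq> A \<or> brick (concat_label \<phi> \<theta>) \<inter> A = {}"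
      if "brick \<phi> \<subseteq> A \<or> brick \<phi> \<inter> A = {}" "brick_label \<theta>" for \<phi> \<theta>
      using that brick_concat_label_subset[of \<phi> \<theta>] by blast
  qed
  then obtain F n where F: "finite F"
    "\<And>x. brick (cell_label F n x) \<subseteq> A \<or> brick (cell_label F n x) \<inter> A = {}" by blast
  have "dissection A (cell_label F n ` A)" unfolding dissection_def
  proof (intro conjI ballI impI)
    show "finite (cell_label F n ` A)" using finite_range_cell_label[OF F(1)]
      by (rule finite_subset[rotated]) auto
    show "brick_label \<phi>" if "\<phi> \<in> cell_label F n ` A" for \<phi> using that label_cell_label[OF F(1)]
      by auto
    show "brick \<phi> \<inter> brick \<psi> = {}" if pq: "\<phi> \<in> cell_label F n ` A" "\<psi> \<in> cell_label F n ` A" "\<phi> \<noteq> \<psi>"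
      for \<phi> \<psi>
    proof (rule ccontr)
      assume "brick \<phi> \<inter> brick \<psi> \<noteq> {}"
      then obtain z where "z \<in> brick \<phi>" "z \<in> brick \<psi>" by blast
      then have "\<phi> = cell_label F n z" "\<psi> = cell_label F n z" using pq cell_label_cong
        by (metis imageE)+
      then show False using pq by simp
    qed
    have "brick (cell_label F n x) \<subseteq> A" if "x \<in> A" for x
      using F(2)[of x] that self_in_brick_cell_label by blast
    then show "\<Union> (brick ` (cell_label F n ` A)) = A" using self_in_brick_cell_label by blast
  qed
  then show ?thesis by blast
qed

text \<open>One brick is cut in two by the next letter at some coordinate. Since the number of
  bricks grows by exactly one, every larger number is attained.\<close>

lemma dissection_more:
  fixes A :: "'s point set"
  assumes "dissection A \<A>" "A \<noteq> {}"
  shows "\<exists>\<A>'. dissection A \<A>' \<and> card \<A>' = Suc (card \<A>)"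
proof -
  obtain \<phi> where p: "\<phi> \<in> \<A>" using assms by (auto simp: dissection_def)
  \<comment> \<open>Any coordinate serves; one exists because types are inhabited.\<close>
  fix s :: 's
  let ?p = "\<lambda>b. concat_label \<phi> (single_label s [b])"
  have ne: "brick \<psi> \<noteq> {}" for \<psi> :: "'s \<Rightarrow> bool list" using Phi_in_brick by blast
  have un: "brick \<phi> = brick (?p False) \<union> brick (?p True)"
  proof
    show "brick \<phi> \<subseteq> brick (?p False) \<union> brick (?p True)"
    proof
      fix x assume "x \<in> brick \<phi>"
      then obtain \<kappa> where x: "x = Phi \<phi> \<kappa>" by (rule brickE)
      obtain a \<kappa>' where "\<kappa> = Phi (single_label s [a]) \<kappa>'" by (rule first_letter)
      then have "x \<in> brick (?p a)" using x by (simp flip: Phi_concat_label)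
      then show "x \<in> brick (?p False) \<union> brick (?p True)" by (cases a) auto
    qed
  qed (use brick_concat_label_subset in blast)
  have dis: "brick (?p False) \<inter> brick (?p True) = {}"
  proof (rule ccontr)
    assume "brick (?p False) \<inter> brick (?p True) \<noteq> {}"
    then obtain x where "x \<in> brick (?p False)" "x \<in> brick (?p True)" by blast
    then obtain \<kappa> \<kappa>' where "x = Phi (?p False) \<kappa>" "x = Phi (?p True) \<kappa>'" using brickE by metis
    then have "Phi (single_label s [False]) \<kappa> = Phi (single_label s [True]) \<kappa>'"
      by (simp add: Phi_concat_label)
    then show False using Phi_single_label_0 by metis
  qed
  have od: "brick \<psi> \<inter> brick (?p b) = {}" if "\<psi> \<in> \<A> - {\<phi>}" for \<psi> b
  proof -
    have "brick \<psi> \<inter> brick \<phi> = {}" using assms(1) that p unfolding dissection_def by blast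
    then show ?thesis using brick_concat_label_subset[of \<phi> "single_label s [b]"] by blast
  qed
  have ni: "?p b \<notin> \<A> - {\<phi>}" for b using od ne by blast
  have pp: "?p False \<noteq> ?p True" using dis ne by auto
  let ?A' = "insert (?p False) (insert (?p True) (\<A> - {\<phi>}))"
  have fin: "finite \<A>" using assms by (simp add: dissection_def)
  have "card ?A' = Suc (card \<A>)"
  proof -
    have "card \<A> > 0" using fin p card_gt_0_iff by blast
    then show ?thesis using fin ni pp p by (simp add: card_Diff_singleton)
  qed
  moreover have "dissection A ?A'" unfolding dissection_def
  proof (intro conjI ballI impI)
    show "finite ?A'" using fin by simp
    show "brick_label \<psi>" if "\<psi> \<in> ?A'" for \<psi>
      using that assms(1) p label_concat_label[OF _ label_single_label] unfolding dissection_def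
        by blast
    show "brick \<psi> \<inter> brick \<psi>' = {}" if "\<psi> \<in> ?A'" "\<psi>' \<in> ?A'" "\<psi> \<noteq> \<psi>'" for \<psi> \<psi>'
    proof -
      have "brick \<psi> \<inter> brick \<psi>' = {}" if "\<psi> \<in> \<A> - {\<phi>}" "\<psi>' \<in> \<A> - {\<phi>}"
        using assms(1) that \<open>\<psi> \<noteq> \<psi>'\<close> unfolding dissection_def by blast
      then show ?thesis using that od dis by (elim insertE) (simp_all add: Int_commute)
    qed
    have "A = brick \<phi> \<union> (\<Union>\<psi>\<in>\<A> - {\<phi>}. brick \<psi>)" using assms(1) p unfolding dissection_def by blast
    then show "\<Union> (brick ` ?A') = A" using un by auto
  qed
  ultimately show ?thesis by blast
qed

lemma dissection_card:
  assumes "dissection A \<A>" "A \<noteq> {}"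
  shows "\<exists>\<A>'. dissection A \<A>' \<and> card \<A>' = card \<A> + k"
proof (induction k)
  case (Suc k)
  then obtain \<A>' where "dissection A \<A>'" "card \<A>' = card \<A> + k" by blast
  then show ?case using dissection_more[OF _ assms(2)] by fastforce
qed (use assms in auto)

context perm_group
begin

lemma dissection_map:
  assumes "dissection A \<A>" "dissection B \<B>" "card \<A> = card \<B>"
  shows "\<exists>f. bij_betw f A B \<and> (\<forall>x\<in>A. locally_twist G f x)"
proof -
  obtain \<beta> where \<beta>: "bij_betw \<beta> \<A> \<B>"
    using finite_same_card_bij assms unfolding dissection_def by metis
  define L where "L x = (THE \<phi>. \<phi> \<in> \<A> \<and> x \<in> brick \<phi>)" for x
  have L: "L (Phi \<phi> \<kappa>) = \<phi>" if "\<phi> \<in> \<A>" for \<phi> \<kappa>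
    unfolding L_def
  proof (rule the_equality)
    show "\<psi> = \<phi>" if "\<psi> \<in> \<A> \<and> Phi \<phi> \<kappa> \<in> brick \<psi>" for \<psi>
      using that \<open>\<phi> \<in> \<A>\<close> assms(1) Phi_in_brick[of \<phi> \<kappa>] unfolding dissection_def
        by (metis disjoint_iff)
  qed (use that in simp)
  define f where "f x = Phi (\<beta> (L x)) (Phi_inv (L x) x)" for x
  have f: "f (Phi \<phi> \<kappa>) = Phi (\<beta> \<phi>) \<kappa>" if "\<phi> \<in> \<A>" for \<phi> \<kappa> by (simp add: f_def L[OF that])
  have A: "\<exists>\<phi>\<in>\<A>. \<exists>\<kappa>. x = Phi \<phi> \<kappa>" if "x \<in> A" for x
    using that assms(1) unfolding dissection_def by (metis UN_iff brickE)
  have B: "\<exists>\<psi>\<in>\<B>. \<exists>\<kappa>. x = Phi \<psi> \<kappa>" if "x \<in> B" for x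
    using that assms(2) unfolding dissection_def by (metis UN_iff brickE)
  have \<beta>B: "\<beta> \<phi> \<in> \<B>" if "\<phi> \<in> \<A>" for \<phi> using \<beta> that bij_betw_apply by metis
  have "bij_betw f A B" unfolding bij_betw_def
  proof
    show "inj_on f A"
    proof (rule inj_onI)
      fix x y assume xy: "x \<in> A" "y \<in> A" "f x = f y"
      obtain \<phi> \<kappa> \<phi>' \<kappa>' where e: "\<phi> \<in> \<A>" "x = Phi \<phi> \<kappa>" "\<phi>' \<in> \<A>" "y = Phi \<phi>' \<kappa>'" using A xy by metis
      then have "Phi (\<beta> \<phi>) \<kappa> = Phi (\<beta> \<phi>') \<kappa>'" using f xy by simp
      moreover from this have "\<beta> \<phi> = \<beta> \<phi>'"
        using assms(2) \<beta>B[OF e(1)] \<beta>B[OF e(3)] Phi_in_brick[of "\<beta> \<phi>" \<kappa>] Phi_in_brick[of "\<beta> \<phi>'" \<kappa>']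
        unfolding dissection_def by (metis disjoint_iff)
      moreover from this have "\<phi> = \<phi>'" using \<beta> e by (metis bij_betw_def inj_onD)
      ultimately show "x = y" using e by simp
    qed
    show "f ` A = B"
    proof
      show "f ` A \<subseteq> B"
      proof
        fix y assume "y \<in> f ` A"
        then obtain \<phi> \<kappa> where "\<phi> \<in> \<A>" "y = f (Phi \<phi> \<kappa>)" using A by blast
        then have "y \<in> brick (\<beta> \<phi>)" "\<beta> \<phi> \<in> \<B>" using f \<beta>B by auto
        then show "y \<in> B" using assms(2) unfolding dissection_def by blast
      qed
      show "B \<subseteq> f ` A"
      proof
        fix y assume "y \<in> B"
        then obtain \<psi> \<kappa> where p: "\<psi> \<in> \<B>" "y = Phi \<psi> \<kappa>" using B by metis
        then obtain \<phi> where q: "\<phi> \<in> \<A>" "\<psi> = \<beta> \<phi>" using \<beta> by (auto simp: bij_betw_def)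
        then have "y = f (Phi \<phi> \<kappa>)" "Phi \<phi> \<kappa> \<in> A" using p f assms(1) unfolding dissection_def
          by auto
        then show "y \<in> f ` A" by blast
      qed
    qed
  qed
  moreover have "locally_twist G f x" if "x \<in> A" for x
  proof -
    obtain \<phi> \<kappa> where e: "\<phi> \<in> \<A>" "x = Phi \<phi> \<kappa>" using A \<open>x \<in> A\<close> by metis
    show ?thesis
      by (rule locally_twistI[of \<phi> "\<beta> \<phi>"
        id]) (use e \<beta>B[OF e(1)] assms f in \<open>auto simp: dissection_def\<close>)
  qed
  ultimately show ?thesis by blast
qed

text \<open>Dissections of both sets are refined to the common size
  \<open>card \<A> + card \<B>\<close> and then matched brick by brick, without permuting
  coordinates.\<close>

lemma clop_map:
  assumes "A \<in> clop" "B \<in> clop" "A \<noteq> {}" "B \<noteq> {}"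
  shows "\<exists>f. bij_betw f A B \<and> (\<forall>x\<in>A. locally_twist G f x)"
proof -
  obtain \<A> \<B> where d: "dissection A \<A>" "dissection B \<B>" using dissection_exists assms by metis
  obtain \<A>' where a: "dissection A \<A>'" "card \<A>' = card \<A> + card \<B>"
    using dissection_card[OF d(1) assms(3)] by blast
  obtain \<B>' where b: "dissection B \<B>'" "card \<B>' = card \<B> + card \<A>"
    using dissection_card[OF d(2) assms(4)] by blast
  show ?thesis using dissection_map[OF a(1) b(1)] a b by simp
qed

lemma twist_group_transitive:
  assumes "A \<in> clop" "B \<in> clop" "A \<noteq> {}" "B \<noteq> {}" "A \<noteq> UNIV" "B \<noteq> UNIV"
  shows "\<exists>g\<in>twist_group G. g ` A = B"
proof -
  obtain f where f: "bij_betw f A B" "\<And>x. x \<in> A \<Longrightarrow> locally_twist G f x" using clop_map[of A B] assms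
    by blast
  obtain f' where f': "bij_betw f' (- A) (- B)" "\<And>x. x \<in> - A \<Longrightarrow> locally_twist G f' x"
    using clop_map[of "- A" "- B"] assms clop_Compl by blast
  define g where "g x = (if x \<in> A then f x else f' x)" for x
  have "bij_betw g A B" "bij_betw g (- A) (- B)"
    using f(1) f'(1) bij_betw_cong[of A g f] bij_betw_cong[of "- A" g f'] by (auto simp: g_def)
  then have "bij_betw g (A \<union> - A) (B \<union> - B)" by (rule bij_betw_combine) auto
  then have "bij g" by simp
  moreover have "locally_twist G g x" for x
  proof (cases "x \<in> A")
    case True
    then show ?thesis using locally_twist_glue[OF assms(1) True, of g f] f(2) by (simp add: g_def)
  next
    case False
    then show ?thesis using locally_twist_glue[OF clop_Compl[OF assms(1)], of x g f'] f'(2)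
      by (simp add: g_def)
  qed
  moreover have "g ` A = B" using \<open>bij_betw g A B\<close> by (simp add: bij_betw_def)
  ultimately show ?thesis using twist_groupI by blast
qed

lemma flexible: "flexible_action (twist_group G) clop"
proof
  show "id \<in> twist_group G" by (rule twist_group_id)
  show "g \<circ> h \<in> twist_group G" if "g \<in> twist_group G" "h \<in> twist_group G" for g h
    using twist_group_comp that .
  show "inv g \<in> twist_group G" "bij g" if "g \<in> twist_group G" for g
    using twist_group_inv twist_group_bij that by auto
  show "UNIV \<in> clop" by (rule clop_UNIV)
  show "- A \<in> clop" if "A \<in> clop" for A :: "'s point set" using clop_Compl that .
  show "A \<inter> B \<in> clop" if "A \<in> clop" "B \<in> clop" for A B :: "'s point set" using clop_Int that .
  show "g ` A \<in> clop" if "g \<in> twist_group G" "A \<in> clop" for g A using twist_group_image_clop that .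
  show "\<exists>g\<in>twist_group G. g ` A = B"
    if "A \<in> clop" "B \<in> clop" "A \<noteq> {}" "B \<noteq> {}" "A \<noteq> UNIV" "B \<noteq> UNIV" for A B
    using twist_group_transitive that .
next
  fix g :: "'s point \<Rightarrow> 's point"
  assume g: "bij g" "\<And>x. \<exists>A\<in>clop. x \<in> A \<and> (\<exists>h\<in>twist_group G. \<forall>y\<in>A. g y = h y)"
  show "g \<in> twist_group G"
  proof (rule twist_groupI[OF g(1)])
    fix x
    obtain A h where "A \<in> clop" "x \<in> A" "h \<in> twist_group G" "\<forall>y\<in>A. g y = h y" using g(2)[of x]
      by blast
    then show "locally_twist G g x" using locally_twist_glue twist_group_locally_twist by metis
  qed
next
  fix g assume g: "g \<in> twist_group G" "g \<noteq> id"
  then obtain x where "g x \<noteq> x" by (auto simp: fun_eq_iff)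
  then obtain s i where si: "g x s i \<noteq> x s i" unfolding fun_eq_iff by blast
  \<comment> \<open>On this set the letter of coordinate \<open>s\<close> at place \<open>i\<close>
    is \<open>x s i\<close> before applying \<open>g\<close> and the other letter afterwards, so the
    image misses the set.\<close>
  let ?A = "{\<kappa>. \<kappa> s i = x s i} \<inter> g -` {\<kappa>. \<kappa> s i = g x s i}"
  have "?A \<in> clop" by (intro clop_Int clop_coord clop_vimage twist_group_locally_twist g)
  moreover have "x \<in> ?A" by simp
  then have "?A \<noteq> {}" by (metis empty_iff)
  moreover have "g ` ?A \<inter> ?A = {}" using si by auto
  ultimately show "\<exists>A\<in>clop. A \<noteq> {} \<and> g ` A \<inter> A = {}" by (intro bexI[of _ ?A] conjI)
next
  fix A :: "'s point set"
  assume A: "A \<in> clop" "A \<noteq> {}"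
  then obtain x where x: "x \<in> A" by blast
  obtain \<phi> where p: "\<forall>y\<in>brick \<phi>. y \<in> A \<longleftrightarrow> x \<in> A" using clop_nbhd[OF A(1)] by blast
  fix s :: 's
  \<comment> \<open>The first letter behind the label at \<open>s\<close> is unconstrained in the
    brick, so both of its values occur there.\<close>
  let ?U = "{\<kappa>. \<kappa> s (length (\<phi> s)) = True}"
  have "Phi \<phi> (\<lambda>_ _. b) s (length (\<phi> s)) = b" for b using Phi_nth[of \<phi> "\<lambda>_ _. b" s 0] by simp
  then have "Phi \<phi> (\<lambda>_ _. True) \<in> A \<inter> ?U" "Phi \<phi> (\<lambda>_ _. False) \<in> A - ?U" using p x by auto
  then have "A \<inter> ?U \<noteq> {}" "A - ?U \<noteq> {}" by (metis empty_iff)+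
  then show "\<exists>U\<in>clop. A \<inter> U \<noteq> {} \<and> A - U \<noteq> {}" by (intro bexI[OF _ clop_coord] conjI)
qed

end

sublocale perm_group \<subseteq> flex: flexible_action "twist_group G" clop
  by (rule flexible)

section \<open>Copies of elements on bricks\<close>

definition local_copy :: "('s \<Rightarrow> bool list) \<Rightarrow> ('s point \<Rightarrow> 's point) \<Rightarrow> 's point \<Rightarrow> 's point" where
  "local_copy \<phi> g x = (if x \<in> brick \<phi> then Phi \<phi> (g (Phi_inv \<phi> x)) else x)"

lemma local_copy_Phi [simp]: "local_copy \<phi> g (Phi \<phi> \<kappa>) = Phi \<phi> (g \<kappa>)"
  by (simp add: local_copy_def)

lemma local_copy_outside: "x \<notin> brick \<phi> \<Longrightarrow> local_copy \<phi> g x = x"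
  by (simp add: local_copy_def)

lemma local_copy_local_copy: "local_copy \<phi> (local_copy \<theta> g) = local_copy (concat_label \<phi> \<theta>) g"
proof
  fix x
  show "local_copy \<phi> (local_copy \<theta> g) x = local_copy (concat_label \<phi> \<theta>) g x"
  proof (cases "x \<in> brick \<phi>")
    case True
    then obtain \<kappa> where x: "x = Phi \<phi> \<kappa>" by (rule brickE)
    show ?thesis
    proof (cases "\<kappa> \<in> brick \<theta>")
      case True
      then obtain \<kappa>' where "\<kappa> = Phi \<theta> \<kappa>'" by (rule brickE)
      then show ?thesis using x local_copy_Phi[of "concat_label \<phi> \<theta>" g \<kappa>']
        by (simp add: Phi_concat_label)
    next
      case False
      have "x \<notin> brick (concat_label \<phi> \<theta>)"
      proof
        assume "x \<in> brick (concat_label \<phi> \<theta>)"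
        then obtain \<kappa>' where "x = Phi (concat_label \<phi> \<theta>) \<kappa>'" by (rule brickE)
        then show False using x False by (auto simp: Phi_concat_label)
      qed
      then show ?thesis using x False by (simp add: local_copy_outside)
    qed
  next
    case False
    then have "x \<notin> brick (concat_label \<phi> \<theta>)" using brick_concat_label_subset by blast
    then show ?thesis using False by (simp add: local_copy_outside)
  qed
qed

text \<open>Going over with \<open>g\<close> and returning with its inverse makes this an involution
  for every \<open>g\<close>; varying \<open>g\<close> produces swaps with the same two
  bricks.\<close>

definition brick_swap :: "('s \<Rightarrow> bool list) \<Rightarrow> ('s \<Rightarrow> bool list) \<Rightarrow> ('s point \<Rightarrow> 's point) \<Rightarrow> 's point \<Rightarrow> 's point" where
  "brick_swap \<phi> \<psi> g x = (if x \<in> brick \<phi> then Phi \<psi> (g (Phi_inv \<phi> x))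
     else if x \<in> brick \<psi> then Phi \<phi> (inv g (Phi_inv \<psi> x)) else x)"

context perm_group
begin

lemma locally_twist_Phi_conj:
  assumes "brick_label \<phi>" "brick_label \<psi>" "locally_twist G g \<kappa>" "\<And>\<kappa>. f (Phi \<phi> \<kappa>) = Phi \<psi> (g \<kappa>)"
  shows "locally_twist G f (Phi \<phi> \<kappa>)"
proof -
  obtain \<alpha> \<beta> \<gamma> where g: "brick_label \<alpha>" "brick_label \<beta>" "\<gamma> \<in> G" "\<kappa> \<in> brick \<alpha>" "acts g \<alpha> \<beta> \<gamma>"
    using assms(3) unfolding locally_twist_def by blast
  obtain \<kappa>' where "\<kappa> = Phi \<alpha> \<kappa>'" using g(4) by (rule brickE)
  then have "Phi \<phi> \<kappa> \<in> brick (concat_label \<phi> \<alpha>)" by (simp flip: Phi_concat_label)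
  moreover have "f (Phi (concat_label \<phi> \<alpha>) \<kappa>) = Phi (concat_label \<psi> \<beta>) (tau \<gamma> \<kappa>)" for \<kappa>
    using g(5) assms(4) by (simp add: Phi_concat_label acts_def)
  ultimately show ?thesis
    using locally_twistI[OF label_concat_label[OF assms(1) g(1)] label_concat_label[OF assms(2) g(2)] g(3)] by blast
qed

lemma locally_twist_fixed:
  assumes "A \<in> clop" "x \<in> A" "\<And>y. y \<in> A \<Longrightarrow> f y = y"
  shows "locally_twist G f x"
  using locally_twist_glue[OF assms(1,2), of f id] assms(3) locally_twist_id by simp

lemma local_copy_twist_group:
  assumes "brick_label \<phi>" "g \<in> twist_group G"
  shows "local_copy \<phi> g \<in> twist_group G"
proof (rule twist_groupI)
  have "local_copy \<phi> (inv g) (local_copy \<phi> g x) = x" "local_copy \<phi> g (local_copy \<phi> (inv g) x) = x"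
    for x
    by (cases "x \<in> brick \<phi>"; auto elim!: brickE simp: assms local_copy_outside)+
  then show "bij (local_copy \<phi> g)"
    by (intro o_bij[of "local_copy \<phi> (inv g)"]) (auto simp: fun_eq_iff)
  show "locally_twist G (local_copy \<phi> g) x" for x
  proof (cases "x \<in> brick \<phi>")
    case True
    then obtain \<kappa> where "x = Phi \<phi> \<kappa>" by (rule brickE)
    then show ?thesis
      using locally_twist_Phi_conj[OF assms(1,1) twist_group_locally_twist[OF assms(2)]] by simp
  next
    case False
    then show ?thesis using locally_twist_fixed[OF clop_Compl[OF clop_brick[OF assms(1)]]]
      by (simp add: local_copy_outside)
  qed
qed

text \<open>The converse of forming copies on a brick. Together they show that \<open>Phi\<close>
  meets the requirements on the embedding in \<open>two_torsion_generators\<close>.\<close>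

lemma rist_unloc:
  assumes "brick_label \<phi>" "h \<in> flex.rist (brick \<phi>)"
  shows "inv (Phi \<phi>) \<circ> h \<circ> Phi \<phi> \<in> twist_group G"
proof (rule twist_groupI)
  let ?f = "inv (Phi \<phi>) \<circ> h \<circ> Phi \<phi>"
  let ?f' = "inv (Phi \<phi>) \<circ> inv h \<circ> Phi \<phi>"
  have hG: "h \<in> twist_group G" using assms flex.rist_mem by blast
  have r: "Phi \<phi> (inv (Phi \<phi>) x) = x" if "x \<in> brick \<phi>" for x
    using that range_Phi f_inv_into_f by metis
  have i: "inv (Phi \<phi>) (Phi \<phi> x) = x" for x using inj_Phi inv_f_f by metis
  have st: "h (Phi \<phi> \<kappa>) \<in> brick \<phi>" "inv h (Phi \<phi> \<kappa>) \<in> brick \<phi>" for \<kappa>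
    using flex.rist_stable[OF assms(2)] flex.rist_stable[OF flex.rist_inv[OF assms(2)]] by auto
  have "?f' (?f x) = x" "?f (?f' x) = x" for x using r st i hG by auto
  then show "bij ?f" by (intro o_bij[of ?f']) (auto simp: fun_eq_iff)
  fix \<kappa>
  obtain \<omega>1 \<omega>2 \<gamma> where l: "brick_label \<omega>1" "brick_label \<omega>2" "\<gamma> \<in> G"
    "Phi \<phi> \<kappa> \<in> brick (concat_label \<phi> \<omega>1)"
    "acts h (concat_label \<phi> \<omega>1) (concat_label \<phi> \<omega>2) \<gamma>"
    using locally_twist_refine[OF twist_group_locally_twist[OF hG] assms(1,1) _ st(1)[of \<kappa>]] by auto
  obtain \<kappa>' where "Phi \<phi> \<kappa> = Phi (concat_label \<phi> \<omega>1) \<kappa>'" using l(4) by (rule brickE)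
  then have "\<kappa> \<in> brick \<omega>1" by (simp add: Phi_concat_label)
  then show "locally_twist G ?f \<kappa>"
    by (rule locally_twistI[OF l(1,2,3)]) (use l(5) i in \<open>simp add: acts_def Phi_concat_label\<close>)
qed

lemma is_swap_brick_swap:
  assumes "brick_label \<phi>" "brick_label \<psi>" "brick \<phi> \<inter> brick \<psi> = {}" "brick \<phi> \<union> brick \<psi> \<noteq> UNIV"
    "g \<in> twist_group G"
  shows "flex.is_swap (brick_swap \<phi> \<psi> g) (brick \<phi>)"
proof -
  let ?p = "brick_swap \<phi> \<psi> g"
  have ni: "Phi \<psi> \<kappa> \<notin> brick \<phi>" for \<kappa> using assms(3) by auto
  have p1: "?p (Phi \<phi> \<kappa>) = Phi \<psi> (g \<kappa>)" for \<kappa> by (simp add: brick_swap_def)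
  have p2: "?p (Phi \<psi> \<kappa>) = Phi \<phi> (inv g \<kappa>)" for \<kappa> using ni by (simp add: brick_swap_def)
  have p3: "?p x = x" if "x \<notin> brick \<phi>" "x \<notin> brick \<psi>" for x using that by (simp add: brick_swap_def)
  have inv: "?p (?p x) = x" for x
  proof -
    consider "x \<in> brick \<phi>" | "x \<in> brick \<psi>" | "x \<notin> brick \<phi>" "x \<notin> brick \<psi>" by blast
    then show ?thesis
    proof cases
      case 1 then show ?thesis using assms(5) by (elim brickE) (simp add: p1 p2)
    next
      case 2 then show ?thesis using assms(5) by (elim brickE) (simp add: p1 p2)
    next
      case 3 then show ?thesis by (simp add: p3)
    qed
  qed
  have "?p \<in> twist_group G"
  proof (rule twist_groupI)
    show "bij ?p" using inv by (intro o_bij[of ?p]) (auto simp: fun_eq_iff)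
    fix x
    consider "x \<in> brick \<phi>" | "x \<in> brick \<psi>" | "x \<in> - (brick \<phi>) \<inter> - (brick \<psi>)" by blast
    then show "locally_twist G ?p x"
    proof cases
      case 1
      then obtain \<kappa> where "x = Phi \<phi> \<kappa>" by (rule brickE)
      then show ?thesis
        using locally_twist_Phi_conj[OF assms(1,2) twist_group_locally_twist[OF assms(5)] p1]
          by simp
    next
      case 2
      then obtain \<kappa> where "x = Phi \<psi> \<kappa>" by (rule brickE)
      then show ?thesis
        using locally_twist_Phi_conj[OF assms(2,1) twist_group_locally_twist[OF twist_group_inv[OF assms(5)]] p2] by simp
    next
      case 3
      have "- (brick \<phi>) \<inter> - (brick \<psi>) \<in> clop" using clop_Int clop_Compl clop_brick assms by blast
      then show ?thesis using 3 p3 by (intro locally_twist_fixed) auto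
    qed
  qed
  moreover have im: "?p ` brick \<phi> = brick \<psi>"
  proof
    show "?p ` brick \<phi> \<subseteq> brick \<psi>" using p1 by (auto elim!: brickE)
    show "brick \<psi> \<subseteq> ?p ` brick \<phi>"
    proof
      fix x assume "x \<in> brick \<psi>"
      then obtain \<kappa> where "x = Phi \<psi> \<kappa>" by (rule brickE)
      then have "x = ?p (Phi \<phi> (inv g \<kappa>))" using p1 assms(5) by simp
      then show "x \<in> ?p ` brick \<phi>" by blast
    qed
  qed
  moreover have "?p \<circ> ?p = id" using inv by (intro ext) simp
  ultimately show ?thesis
    unfolding flex.is_swap_def im using assms(3,4) clop_brick[OF assms(1)] p3 by blast
qed

text \<open>The product of the plain exchange and the exchange by \<open>g\<close> is
  \<open>g\<close> on the first brick and the inverse of \<open>g\<close> on the second. Composed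
  with the copy on the second brick it leaves the copy on the first.\<close>

lemma local_copy_transport:
  assumes "brick_label \<phi>" "brick_label \<psi>" "brick \<phi> \<inter> brick \<psi> = {}" "brick \<phi> \<union> brick \<psi> \<noteq> UNIV"
    "g \<in> twist_group G"
  shows "\<exists>z\<in>flex.swap_gen. local_copy \<phi> g = z \<circ> local_copy \<psi> g"
proof
  let ?z = "brick_swap \<phi> \<psi> id \<circ> brick_swap \<phi> \<psi> g"
  show "?z \<in> flex.swap_gen"
    using is_swap_brick_swap[OF assms(1-4) twist_group_id] is_swap_brick_swap[OF assms] flex.swap_gen_is_swap flex.swap_gen_comp by blast
  show "local_copy \<phi> g = ?z \<circ> local_copy \<psi> g"
  proof
    fix x
    have ni: "Phi \<psi> \<kappa> \<notin> brick \<phi>" "Phi \<phi> \<kappa> \<notin> brick \<psi>" for \<kappa> using assms(3) by auto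
    consider "x \<in> brick \<phi>" | "x \<in> brick \<psi>" | "x \<notin> brick \<phi>" "x \<notin> brick \<psi>" by blast
    then show "local_copy \<phi> g x = (?z \<circ> local_copy \<psi> g) x"
    proof cases
      case 1 then show ?thesis by (elim brickE) (simp add: ni local_copy_outside brick_swap_def)
    next
      case 2 then show ?thesis using assms(5)
        by (elim brickE) (simp add: ni local_copy_outside brick_swap_def)
    next
      case 3 then show ?thesis by (simp add: local_copy_outside brick_swap_def)
    qed
  qed
qed

end

section \<open>Swaps generate\<close>

definition insert_letter :: "'s \<Rightarrow> nat \<Rightarrow> bool \<Rightarrow> 's point \<Rightarrow> 's point" where
  "insert_letter s k a \<kappa> = \<kappa>(s := (\<lambda>i. if i < k then \<kappa> s i else if i = k then a else \<kappa> s (i - 1)))"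

definition delete_letter :: "'s \<Rightarrow> nat \<Rightarrow> 's point \<Rightarrow> 's point" where
  "delete_letter s k \<kappa> = \<kappa>(s := (\<lambda>i. if i < k then \<kappa> s i else \<kappa> s (Suc i)))"

definition swap_letters :: "'s \<Rightarrow> nat \<Rightarrow> 's point \<Rightarrow> 's point" where
  "swap_letters s k \<kappa> = \<kappa>(s := (\<kappa> s)(k := \<kappa> s (Suc k), Suc k := \<kappa> s k))"

lemma delete_letter_insert_letter [simp]: "delete_letter s k (insert_letter s k a \<kappa>) = \<kappa>"
  by (auto simp: delete_letter_def insert_letter_def fun_eq_iff)

lemma swap_letters_insert_letter: "swap_letters s k (insert_letter s k a \<kappa>)
    = insert_letter s (Suc k) a \<kappa>"
  by (auto simp: swap_letters_def insert_letter_def fun_eq_iff less_Suc_eq)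

lemma insert_letter_delete_letter [simp]: "insert_letter s k (\<kappa> s k) (delete_letter s k \<kappa>) = \<kappa>"
  by (auto simp: delete_letter_def insert_letter_def fun_eq_iff)

lemma swap_letters_swap_letters [simp]: "swap_letters s k (swap_letters s k \<kappa>) = \<kappa>"
  by (auto simp: swap_letters_def fun_eq_iff)

lemma insert_letter_Phi: "insert_letter s (length (\<phi> s)) a (Phi \<phi> \<kappa>)
    = Phi \<phi> (Phi (single_label s [a]) \<kappa>)"
  by (auto simp: insert_letter_def Phi_def concat_seq_def single_label_def fun_eq_iff)

lemma delete_letter_0_Phi [simp]: "delete_letter s 0 (Phi (single_label s [a]) \<kappa>) = \<kappa>"
  by (auto simp: delete_letter_def Phi_def concat_seq_def single_label_def fun_eq_iff)

context perm_group
begin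

lemma locally_twist_delete_letter: "locally_twist G (delete_letter s k) x"
proof (rule locally_twistI[of "cell_label {s} (Suc k) x" "cell_label {s} k x" id])
  show "delete_letter s k (Phi (cell_label {s} (Suc k) x) \<kappa>) = Phi (cell_label {s} k x) (tau id \<kappa>)"
    for \<kappa>
    by (auto simp: delete_letter_def Phi_def concat_seq_def cell_label_def fun_eq_iff simp del: upt_Suc)
qed auto

lemma locally_twist_swap_letters: "locally_twist G (swap_letters s k) x"
proof (rule locally_twistI[of "cell_label {s} (Suc (Suc k)) x"
  "cell_label {s} (Suc (Suc k)) (swap_letters s k x)" id])
  show "swap_letters s k (Phi (cell_label {s} (Suc (Suc k)) x) \<kappa>)
      = Phi (cell_label {s} (Suc (Suc k)) (swap_letters s k x)) (tau id \<kappa>)" for \<kappa>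
    by (auto simp: swap_letters_def Phi_def concat_seq_def cell_label_def fun_eq_iff less_Suc_eq simp del: upt_Suc)
qed auto

lemma swap_letters_twist_group: "swap_letters s k \<in> twist_group G"
  by (rule twist_groupI) (auto intro!: o_bij[of "swap_letters s k"] locally_twist_swap_letters simp: fun_eq_iff)

text \<open>The map moving the first letter of \<open>\<kappa> s\<close> to position \<open>m\<close> is reached by letting that letter
  travel one step at a time; in step \<open>k\<close> the letters \<open>k\<close> and \<open>k + 1\<close> of \<open>\<kappa> s\<close> are exchanged wherever
  \<open>m > k\<close>, which is a single swap. The hypothesis \<open>star\<close> makes this condition insensitive
  to the exchange.\<close>

lemma insertion_swap_gen:
  fixes m :: "'s point \<Rightarrow> nat"
  assumes mloc: "\<And>x. \<exists>\<phi>. brick_label \<phi> \<and> x \<in> brick \<phi> \<and> (\<forall>y\<in>brick \<phi>. m y = m x)"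
    and star: "\<And>x y. (\<And>t. t \<noteq> s \<Longrightarrow> x t = y t) \<Longrightarrow> (\<And>i. i < m x \<Longrightarrow> x s i = y s i) \<Longrightarrow> m y = m x"
    and bound: "\<And>x. m x \<le> K"
  shows "(\<lambda>\<kappa>. insert_letter s (m (delete_letter s 0 \<kappa>)) (\<kappa> s 0) (delete_letter s 0 \<kappa>)) \<in> flex.swap_gen"
proof -
  \<comment> \<open>Before step \<open>k\<close> a letter that is still travelling stands at
    position \<open>k\<close>; deleting it restores the point from which \<open>m\<close> has to be
    read.\<close>
  define \<sigma> where "\<sigma> k \<kappa> = (if m (delete_letter s k \<kappa>) > k then swap_letters s k \<kappa> else \<kappa>)" for k \<kappa>
  define P
    where "P k \<kappa> = insert_letter s (min k (m (delete_letter s 0 \<kappa>))) (\<kappa> s 0) (delete_letter s 0 \<kappa>)"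
      for k \<kappa>
  \<comment> \<open>By \<open>star\<close>, whether \<open>m\<close> exceeds \<open>k\<close> after
    the deletion is decided by the other coordinates and the letters before \<open>k\<close>, none
    of which step \<open>k\<close> changes.\<close>
  have C: "m (delete_letter s k y) > k" if "m (delete_letter s k x) > k" "\<And>t. t \<noteq> s \<Longrightarrow> x t = y t"
    "\<And>i. i < k \<Longrightarrow> x s i = y s i" for x y k
  proof (rule ccontr)
    assume a: "\<not> m (delete_letter s k y) > k"
    have "m (delete_letter s k x) = m (delete_letter s k y)"
      by (rule star) (use a that in \<open>auto simp: delete_letter_def\<close>)
    then show False using a that by simp
  qed
  have Cf: "m (delete_letter s k (swap_letters s k x)) > k \<longleftrightarrow> m (delete_letter s k x) > k" for k x
    using C[of k x "swap_letters s k x"] C[of k "swap_letters s k x" x]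
      by (auto simp: swap_letters_def)
  have \<sigma>\<sigma>: "\<sigma> k (\<sigma> k x) = x" for k x using Cf by (auto simp: \<sigma>_def)
  have M: "{\<kappa>. m \<kappa> > k} \<in> clop" for k
  proof (rule clop_local)
    fix x
    show "\<exists>\<phi>. brick_label \<phi> \<and> x \<in> brick \<phi> \<and> (\<forall>y\<in>brick \<phi>. y \<in> {\<kappa>. m \<kappa> > k} \<longleftrightarrow> x \<in> {\<kappa>. m \<kappa> > k})"
      using mloc[of x] by (metis mem_Collect_eq)
  qed
  have MD: "{\<kappa>. m (delete_letter s k \<kappa>) > k} \<in> clop" for k
    using clop_vimage[OF locally_twist_delete_letter M[of k], of s k] by (simp add: vimage_def)
  have sw: "\<sigma> k \<in> flex.swap_gen" for k
  proof (rule flex.swap_gen_is_swap)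
    \<comment> \<open>The exchanged halves are where letters \<open>k\<close> and
      \<open>k + 1\<close> read False, True and True, False; points with equal letters are fixed.
      The constant False point shows that the support is proper.\<close>
    let ?D = "{\<kappa>. m (delete_letter s k \<kappa>) > k} \<inter> ({\<kappa>. \<kappa> s k = False} \<inter> {\<kappa>. \<kappa> s (Suc k) = True})"
    have im: "x \<in> \<sigma> k ` ?D \<longleftrightarrow> m (delete_letter s k x) > k \<and> x s k \<and> \<not> x s (Suc k)" for x
    proof
      assume "x \<in> \<sigma> k ` ?D"
      then show "m (delete_letter s k x) > k \<and> x s k \<and> \<not> x s (Suc k)"
        using Cf by (auto simp: \<sigma>_def) (auto simp: swap_letters_def)
    next
      assume a: "m (delete_letter s k x) > k \<and> x s k \<and> \<not> x s (Suc k)"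
      then have "\<sigma> k x \<in> ?D" using Cf by (simp add: \<sigma>_def) (simp add: swap_letters_def)
      then show "x \<in> \<sigma> k ` ?D" using \<sigma>\<sigma>[of k x] by (metis imageI)
    qed
    have "\<sigma> k \<in> twist_group G"
    proof (rule twist_groupI)
      show "bij (\<sigma> k)" using \<sigma>\<sigma> by (intro o_bij[of "\<sigma> k"]) (auto simp: fun_eq_iff)
      show "locally_twist G (\<sigma> k) x" for x
      proof (cases "m (delete_letter s k x) > k")
        case True
        then show ?thesis using locally_twist_glue[OF MD[of k], of x "\<sigma> k"
          "swap_letters s k"] locally_twist_swap_letters by (simp add: \<sigma>_def)
      next
        case False
        then show ?thesis using locally_twist_fixed[OF clop_Compl[OF MD[of k]], of x "\<sigma> k"]
          by (simp add: \<sigma>_def)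
      qed
    qed
    moreover have "?D \<in> clop" by (intro clop_Int clop_coord MD)
    moreover have "\<sigma> k \<circ> \<sigma> k = id" using \<sigma>\<sigma> by (intro ext) simp
    moreover have "\<sigma> k ` ?D \<inter> ?D = {}" unfolding disjoint_iff im by simp
    moreover have "?D \<union> \<sigma> k ` ?D \<noteq> UNIV"
    proof -
      have "(\<lambda>_ _. False) \<notin> ?D \<union> \<sigma> k ` ?D" unfolding Un_iff im by simp
      then show ?thesis by (metis UNIV_I)
    qed
    moreover have "\<sigma> k x = x" if "x \<notin> ?D \<union> \<sigma> k ` ?D" for x
    proof -
      have "swap_letters s k x = x" if "x s k = x s (Suc k)" using that
        by (auto simp: swap_letters_def fun_eq_iff)
      then show ?thesis using that unfolding Un_iff im by (auto simp: \<sigma>_def)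
    qed
    ultimately show "flex.is_swap (\<sigma> k) ?D" unfolding flex.is_swap_def by blast
  qed
  have step: "P (Suc k) = \<sigma> k \<circ> P k" for k
  proof
    fix \<kappa>
    define \<kappa>' where "\<kappa>' = delete_letter s 0 \<kappa>"
    show "P (Suc k) \<kappa> = (\<sigma> k \<circ> P k) \<kappa>"
    proof (cases "m \<kappa>' > k")
      case True
      then have "P k \<kappa> = insert_letter s k (\<kappa> s 0) \<kappa>'"
        "P (Suc k) \<kappa> = insert_letter s (Suc k) (\<kappa> s 0) \<kappa>'"
        by (simp_all add: P_def \<kappa>'_def[symmetric])
      then show ?thesis using True by (simp add: \<sigma>_def swap_letters_insert_letter)
    next
      case False
      then have e: "P k \<kappa> = insert_letter s (m \<kappa>') (\<kappa> s 0) \<kappa>'" "P (Suc k) \<kappa> = P k \<kappa>"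
        by (simp_all add: P_def \<kappa>'_def[symmetric] min_def)
      \<comment> \<open>The letter has already stopped at position \<open>m \<kappa>'\<close>, so
        deleting position \<open>k\<close> may not give \<open>\<kappa>'\<close> back. The first
        \<open>m \<kappa>'\<close> letters at \<open>s\<close> still agree, which suffices for
        \<open>star\<close>.\<close>
      have "m (delete_letter s k (P k \<kappa>)) = m \<kappa>'"
        unfolding e by (rule star) (use False in \<open>auto simp: delete_letter_def insert_letter_def\<close>)
      then show ?thesis using False e by (simp add: \<sigma>_def)
    qed
  qed
  have "P k \<in> flex.swap_gen" for k
  proof (induction k)
    case 0
    have "P 0 = id" by (auto simp: P_def)
    then show ?case using flex.swap_gen_id by metis
  next
    case (Suc k)
    then show ?case using step sw flex.swap_gen_comp by metis
  qed
  then have "P K \<in> flex.swap_gen" .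
  moreover have "P K = (\<lambda>\<kappa>. insert_letter s (m (delete_letter s 0 \<kappa>)) (\<kappa> s 0) (delete_letter s 0 \<kappa>))"
    by (rule ext) (simp add: P_def min_absorb2[OF bound])
  ultimately show ?thesis by simp
qed

text \<open>The letter has to pass as many places as the label of the brick has letters at
  \<open>s\<close>. This number depends on the point only through its brick, and agreement off
  \<open>s\<close> and on that many letters at \<open>s\<close> keeps a point in the brick, which is
  the condition \<open>star\<close>.\<close>

lemma partition_insertion:
  fixes \<Lambda> :: "'s point \<Rightarrow> 's \<Rightarrow> bool list"
  assumes "\<And>x. brick_label (\<Lambda> x)" "\<And>x. x \<in> brick (\<Lambda> x)" "\<And>x y. y \<in> brick (\<Lambda> x) \<Longrightarrow> \<Lambda> y = \<Lambda> x"
    "finite (range \<Lambda>)"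
  shows "\<exists>p\<in>flex.swap_gen. \<forall>a x \<kappa>. p (Phi (single_label s [a]) (Phi (\<Lambda> x) \<kappa>))
      = Phi (\<Lambda> x) (Phi (single_label s [a]) \<kappa>)"
proof
  define m where "m x = length (\<Lambda> x s)" for x
  let ?p = "\<lambda>\<kappa>. insert_letter s (m (delete_letter s 0 \<kappa>)) (\<kappa> s 0) (delete_letter s 0 \<kappa>)"
  show "?p \<in> flex.swap_gen"
  proof (rule insertion_swap_gen)
    show "\<exists>\<phi>. brick_label \<phi> \<and> x \<in> brick \<phi> \<and> (\<forall>y\<in>brick \<phi>. m y = m x)" for x
      unfolding m_def using assms(1,2)[of x] assms(3)[of _ x] by metis
    show "m y = m x" if "\<And>t. t \<noteq> s \<Longrightarrow> x t = y t" "\<And>i. i < m x \<Longrightarrow> x s i = y s i" for x y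
    proof -
      have "is_prefix (\<Lambda> x t) (y t)" for t
      proof -
        have "is_prefix (\<Lambda> x t) (x t)" using assms(2)[of x] by (simp add: brick_def)
        then show ?thesis using that by (cases "t = s") (simp_all add: is_prefix_def m_def)
      qed
      then have "y \<in> brick (\<Lambda> x)" by (simp add: brick_def)
      then show ?thesis using assms(3) by (simp add: m_def)
    qed
    have "finite ((\<lambda>\<phi>. length (\<phi> s)) ` range \<Lambda>)" using assms(4) by simp
    then show "m x \<le> Max ((\<lambda>\<phi>. length (\<phi> s)) ` range \<Lambda>)" for x by (intro Max_ge) (auto simp: m_def)
  qed
  show "\<forall>a x \<kappa>. ?p (Phi (single_label s [a]) (Phi (\<Lambda> x) \<kappa>)) = Phi (\<Lambda> x) (Phi (single_label s [a]) \<kappa>)"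
  proof (intro allI)
    fix a x \<kappa>
    have "m (Phi (\<Lambda> x) \<kappa>) = length (\<Lambda> x s)" using assms(3)[of "Phi (\<Lambda> x) \<kappa>" x] by (simp add: m_def)
    then show "?p (Phi (single_label s [a]) (Phi (\<Lambda> x) \<kappa>)) = Phi (\<Lambda> x) (Phi (single_label s [a]) \<kappa>)"
      by (simp add: Phi_single_label_0 insert_letter_Phi)
  qed
qed

lemma twist_group_mono: "G' \<subseteq> G \<Longrightarrow> twist_group G' \<subseteq> twist_group G"
  using locally_twist_mono unfolding twist_group_def by blast

end

section \<open>The doubling relation\<close>

definition double_copy :: "'s \<Rightarrow> ('s point \<Rightarrow> 's point) \<Rightarrow> 's point \<Rightarrow> 's point" where
  "double_copy s g = local_copy (single_label s [False]) g \<circ> local_copy (single_label s [True]) g"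

lemma double_copy_Phi: "double_copy s g (Phi (single_label s [a]) \<kappa>) = Phi (single_label s [a]) (g \<kappa>)"
proof -
  have "Phi (single_label s [b]) \<kappa> \<notin> brick (single_label s [\<not> b])" for b \<kappa>
    using Phi_single_label_0[of s b \<kappa>] by (simp add: in_brick_single_label)
  from this[of True] this[of False] show ?thesis
    by (cases a) (simp_all add: double_copy_def local_copy_outside)
qed

context perm_group
begin

lemma double_copy_twist_group: "g \<in> twist_group G \<Longrightarrow> double_copy s g \<in> twist_group G"
  unfolding double_copy_def by (intro twist_group_comp local_copy_twist_group label_single_label)

text \<open>Here \<open>p\<close> moves the leading letter at \<open>s\<close> behind the label of a
  cell, and \<open>q\<close> does the same for the labels of the image bricks. Then
  \<open>g \<circ> p\<close> and \<open>q \<circ> double_copy s g\<close> differ only in the place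
  of that letter: a twist by \<open>c\<close> carries it to coordinate \<open>c s\<close> in the
  former, while it stays at \<open>s\<close> in the latter. The factor \<open>r\<close> moves it
  across, so it involves no permutation, and it vanishes when all twists are trivial.\<close>

lemma doubling_relation:
  assumes G': "perm_group G'" "G' \<subseteq> G" and g: "g \<in> twist_group G'"
  shows "\<exists>p\<in>flex.swap_gen. \<exists>q\<in>flex.swap_gen. \<exists>r\<in>twist_group {id}. g \<circ> p = r \<circ> q \<circ> double_copy s g
      \<and> (G' = {id} \<longrightarrow> r = id)"
proof -
  interpret G': perm_group G' by (rule G'(1))
  have gG: "g \<in> twist_group G" using g twist_group_mono[OF G'(2)] by blast
  obtain F n \<Psi> c where F: "finite F" and
    a: "\<And>x. brick_label (\<Psi> (cell_label F n x))" "\<And>x. c (cell_label F n x) \<in> G'"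
    "\<And>x. acts g (cell_label F n x) (\<Psi> (cell_label F n x)) (c (cell_label F n x))"
    using G'.uniform_acts[OF g] by blast
  define \<Lambda> where "\<Lambda> y = \<Psi> (cell_label F n (inv g y))" for y
  have im: "g ` brick (cell_label F n x) = brick (\<Psi> (cell_label F n x))" for x
    using G'.acts_image[OF a(3) G'.G_bij[OF a(2)]] .
  obtain p where p: "p \<in> flex.swap_gen"
    "\<And>a x \<kappa>. p (Phi (single_label s [a]) (Phi (cell_label F n x) \<kappa>))
        = Phi (cell_label F n x) (Phi (single_label s [a]) \<kappa>)"
    using partition_insertion[of "cell_label F n"
      s, OF label_cell_label[OF F] self_in_brick_cell_label cell_label_cong finite_range_cell_label[OF F]]
    by blast
  have "\<exists>q\<in>flex.swap_gen. \<forall>a x \<kappa>. q (Phi (single_label s [a]) (Phi (\<Lambda> x) \<kappa>))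
      = Phi (\<Lambda> x) (Phi (single_label s [a]) \<kappa>)"
  proof (rule partition_insertion)
    show "brick_label (\<Lambda> x)" for x using a(1) by (simp add: \<Lambda>_def)
    show "x \<in> brick (\<Lambda> x)" for x
    proof -
      have "g (inv g x) \<in> g ` brick (cell_label F n (inv g x))" using self_in_brick_cell_label
        by blast
      then show ?thesis using im gG by (simp add: \<Lambda>_def)
    qed
    show "\<Lambda> y = \<Lambda> x" if "y \<in> brick (\<Lambda> x)" for x y
    proof -
      have "y \<in> g ` brick (cell_label F n (inv g x))" using that im by (simp add: \<Lambda>_def)
      then have "inv g y \<in> brick (cell_label F n (inv g x))" using flex.in_image_iff[OF gG] by blast
      then show ?thesis unfolding \<Lambda>_def using cell_label_cong by metis
    qed
    have "range \<Lambda> \<subseteq> \<Psi> ` range (cell_label F n)" by (auto simp: \<Lambda>_def)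
    then show "finite (range \<Lambda>)" using finite_range_cell_label[OF F] finite_surj by blast
  qed
  then obtain q where q: "q \<in> flex.swap_gen"
    "\<And>a x \<kappa>. q (Phi (single_label s [a]) (Phi (\<Lambda> x) \<kappa>)) = Phi (\<Lambda> x) (Phi (single_label s [a]) \<kappa>)"
    by blast
  have \<Lambda>g: "\<Lambda> (g x) = \<Psi> (cell_label F n x)" for x using gG by (simp add: \<Lambda>_def)
  have pG: "p \<in> twist_group G" and qG: "q \<in> twist_group G" using p q flex.swap_gen_mem by auto
  let ?d = "q \<circ> double_copy s g"
  have dG: "?d \<in> twist_group G" using double_copy_twist_group[OF gG] qG twist_group_comp by blast
  define r where "r = g \<circ> p \<circ> inv ?d"
  have rd: "r \<circ> ?d = g \<circ> p"
  proof
    fix z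
    have "inv ?d (?d z) = z" using dG by (rule flex.inv_app)
    then show "(r \<circ> ?d) z = (g \<circ> p) z" by (simp add: r_def)
  qed
  have cover: "\<exists>a x \<kappa>. z = Phi (single_label s [a]) (Phi (cell_label F n x) \<kappa>)" for z
    by (metis first_letter brickE self_in_brick_cell_label)
  have d: "?d (Phi (single_label s [a]) (Phi (cell_label F n x) \<kappa>))
      = Phi (\<Psi> (cell_label F n x)) (Phi (single_label s [a]) (tau (c (cell_label F n x)) \<kappa>))" for a x \<kappa>
    using a(3)[of x] q(2)[of a "g x"] by (simp add: double_copy_Phi acts_def \<Lambda>g)
  have gp: "(g \<circ> p) (Phi (single_label s [a]) (Phi (cell_label F n x) \<kappa>))
      = Phi (\<Psi> (cell_label F n x)) (Phi (single_label s [a] \<circ> inv (c (cell_label F n x))) (tau (c (cell_label F n x)) \<kappa>))" for a x \<kappa>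
    using a(3)[of x] p(2)[of a x] by (simp add: acts_def tau_Phi)
  have "r \<in> twist_group {id}"
  proof -
    have "r \<in> twist_group G" unfolding r_def using gG pG dG twist_group_comp twist_group_inv
      by blast
    then have "bij r" by (rule twist_group_bij)
    moreover have "locally_twist {id} r y" for y
    proof -
      obtain a x \<kappa> where e: "inv ?d y = Phi (single_label s [a]) (Phi (cell_label F n x) \<kappa>)"
        using cover by blast
      let ?\<psi> = "\<Psi> (cell_label F n x)" and ?c = "c (cell_label F n x)"
      have b: "bij ?c" using a(2) G'.G_bij by blast
      have "y = ?d (inv ?d y)" using flex.inv_app(2)[OF dG] by metis
      then have y: "y = Phi (concat_label ?\<psi> (single_label s [a])) (tau ?c \<kappa>)"
        unfolding e d Phi_concat_label .
      show ?thesis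
      proof (rule locally_twistI[of "concat_label ?\<psi> (single_label s [a])"
        "concat_label ?\<psi> (single_label s [a] \<circ> inv ?c)" id])
        show "brick_label (concat_label ?\<psi> (single_label s [a]))" using a(1) by blast
        show "brick_label (concat_label ?\<psi> (single_label s [a] \<circ> inv ?c))"
          using a(1) label_perm[OF label_single_label bij_imp_bij_inv[OF b]] by blast
        show "id \<in> {id}" by simp
        show "y \<in> brick (concat_label ?\<psi> (single_label s [a]))" using y by simp
        fix \<kappa>'
        \<comment> \<open>Starting from the untwisted tail \<open>tau (inv ?c) \<kappa>'\<close>
          makes the same \<open>tau\<close> cancel on both sides, so that \<open>r\<close> acts with
          the identity permutation.\<close>
        have "r (?d (Phi (single_label s [a]) (Phi (cell_label F n x) (tau (inv ?c) \<kappa>'))))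
          = (g \<circ> p) (Phi (single_label s [a]) (Phi (cell_label F n x) (tau (inv ?c) \<kappa>')))"
          using rd by (metis comp_apply)
        then show "r (Phi (concat_label ?\<psi> (single_label s [a])) \<kappa>')
            = Phi (concat_label ?\<psi> (single_label s [a] \<circ> inv ?c)) (tau id \<kappa>')"
          unfolding d gp using b by (simp add: Phi_concat_label)
      qed
    qed
    ultimately show ?thesis unfolding twist_group_def by blast
  qed
  moreover have "r = id" if "G' = {id}"
  proof -
    have "c (cell_label F n x) = id" for x using a(2)[of x] that by simp
    then have "(g \<circ> p) z = ?d z" for z using cover[of z] gp d by (auto simp del: comp_apply)
    then have "g \<circ> p = ?d" by blast
    then have "r y = y" for y unfolding r_def using flex.inv_app(2)[OF dG, of y]
      by (metis comp_apply)
    then show ?thesis by (intro ext) simp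
  qed
  moreover have "g \<circ> p = r \<circ> q \<circ> double_copy s g" using rd by (simp add: comp_assoc)
  ultimately show ?thesis using p(1) q(1) by blast
qed

text \<open>Modulo swaps all local copies of \<open>g\<close> on proper bricks are equal, to \<open>x\<close> say; applying the
  hypothesis to the copy on the brick \<open>False\<close> gives \<open>x = x * x\<close>, so \<open>x = 1\<close> and \<open>g = x * x = 1\<close>.\<close>

lemma doubling_imp_swap_gen:
  assumes K: "K \<subseteq> twist_group G" "\<And>g \<phi>. g \<in> K \<Longrightarrow> brick_label \<phi> \<Longrightarrow> local_copy \<phi> g \<in> K"
    and rel: "\<And>g. g \<in> K \<Longrightarrow> \<exists>p\<in>flex.swap_gen. \<exists>q\<in>flex.swap_gen. g \<circ> p = q \<circ> double_copy s g"
  shows "K \<subseteq> flex.swap_gen"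
proof
  fix g assume g: "g \<in> K"
  then have gG: "g \<in> twist_group G" using K by blast
  let ?L = "\<lambda>w. local_copy (single_label s w) g"
  let ?tt = "\<lambda>(_::'s) (_::nat). True"
  let ?ft = "\<lambda>(_::'s) i. i \<noteq> (0::nat)"
  have tr: "\<exists>z\<in>flex.swap_gen. ?L u = z \<circ> ?L v"
    if "brick (single_label s u) \<inter> brick (single_label s v) = {}"
      "brick (single_label s u) \<union> brick (single_label s v) \<noteq> UNIV" for u v
    using local_copy_transport[OF label_single_label label_single_label that gG] .
  have d1: "brick (single_label s (False # u)) \<inter> brick (single_label s (True # v)) = {}" for u v
    by (force simp: in_brick_single_label)
  have d2: "brick (single_label s (True # u)) \<inter> brick (single_label s (False # v)) = {}" for u v
    by (force simp: in_brick_single_label)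
  \<comment> \<open>The bricks of \<open>[False]\<close> and \<open>[True]\<close> cover the space,
    so \<open>tr\<close> cannot compare their copies directly. The words of length two leave a point
    uncovered, and \<open>[False, False]\<close> is comparable both with
    \<open>[True, False]\<close> and with \<open>[True]\<close>.\<close>
  have "?tt \<notin> brick (single_label s [True, False])" "?tt \<notin> brick (single_label s [False])"
    by (auto simp: in_brick_single_label less_Suc_eq)
  then have n1: "brick (single_label s [True, False]) \<union> brick (single_label s [False]) \<noteq> UNIV"
    by (metis UNIV_I Un_iff)
  have "?ft \<notin> brick (single_label s [False, False])" "?ft \<notin> brick (single_label s [True, False])"
    "?ft \<notin> brick (single_label s [True])"
    by (auto simp: in_brick_single_label less_Suc_eq)
  then have n2: "brick (single_label s [True, False]) \<union> brick (single_label s [False, False]) \<noteq> UNIV"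
    "brick (single_label s [True]) \<union> brick (single_label s [False, False]) \<noteq> UNIV"
      by (metis UNIV_I Un_iff)+
  let ?y = "?L [False]"
  have yK: "?y \<in> K" using K(2)[OF g] by blast
  then have yG: "?y \<in> twist_group G" using K by blast
  obtain p q where pq: "p \<in> flex.swap_gen" "q \<in> flex.swap_gen" "?y \<circ> p = q \<circ> double_copy s ?y"
    using rel[OF yK] by blast
  have dy: "double_copy s ?y = ?L [False, False] \<circ> ?L [True, False]"
    by (simp add: double_copy_def local_copy_local_copy concat_label_single_label)
  obtain z where z: "z \<in> flex.swap_gen" "?L [True, False] = z \<circ> ?y" using tr[OF d2 n1] by blast
  have LG: "?L w \<in> twist_group G" for w using local_copy_twist_group[OF label_single_label gG] .
  have zG: "z \<in> twist_group G" "q \<in> twist_group G" "p \<in> twist_group G" using z pq flex.swap_gen_mem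
    by auto
  \<comment> \<open>The doubling relation for \<open>?y\<close> reads \<open>?y \<circ> p = q
    \<circ> ?L [False, False] \<circ> z \<circ> ?y\<close>; cancelling \<open>?y\<close> leaves
    swaps and a conjugate of \<open>p\<close>.\<close>
  have "?L [False, False] = inv q \<circ> (?y \<circ> p \<circ> inv ?y) \<circ> inv z"
  proof
    fix x
    have "(?y \<circ> p) (inv ?y (inv z x)) = (q \<circ> (?L [False, False] \<circ> (z \<circ> ?y))) (inv ?y (inv z x))"
      using pq(3) unfolding dy z(2) by simp
    then have "?y (p (inv ?y (inv z x))) = q (?L [False, False] x)" using zG yG by simp
    then show "?L [False, False] x = (inv q \<circ> (?y \<circ> p \<circ> inv ?y) \<circ> inv z) x" using zG by simp
  qed
  moreover have "inv q \<circ> (?y \<circ> p \<circ> inv ?y) \<circ> inv z \<in> flex.swap_gen"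
    using flex.swap_gen_comp flex.swap_gen_inv flex.swap_gen_conj[OF pq(1) yG] z(1) pq(2) by blast
  ultimately have ff: "?L [False, False] \<in> flex.swap_gen" by (simp only:)
  have tf: "?L [True, False] \<in> flex.swap_gen" using tr[OF d2 n2(1)] ff flex.swap_gen_comp by metis
  have t: "?L [True] \<in> flex.swap_gen" using tr[OF d2 n2(2)] ff flex.swap_gen_comp by metis
  have "?y = inv z \<circ> ?L [True, False]" unfolding z(2) using zG by (auto simp: fun_eq_iff)
  then have f: "?y \<in> flex.swap_gen" using flex.swap_gen_comp[OF flex.swap_gen_inv[OF z(1)] tf]
    by (simp only:)
  obtain p q where pq: "p \<in> flex.swap_gen" "q \<in> flex.swap_gen" "g \<circ> p = q \<circ> double_copy s g"
    using rel[OF g] by blast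
  have pG: "p \<in> twist_group G" using pq flex.swap_gen_mem by blast
  have "g = g \<circ> p \<circ> inv p" using pG by (auto simp: fun_eq_iff)
  then have "g = q \<circ> double_copy s g \<circ> inv p" unfolding pq(3) .
  moreover have "q \<circ> double_copy s g \<circ> inv p \<in> flex.swap_gen"
    unfolding double_copy_def by (intro flex.swap_gen_comp flex.swap_gen_inv pq f t)
  ultimately show "g \<in> flex.swap_gen" by (simp only:)
qed

lemma trivial_perm_group: "perm_group {id}"
  by unfold_locales (auto simp: inv_id)

text \<open>For the permutation group \<open>{id}\<close> the correction \<open>r\<close> of the
  doubling relation is trivial. In general it lies in \<open>twist_group {id}\<close>, so the first
  case absorbs it into the swaps. The swaps are those of \<open>twist_group G\<close> both
  times.\<close>

lemma twist_group_subset_swap_gen: "twist_group G \<subseteq> flex.swap_gen"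
proof -
  fix s :: 's
  have V: "twist_group {id} \<subseteq> flex.swap_gen"
  proof (rule doubling_imp_swap_gen[of _ s])
    show "twist_group {id} \<subseteq> twist_group G" by (rule twist_group_mono) simp
    show "local_copy \<phi> g \<in> twist_group {id}" if "g \<in> twist_group {id}" "brick_label \<phi>"
      for g and \<phi> :: "'s \<Rightarrow> bool list"
      using perm_group.local_copy_twist_group[OF trivial_perm_group that(2,1)] .
    show "\<exists>p\<in>flex.swap_gen. \<exists>q\<in>flex.swap_gen. g \<circ> p = q \<circ> double_copy s g"
      if g: "g \<in> twist_group {id}" for g
    proof -
      have "{id} \<subseteq> G" by simp
      from doubling_relation[OF trivial_perm_group this g, of s] obtain p q r
        where "p \<in> flex.swap_gen" "q \<in> flex.swap_gen" "g \<circ> p = r \<circ> q \<circ> double_copy s g" "r = id"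
          by blast
      then show ?thesis by auto
    qed
  qed
  show ?thesis
  proof (rule doubling_imp_swap_gen[of _ s])
    show "\<exists>p\<in>flex.swap_gen. \<exists>q\<in>flex.swap_gen. g \<circ> p = q \<circ> double_copy s g" if g: "g \<in> twist_group G"
      for g
    proof -
      from doubling_relation[OF perm_group_axioms order_refl g, of s] obtain p q r
        where "p \<in> flex.swap_gen" "q \<in> flex.swap_gen" "g \<circ> p = r \<circ> q \<circ> double_copy s g"
          "r \<in> twist_group {id}" by blast
      then show ?thesis using V flex.swap_gen_comp[of r q] by blast
    qed
  qed (auto intro: local_copy_twist_group)
qed

end

section \<open>The group as an abstract group\<close>

context flexible_action
begin

lemma swap_gen_finitary:
  assumes "finite A" "A \<subseteq> swap_gen"
  shows "\<exists>T. finite T \<and> (\<forall>p\<in>T. \<exists>D. is_swap p D) \<and> (\<forall>H. subgrp H \<longrightarrow> T \<subseteq> H \<longrightarrow> A \<subseteq> H)"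
proof -
  have one: "\<exists>T. finite T \<and> (\<forall>p\<in>T. \<exists>D. is_swap p D) \<and> (\<forall>H. subgrp H \<longrightarrow> T \<subseteq> H \<longrightarrow> x \<in> H)"
    if "x \<in> swap_gen" for x
    using that
  proof (induction rule: swap_gen.induct)
    case swap_gen_id
    then show ?case using subgrpD(2) by (intro exI[of _ "{}"]) blast
  next
    case (swap_gen_is_swap p D)
    then show ?case by (intro exI[of _ "{p}"]) blast
  next
    case (swap_gen_comp p q)
    then obtain T T' where T: "finite T" "finite T'" "\<forall>p\<in>T. \<exists>D. is_swap p D"
      "\<forall>p\<in>T'. \<exists>D. is_swap p D"
      "\<And>H. subgrp H \<Longrightarrow> T \<subseteq> H \<Longrightarrow> p \<in> H" "\<And>H. subgrp H \<Longrightarrow> T' \<subseteq> H \<Longrightarrow> q \<in> H" by metis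
    show ?case
    proof (intro exI[of _ "T \<union> T'"] conjI allI impI)
      show "p \<circ> q \<in> H" if "subgrp H" "T \<union> T' \<subseteq> H" for H
        using subgrpD(3)[OF that(1) T(5)[OF that(1)] T(6)[OF that(1)]] that(2) by simp
    qed (use T in blast)+
  qed
  show ?thesis
    using assms
  proof (induction A)
    case empty
    then show ?case by (intro exI[of _ "{}"]) blast
  next
    case (insert x A)
    then obtain T where T: "finite T" "\<forall>p\<in>T. \<exists>D. is_swap p D" "\<And>H. subgrp H \<Longrightarrow> T \<subseteq> H \<Longrightarrow> A \<subseteq> H" by auto
    have "x \<in> swap_gen" using insert.prems by simp
    from one[OF this] obtain T' where T': "finite T'" "\<forall>p\<in>T'. \<exists>D. is_swap p D"
      "\<And>H. subgrp H \<Longrightarrow> T' \<subseteq> H \<Longrightarrow> x \<in> H"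
      by auto
    show ?case
    proof (intro exI[of _ "T \<union> T'"] conjI allI impI)
      show "insert x A \<subseteq> H" if "subgrp H" "T \<union> T' \<subseteq> H" for H
        using T(3)[OF that(1)] T'(3)[OF that(1)] that(2) by simp
    qed (use T T' in blast)+
  qed
qed

text \<open>Finitely many generators involve finitely many swaps, and each swap is a commutator of
  two involutions. The conclusion is phrased with all pairs of distinct indices because the two
  generators constructed earlier yield all those commutators alike.\<close>

lemma finitely_many_commutators:
  assumes "finite A" "A \<subseteq> swap_gen" "\<And>H. subgrp H \<Longrightarrow> A \<subseteq> H \<Longrightarrow> \<Gamma> \<subseteq> H"
  shows "\<exists>ws (M :: nat). (\<forall>i<M. ws i \<in> \<Gamma> \<and> ws i \<circ> ws i = id) \<and>
    (\<forall>H. subgrp H \<longrightarrow> (\<forall>i<M. \<forall>j<M. i \<noteq> j \<longrightarrow> ws i \<circ> ws j \<circ> ws i \<circ> ws j \<in> H) \<longrightarrow> \<Gamma> \<subseteq> H)"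
proof -
  obtain T where T: "finite T" "\<forall>p\<in>T. \<exists>D. is_swap p D" "\<And>H. subgrp H \<Longrightarrow> T \<subseteq> H \<Longrightarrow> A \<subseteq> H"
    using swap_gen_finitary[OF assms(1,2)] by blast
  obtain ts where ts: "set ts = T" using finite_list[OF T(1)] by blast
  have "\<exists>uv. fst uv \<in> \<Gamma> \<and> snd uv \<in> \<Gamma> \<and> fst uv \<circ> fst uv = id \<and> snd uv \<circ> snd uv = id
      \<and> p = fst uv \<circ> snd uv \<circ> fst uv \<circ> snd uv" if pT: "p \<in> T" for p
  proof -
    obtain D where "is_swap p D" using bspec[OF T(2) pT] by (elim exE)
    from is_swap_commutator[OF this] obtain u v where uv: "u \<in> rist (D \<union> p ` D)"
      "v \<in> rist (D \<union> p ` D)"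
      "u \<circ> u = id" "v \<circ> v = id" "p = u \<circ> v \<circ> u \<circ> v" by (elim bexE conjE)
    show ?thesis using rist_mem[OF uv(1)] rist_mem[OF uv(2)] uv(3,4,5)
      by (intro exI[of _ "(u, v)"]) simp
  qed
  then obtain uv
    where uv: "\<And>p. p \<in> T \<Longrightarrow> fst (uv p) \<in> \<Gamma> \<and> snd (uv p) \<in> \<Gamma> \<and> fst (uv p) \<circ> fst (uv p) = id
      \<and> snd (uv p) \<circ> snd (uv p) = id \<and> p = fst (uv p) \<circ> snd (uv p) \<circ> fst (uv p) \<circ> snd (uv p)" by metis
  \<comment> \<open>The two involutions belonging to the \<open>i\<close>-th swap occupy the indices
    \<open>2 * i\<close> and \<open>2 * i + 1\<close>.\<close>
  define ws where "ws i = (if even i then fst (uv (ts ! (i div 2))) else snd (uv (ts ! (i div 2))))"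
    for i
  have "ws i \<in> \<Gamma> \<and> ws i \<circ> ws i = id" if "i < 2 * length ts" for i
  proof -
    have "ts ! (i div 2) \<in> T" using that ts by auto
    then show ?thesis using uv by (simp add: ws_def)
  qed
  moreover have "\<Gamma> \<subseteq> H" if H: "subgrp H"
    "\<forall>i<2 * length ts. \<forall>j<2 * length ts. i \<noteq> j \<longrightarrow> ws i \<circ> ws j \<circ> ws i \<circ> ws j \<in> H" for H
  proof -
    have "p \<in> H" if "p \<in> T" for p
    proof -
      obtain i where i: "i < length ts" "ts ! i = p" using \<open>p \<in> T\<close> ts by (metis in_set_conv_nth)
      then have "ws (2 * i) \<circ> ws (2 * i + 1) \<circ> ws (2 * i) \<circ> ws (2 * i + 1) \<in> H" using H(2) by simp
      moreover have "ws (2 * i) = fst (uv p)" "ws (2 * i + 1) = snd (uv p)" using i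
        by (simp_all add: ws_def)
      ultimately show ?thesis using uv[OF \<open>p \<in> T\<close>] by metis
    qed
    then show ?thesis using T(3)[OF H(1)] assms(3)[OF H(1)] by blast
  qed
  ultimately show ?thesis by (intro exI[of _ ws] exI[of _ "2 * length ts"]) blast
qed

end

section \<open>Translation to the algebraic statement\<close>

lemma perm_group_of_subgroup:
  assumes "subgroup G (BijGroup (UNIV :: 's set))"
  shows "perm_group G"
proof -
  interpret subgroup G "BijGroup (UNIV :: 's set)" by (rule assms)
  have B: "g \<in> Bij UNIV" if "g \<in> G" for g using mem_carrier[OF that] by (simp add: BijGroup_def)
  show ?thesis
  proof
    show "id \<in> G" using one_closed by (simp add: BijGroup_def id_def restrict_UNIV)
    show bij: "bij g" if "g \<in> G" for g using B[OF that] by (simp add: Bij_def)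
    show "g \<circ> h \<in> G" if "g \<in> G" "h \<in> G" for g h
      using m_closed[OF that] B[OF that(1)] B[OF that(2)]
        by (simp add: BijGroup_def compose_def comp_def restrict_UNIV)
    show "inv g \<in> G" if "g \<in> G" for g
      using m_inv_closed[OF that] inv_BijGroup[OF B[OF that]] by (simp add: restrict_UNIV)
  qed
qed

context perm_group
begin

lemma SV_group_simps [simp]:
  "carrier (SV_group G) = twist_group G" "x \<otimes>\<^bsub>SV_group G\<^esub> y = x \<circ> y" "\<one>\<^bsub>SV_group G\<^esub> = id"
  by (simp_all add: SV_group_def SV_eq_twist_group)

lemma group_SV: "group (SV_group G)"
proof (rule groupI)
  show "\<exists>y\<in>carrier (SV_group G). y \<otimes>\<^bsub>SV_group G\<^esub> x = \<one>\<^bsub>SV_group G\<^esub>" if "x \<in> carrier (SV_group G)"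
    for x
    using that twist_group_inv twist_group_bij by (intro bexI[of _ "inv x"]) (auto simp: bij_is_inj)
qed (auto simp: twist_group_comp twist_group_id comp_assoc)

lemma m_inv_SV: "x \<in> twist_group G \<Longrightarrow> m_inv (SV_group G) x = inv x"
  using group.inv_equality[OF group_SV, of "inv x" x] twist_group_inv twist_group_bij
    by (simp add: bij_is_inj)

lemma subgrp_iff: "flex.subgrp H \<longleftrightarrow> subgroup H (SV_group G)"
proof
  assume "flex.subgrp H"
  then show "subgroup H (SV_group G)"
    unfolding flex.subgrp_def using m_inv_SV by (intro subgroup.intro) auto
next
  assume H: "subgroup H (SV_group G)"
  have sub: "H \<subseteq> twist_group G" using subgroup.subset[OF H] by simp
  have "inv x \<in> H" if "x \<in> H" for x
    using subgroup.m_inv_closed[OF H that] m_inv_SV sub that by auto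
  then show "flex.subgrp H"
    unfolding flex.subgrp_def using sub subgroup.m_closed[OF H] subgroup.one_closed[OF H] by simp
qed

lemma pow_SV: "x [^]\<^bsub>SV_group G\<^esub> (n :: nat) = x ^^ n"
  by (induction n) (simp_all add: nat_pow_def funpow_swap1 fun_eq_iff SV_group_def)

lemma generate_SV:
  assumes "A \<subseteq> twist_group G"
  shows "generate (SV_group G) A = twist_group G \<longleftrightarrow> (\<forall>H. flex.subgrp H \<longrightarrow> A \<subseteq> H \<longrightarrow> twist_group G \<subseteq> H)"
proof
  assume "generate (SV_group G) A = twist_group G"
  then show "\<forall>H. flex.subgrp H \<longrightarrow> A \<subseteq> H \<longrightarrow> twist_group G \<subseteq> H"
    using group.generate_subgroup_incl[OF group_SV] subgrp_iff by metis
next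
  assume a: "\<forall>H. flex.subgrp H \<longrightarrow> A \<subseteq> H \<longrightarrow> twist_group G \<subseteq> H"
  have s: "subgroup (generate (SV_group G) A) (SV_group G)"
    using group.generate_is_subgroup[OF group_SV] assms by simp
  then have "twist_group G \<subseteq> generate (SV_group G) A"
    using a subgrp_iff generate.incl[of _ A "SV_group G"] by blast
  then show "generate (SV_group G) A = twist_group G" using subgroup.subset[OF s] by auto
qed

lemma twist_group_nontrivial: "twist_group G \<noteq> {id}"
proof
  assume a: "twist_group G = {id}"
  fix s :: 's
  have "swap_letters s 0 = id" using swap_letters_twist_group[of s 0] a by blast
  from fun_cong[OF this, of "\<lambda>_ i. i = 0"] have "swap_letters s 0 (\<lambda>_ i. i = 0) s 0" by simp
  then show False by (simp add: swap_letters_def)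
qed

lemma simple_SV: "simple_grp (SV_group G)"
  unfolding simple_grp_def
proof (intro conjI allI impI)
  show "group (SV_group G)" by (rule group_SV)
  show "carrier (SV_group G) \<noteq> {\<one>\<^bsub>SV_group G\<^esub>}" using twist_group_nontrivial by simp
  fix N assume N: "N \<lhd> SV_group G"
  then have sub: "flex.subgrp N" using subgrp_iff normal_imp_subgroup by blast
  show "N = {\<one>\<^bsub>SV_group G\<^esub>} \<or> N = carrier (SV_group G)"
  proof (cases "\<exists>f\<in>N. f \<noteq> id")
    case True
    then obtain f where f: "f \<in> N" "f \<noteq> id" by blast
    have "h \<circ> n \<circ> inv h \<in> N" if "h \<in> twist_group G" "n \<in> N" for h n
      using normal.inv_op_closed2[OF N, of h n] that m_inv_SV by simp
    from flex.normal_contains_swap_gen[OF sub this f] have "twist_group G \<subseteq> N"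
      using twist_group_subset_swap_gen by blast
    then show ?thesis using sub unfolding flex.subgrp_def by auto
  next
    case False
    then have "N = {id}" using sub unfolding flex.subgrp_def by blast
    then show ?thesis by simp
  qed
qed

lemma two_generators:
  assumes "finitely_generated (SV_group G)"
  shows "\<exists>a\<in>SV G. \<exists>b\<in>SV G. finite_order (SV_group G) a \<and> finite_order (SV_group G) b \<and>
    generate (SV_group G) {a, b} = SV G"
proof -
  obtain A where A: "finite A" "A \<subseteq> twist_group G" "generate (SV_group G) A = twist_group G"
    using assms by (auto simp: finitely_generated_def)
  then have "\<exists>ws (M :: nat). (\<forall>i<M. ws i \<in> twist_group G \<and> ws i \<circ> ws i = id) \<and>
    (\<forall>H. flex.subgrp H \<longrightarrow> (\<forall>i<M. \<forall>j<M. i \<noteq> j \<longrightarrow> ws i \<circ> ws j \<circ> ws i \<circ> ws j \<in> H) \<longrightarrow> twist_group G \<subseteq> H)"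
    using twist_group_subset_swap_gen generate_SV[OF A(2)]
      by (intro flex.finitely_many_commutators[of A]) auto
  then obtain ws and M :: nat where W: "\<forall>i<M. ws i \<in> twist_group G \<and> ws i \<circ> ws i = id"
    "\<forall>H. flex.subgrp H \<longrightarrow> (\<forall>i<M. \<forall>j<M. i \<noteq> j \<longrightarrow> ws i \<circ> ws j \<circ> ws i \<circ> ws j \<in> H) \<longrightarrow> twist_group G \<subseteq> H"
    by (elim exE conjE)
  have ws: "ws i \<in> twist_group G" "ws i \<circ> ws i = id" if "i < M" for i using W(1) that by auto
  have gen: "twist_group G \<subseteq> H"
    if "flex.subgrp H" "\<And>i j. i < M \<Longrightarrow> j < M \<Longrightarrow> i \<noteq> j \<Longrightarrow> ws i \<circ> ws j \<circ> ws i \<circ> ws j \<in> H" for H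
    using W(2)[rule_format, OF that(1)] that(2) by metis
  fix s :: 's
  \<comment> \<open>Prefixing a single letter at one coordinate embeds the space onto a proper
    brick, as the theorem on two generators requires.\<close>
  let ?\<phi> = "single_label s [True]"
  have nu: "brick ?\<phi> \<noteq> UNIV"
  proof
    assume "brick ?\<phi> = UNIV"
    then have "(\<lambda>_ _. False) \<in> brick ?\<phi>" by simp
    then show False by (auto simp: in_brick_single_label)
  qed
  have "\<exists>a\<in>twist_group G. \<exists>b\<in>twist_group G. (\<exists>n>0. a ^^ n = id) \<and> b \<circ> b = id \<and> (\<forall>H. flex.subgrp H
      \<longrightarrow> a \<in> H \<longrightarrow> b \<in> H \<longrightarrow> twist_group G \<subseteq> H)"
  proof (rule flex.two_torsion_generators[OF ws gen twist_group_subset_swap_gen inj_Phi[of ?\<phi>]])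
    show "range (Phi ?\<phi>) \<in> clop" "range (Phi ?\<phi>) \<noteq> UNIV"
      unfolding range_Phi by (rule clop_brick[OF label_single_label], rule nu)
    show "(\<lambda>x. if x \<in> range (Phi ?\<phi>) then Phi ?\<phi> (g (inv (Phi ?\<phi>) x)) else x) \<in> twist_group G"
      if "g \<in> twist_group G" for g
    proof -
      have "inv (Phi ?\<phi>) x = Phi_inv ?\<phi> x" if "x \<in> brick ?\<phi>" for x
        using Phi_Phi_inv[OF that] inj_Phi inv_f_f by metis
      then have "(\<lambda>x. if x \<in> range (Phi ?\<phi>) then Phi ?\<phi> (g (inv (Phi ?\<phi>) x)) else x) = local_copy ?\<phi> g"
        unfolding range_Phi local_copy_def by (intro ext) simp
      then show ?thesis using local_copy_twist_group[OF label_single_label that] by simp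
    qed
    show "inv (Phi ?\<phi>) \<circ> h \<circ> Phi ?\<phi> \<in> twist_group G" if "h \<in> flex.rist (range (Phi ?\<phi>))" for h
      using rist_unloc[OF label_single_label] that unfolding range_Phi by blast
  qed
  then obtain a b n where ab: "a \<in> twist_group G" "b \<in> twist_group G" "n > 0" "a ^^ n = id"
    "b \<circ> b = id"
    "\<forall>H. flex.subgrp H \<longrightarrow> a \<in> H \<longrightarrow> b \<in> H \<longrightarrow> twist_group G \<subseteq> H"
    by (elim bexE exE conjE)
  have "b ^^ 2 = id" using ab(5) by (simp add: numeral_2_eq_2)
  then have "finite_order (SV_group G) b" unfolding finite_order_def pow_SV
    by (intro exI[of _ 2]) simp
  moreover have "finite_order (SV_group G) a" unfolding finite_order_def pow_SV using ab by auto
  moreover have "generate (SV_group G) {a, b} = twist_group G" using generate_SV[of "{a, b}"] ab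
    by simp
  ultimately show ?thesis unfolding SV_eq_twist_group using ab by blast
qed

end

theorem theorem3p4:
  fixes G :: "('s \<Rightarrow> 's) set"
  assumes "subgroup G (BijGroup (UNIV :: 's set))"
  shows "simple_grp (SV_group G) \<and>
    (finitely_generated (SV_group G) \<longrightarrow>
      (\<exists>a \<in> SV G. \<exists>b \<in> SV G. finite_order (SV_group G) a \<and> finite_order (SV_group G) b \<and>
         generate (SV_group G) {a, b} = SV G))"
proof -
  interpret perm_group G by (rule perm_group_of_subgroup[OF assms])
  show ?thesis using simple_SV two_generators by blast
qed

end
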